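(* Let $E$ be a complex Banach lattice and let $T \in \mathcal{L}(E)$ with spectral radius $r(T) = 1$ be positive and irreducible. Assume that the peripheral point spectrum of $T$ is non-empty and that $T$ is (WS)-bounded. Then the following assertions hold: (a) For every $x \in E$ with $x > 0$ we have $T^kx \not\to 0$ as $k \to \infty$. (b) Whenever $z \in \ker(\lambda-T)$ for a peripheral eigenvalue $\lambda$ of $T$, then $|z| \in \ker(1-T)$. (c) $1$ is an eigenvalue of $T$ and the corresponding eigenspace $\ker(1-T)$ is a one-dimensional sublattice of $E$ which is spanned by a quasi-interior point of $E_+$. (d) For each peripheral eigenvalue $\lambda$ of $T$ the operators $T$ and $\lambda T$ are similar. In particular, $\lambda\sigma(T) = \sigma(T)$ and $\lambda\sigma_{\mathrm{pnt}}(T) = \sigma_{\mathrm{pnt}}(T)$. (e) The peripheral point spectrum of $T$ is a subgroup of the complex unit circle. (f) Each peripheral eigenvalue $\lambda$ of $T$ is an algebraically simple eigenvalue of $T$, i.e. $\dim \bigcup_{n \in \mathbb{N}} \ker((\lambda-T)^n) = \dim \ker(\lambda-T) = 1$. (g) The only eigenvalue of $T$ which admits a positive eigenvector is $1$.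
   Context: $\mathcal{L}(E)$ is the space of bounded linear operators on $E$; $\mathbb{N}=\{1,2,\dots\}$, $\mathbb{N}_0=\mathbb{N}\cup\{0\}$. $E_+ := \{x \in E : x \ge 0\}$; $x>0$ means $x \ge 0$ and $x \ne 0$. $T$ is positive if $TE_+ \subset E_+$; $T$ is irreducible if the only $T$-invariant closed (lattice) ideals of $E$ are $\{0\}$ and $E$. $\sigma(T)$ is the spectrum, $\sigma_{\mathrm{pnt}}(T)$ the point spectrum (set of eigenvalues) and $\sigma_{\mathrm{per}}(T) := \{\lambda \in \sigma(T) : |\lambda| = r(T)\}$ the peripheral spectrum of $T$. The peripheral point spectrum is $\sigma_{\mathrm{per}}(T)\cap\sigma_{\mathrm{pnt}}(T)$ and its elements are the peripheral eigenvalues. A positive eigenvector is an eigenvector $z$ with $z \geq 0$ (hence $z>0$). Two operators $S,T\in\mathcal{L}(E)$ are similar if there is a bijection $V\in\mathcal{L}(E)$ with $T=V^{-1}SV$. A closed vector subspace $F\subset E$ is a sublattice if $F$ is conjugation invariant and $|f|\in F$ for all $f\in F$. For $x \in E_+$ let $E_x := \{y\in E : \exists c>0,\ |y|\le cx\}$; $x$ is a quasi-interior point of $E_+$ if $E_x$ is dense in $E$. Weighting schemes: let $\overline{\mathbb{D}}\subset\mathbb{C}$ be the closed unit disk; a function $f:\overline{\mathbb{D}}\to\mathbb{C}$ is called analytic if it has an analytic extension to some open neighbourhood of $\overline{\mathbb{D}}$. A net $(f_j)_{j\in J}$ of analytic functions $f_j:\overline{\mathbb{D}}\to\mathbb{C}$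 is a weighting scheme if: $f_j(1)=1$ for all $j\in J$; $f_j^{(k)}(0)\ge 0$ for all $j\in J$, $k\in\mathbb{N}_0$; and $|f_j(z)|\to 0$ (along $j$) for every $z\in\mathbb{C}$ with $|z|<1$. An operator $T\in\mathcal{L}(E)$ with $r(T)=1$ is (WS)-bounded if there is a weighting scheme $(f_j)_{j\in J}$ such that $\{f_j(T) : j\in J\}$ is bounded in operator norm, where $f_j(T)$ is defined by the analytic functional calculus. *)

theory Defs
  imports
    "HOL-Complex_Analysis.Complex_Analysis"
    "HOL-Algebra.Group"
    "HOL-Library.Complex_Order"
begin

unbundle no m_inv_syntax  \<comment> \<open>\<open>inv\<close> denotes inverse functions here\<close>

section \<open>Complex Banach spaces\<close>

class scaleC = scaleR +
  fixes scaleC :: "complex \<Rightarrow> 'a \<Rightarrow> 'a"  (infixr \<open>*\<^sub>C\<close> 75)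
  assumes scaleR_scaleC: "scaleR r = scaleC (complex_of_real r)"

class complex_vector = scaleC + real_vector +
  assumes scaleC_add_right: "c *\<^sub>C (x + y) = c *\<^sub>C x + c *\<^sub>C y"
    and scaleC_add_left: "(b + c) *\<^sub>C x = b *\<^sub>C x + c *\<^sub>C x"
    and scaleC_scaleC: "b *\<^sub>C (c *\<^sub>C x) = (b * c) *\<^sub>C x"
    and scaleC_one: "1 *\<^sub>C x = x"

class complex_normed_vector = complex_vector + real_normed_vector +
  assumes norm_scaleC: "norm (c *\<^sub>C x) = cmod c * norm x"

class complex_banach = complex_normed_vector + complete_space

global_interpretation cvec: vector_space "scaleC :: complex \<Rightarrow> 'a \<Rightarrow> 'a :: complex_vector"
  defines csubspace = cvec.subspace
    and cspan = cvec.span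
    and cdependent = cvec.dependent
    and cdim = cvec.dim
    and crepresentation = cvec.representation
    and cextend_basis = cvec.extend_basis
  by unfold_locales (auto simp: scaleC_add_right scaleC_add_left scaleC_scaleC scaleC_one)


section \<open>Complex Banach lattices\<close>

text \<open>
  A conjugation is a conjugate-linear involution; it makes the space the complexification
  of the real vector space of its fixed points.
\<close>

class complex_conj_vector = complex_vector +
  fixes vconj :: "'a \<Rightarrow> 'a"
  assumes vconj_add: "vconj (x + y) = vconj x + vconj y"
    and vconj_scaleC: "vconj (c *\<^sub>C x) = cnj c *\<^sub>C vconj x"
    and vconj_vconj: "vconj (vconj x) = x"
begin

definition real_part :: "'a \<Rightarrow> 'a"
  where "real_part x = (1/2) *\<^sub>R (x + vconj x)"

end

text \<open>
  A complex Banach lattice is the complexification of a real Banach lattice: the fixed points of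
  the conjugation carry the order of a real Banach lattice, the modulus of \<open>z\<close> is the
  supremum of the elements \<open>Re (e\<^sup>i\<^sup>t z)\<close> for real \<open>t\<close>, and the norm of \<open>z\<close> is the norm of its
  modulus.  The order is extended to the whole space by letting \<open>x \<le> y\<close> mean that \<open>y - x\<close> is in
  the cone of positive elements, which consists of real elements only; in particular
  \<open>0 < x\<close> means that \<open>x\<close> is positive and non-zero.  The modulus is a parameter of the
  class, but it is determined by the order through the axioms \<open>abs_upper\<close> and \<open>abs_least\<close>;
  in the complexification of a real Banach lattice the supremum always exists.
\<close>

class complex_banach_lattice = complex_banach + complex_conj_vector + ordered_real_vector + abs +
  assumes nonneg_real: "0 \<le> x \<Longrightarrow> vconj x = x"
    and real_sup_exists: "vconj x = x \<Longrightarrow> vconj y = y \<Longrightarrow>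
          \<exists>s. x \<le> s \<and> y \<le> s \<and> (\<forall>u. x \<le> u \<longrightarrow> y \<le> u \<longrightarrow> s \<le> u)"
    and abs_upper: "real_part (cis t *\<^sub>C z) \<le> \<bar>z\<bar>"
    and abs_least: "(\<And>t. real_part (cis t *\<^sub>C z) \<le> u) \<Longrightarrow> \<bar>z\<bar> \<le> u"
    and norm_abs: "norm \<bar>z\<bar> = norm z"
    and norm_mono: "0 \<le> x \<Longrightarrow> x \<le> y \<Longrightarrow> norm x \<le> norm y"

text \<open>The scalar field is a complex Banach lattice.\<close>

instantiation complex :: complex_banach
begin

definition scaleC_complex :: "complex \<Rightarrow> complex \<Rightarrow> complex"
  where "scaleC_complex = (*)"

instance
  by standard
    (auto simp: scaleC_complex_def scaleR_conv_of_real algebra_simps norm_mult)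

end

instantiation complex :: complex_conj_vector
begin

definition vconj_complex :: "complex \<Rightarrow> complex"
  where "vconj_complex = cnj"

instance
  by standard (simp_all add: vconj_complex_def scaleC_complex_def)

end

lemma real_part_complex: "real_part w = complex_of_real (Re w)" for w :: complex
  by (simp add: real_part_def vconj_complex_def complex_eq_iff)

instance complex :: complex_banach_lattice
proof
  fix x y z u :: complex and t :: real
  show "0 \<le> x \<Longrightarrow> vconj x = x"
    by (simp add: vconj_complex_def less_eq_complex_def complex_eq_iff)
  show "vconj x = x \<Longrightarrow> vconj y = y \<Longrightarrow>
          \<exists>s. x \<le> s \<and> y \<le> s \<and> (\<forall>u. x \<le> u \<longrightarrow> y \<le> u \<longrightarrow> s \<le> u)"
    by (rule exI [of _ "if x \<le> y then y else x"])
      (auto simp: vconj_complex_def less_eq_complex_def complex_eq_iff)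
  show "real_part (cis t *\<^sub>C z) \<le> \<bar>z\<bar>"
  proof -
    have "Re (cis t * z) \<le> cmod z"
      by (metis complex_Re_le_cmod norm_cis norm_mult mult_1)
    then show ?thesis
      by (simp add: real_part_complex abs_complex_def less_eq_complex_def scaleC_complex_def)
  qed
  show "\<bar>z\<bar> \<le> u" if *: "\<And>t. real_part (cis t *\<^sub>C z) \<le> u"
  proof -
    have "cis (- Arg z) * z = cis (- Arg z) * (complex_of_real (cmod z) * cis (Arg z))"
      by (metis rcis_cmod_Arg rcis_def)
    also have "\<dots> = complex_of_real (cmod z)"
      by (simp add: cis_mult mult.left_commute)
    finally show ?thesis
      using * [of "- Arg z"] by (simp add: real_part_complex abs_complex_def scaleC_complex_def)
  qed
  show "norm \<bar>z\<bar> = norm z"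
    by (simp add: abs_complex_def)
  show "0 \<le> x \<Longrightarrow> x \<le> y \<Longrightarrow> norm x \<le> norm y"
    by (auto simp: less_eq_complex_def cmod_def)
qed

definition lattice_ideal :: "'a::complex_banach_lattice set \<Rightarrow> bool"
  where "lattice_ideal I \<longleftrightarrow> csubspace I \<and> (\<forall>x y. y \<in> I \<longrightarrow> \<bar>x\<bar> \<le> \<bar>y\<bar> \<longrightarrow> x \<in> I)"

definition closed_sublattice :: "'a::complex_banach_lattice set \<Rightarrow> bool"
  where "closed_sublattice F \<longleftrightarrow>
    csubspace F \<and> closed F \<and> (\<forall>f\<in>F. vconj f \<in> F) \<and> (\<forall>f\<in>F. \<bar>f\<bar> \<in> F)"

definition principal_ideal :: "'a::complex_banach_lattice \<Rightarrow> 'a set"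
  where "principal_ideal x = {y. \<exists>c>0. \<bar>y\<bar> \<le> c *\<^sub>R x}"

definition quasi_interior :: "'a::complex_banach_lattice \<Rightarrow> bool"
  where "quasi_interior x \<longleftrightarrow> 0 \<le> x \<and> closure (principal_ideal x) = UNIV"


section \<open>Operators and spectra\<close>

definition bounded_clinear :: "('a::complex_normed_vector \<Rightarrow> 'b::complex_normed_vector) \<Rightarrow> bool"
  where "bounded_clinear T \<longleftrightarrow> bounded_linear T \<and> (\<forall>c x. T (c *\<^sub>C x) = c *\<^sub>C T x)"

definition positive_op :: "('a::complex_banach_lattice \<Rightarrow> 'a) \<Rightarrow> bool"
  where "positive_op T \<longleftrightarrow> (\<forall>x\<ge>0. 0 \<le> T x)"

definition irreducible_op :: "('a::complex_banach_lattice \<Rightarrow> 'a) \<Rightarrow> bool"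
  where "irreducible_op T \<longleftrightarrow>
    (\<forall>I. closed I \<longrightarrow> lattice_ideal I \<longrightarrow> T ` I \<subseteq> I \<longrightarrow> I = {0} \<or> I = UNIV)"

definition ker :: "('a \<Rightarrow> 'b::zero) \<Rightarrow> 'a set"
  where "ker S = {x. S x = 0}"

text \<open>The operator \<open>\<lambda> - T\<close>.\<close>

definition shift :: "complex \<Rightarrow> ('a::complex_vector \<Rightarrow> 'a) \<Rightarrow> 'a \<Rightarrow> 'a"
  where "shift l T = (\<lambda>x. l *\<^sub>C x - T x)"

definition spectrum :: "('a::complex_normed_vector \<Rightarrow> 'a) \<Rightarrow> complex set"
  where "spectrum T =
    {l. \<not> (\<exists>R. bounded_clinear R \<and> R \<circ> shift l T = id \<and> shift l T \<circ> R = id)}"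

definition spectral_radius :: "('a::complex_normed_vector \<Rightarrow> 'a) \<Rightarrow> real"
  where "spectral_radius T = (SUP l\<in>spectrum T. cmod l)"

definition point_spectrum :: "('a::complex_vector \<Rightarrow> 'a) \<Rightarrow> complex set"
  where "point_spectrum T = {l. \<exists>x. x \<noteq> 0 \<and> T x = l *\<^sub>C x}"

definition peripheral_spectrum :: "('a::complex_normed_vector \<Rightarrow> 'a) \<Rightarrow> complex set"
  where "peripheral_spectrum T = {l \<in> spectrum T. cmod l = spectral_radius T}"

definition peripheral_point_spectrum :: "('a::complex_normed_vector \<Rightarrow> 'a) \<Rightarrow> complex set"
  where "peripheral_point_spectrum T = peripheral_spectrum T \<inter> point_spectrum T"

definition similar_op :: "('a::complex_normed_vector \<Rightarrow> 'a) \<Rightarrow> ('a \<Rightarrow> 'a) \<Rightarrow> bool"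
  where "similar_op S T \<longleftrightarrow> (\<exists>V. bounded_clinear V \<and> bij V \<and> T = inv V \<circ> S \<circ> V)"

definition unit_circle_group :: "complex monoid"
  where "unit_circle_group = \<lparr>carrier = sphere 0 1, monoid.mult = (*), one = 1\<rparr>"


section \<open>The analytic functional calculus and weighting schemes\<close>

text \<open>
  The resolvent integral of \<open>f\<close> along the path \<open>g\<close>; the integrand is spelled out as in the
  library definition of contour integrals, which covers complex-valued functions only.  The
  operator-valued integral is taken pointwise: for a path in the resolvent set, on which \<open>f\<close>
  is continuous, this is the same as integrating in operator norm.  On the resolvent set the
  inverse function is the resolvent.
\<close>

definition resolvent_integral ::
  "(real \<Rightarrow> complex) \<Rightarrow> (complex \<Rightarrow> complex) \<Rightarrow> ('a::complex_banach \<Rightarrow> 'a) \<Rightarrow> 'a \<Rightarrow> 'a"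
  where "resolvent_integral g f T x =
    (1 / (2 * of_real pi * \<i>)) *\<^sub>C
    integral {0..1} (\<lambda>t. (f (g t) * vector_derivative g (at t within {0..1})) *\<^sub>C
                          inv (shift (g t) T) x)"

text \<open>
  The operator \<open>f(T)\<close> for \<open>f\<close> analytic on a closed disk around 0 of radius greater than the
  spectral radius.  By Cauchy's theorem, the choice of the radius is immaterial.
\<close>

definition analytic_calculus ::
  "(complex \<Rightarrow> complex) \<Rightarrow> ('a::complex_banach \<Rightarrow> 'a) \<Rightarrow> 'a \<Rightarrow> 'a"
  where "analytic_calculus f T =
    resolvent_integral
      (circlepath 0 (SOME \<rho>. spectral_radius T < \<rho> \<and> 0 < \<rho> \<and> f analytic_on cball 0 \<rho>)) f T"

definition directed_on :: "'j set \<Rightarrow> ('j \<Rightarrow> 'j \<Rightarrow> bool) \<Rightarrow> bool"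
  where "directed_on J R \<longleftrightarrow>
    J \<noteq> {} \<and> (\<forall>i\<in>J. R i i) \<and>
    (\<forall>i\<in>J. \<forall>j\<in>J. \<forall>k\<in>J. R i j \<longrightarrow> R j k \<longrightarrow> R i k) \<and>
    (\<forall>i\<in>J. \<forall>j\<in>J. \<exists>k\<in>J. R i k \<and> R j k)"

text \<open>The filter of tails, along which nets indexed by a directed set converge.\<close>

definition net_filter :: "'j set \<Rightarrow> ('j \<Rightarrow> 'j \<Rightarrow> bool) \<Rightarrow> 'j filter"
  where "net_filter J R = (INF i\<in>J. principal {j\<in>J. R i j})"

text \<open>
  An analytic function on the closed unit disk is represented by any function on the complex
  plane that is an analytic extension of it near the closed unit disk.
\<close>

definition weighting_scheme ::
  "'j set \<Rightarrow> ('j \<Rightarrow> 'j \<Rightarrow> bool) \<Rightarrow> ('j \<Rightarrow> complex \<Rightarrow> complex) \<Rightarrow> bool"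
  where "weighting_scheme J R f \<longleftrightarrow>
    directed_on J R \<and>
    (\<forall>j\<in>J. f j analytic_on cball 0 1) \<and>
    (\<forall>j\<in>J. f j 1 = 1) \<and>
    (\<forall>j\<in>J. \<forall>k. (deriv ^^ k) (f j) 0 \<in> \<real>\<^sub>\<ge>\<^sub>0) \<and>
    (\<forall>z. cmod z < 1 \<longrightarrow> ((\<lambda>j. cmod (f j z)) \<longlongrightarrow> 0) (net_filter J R))"

text \<open>
  Weighting schemes are indexed by arbitrary directed sets, but HOL does not allow to quantify
  over types within a formula.  The type of the indices is therefore an argument; a theorem
  assuming \<open>ws_bounded TYPE('j) T\<close> for a type variable \<open>'j\<close> holds for all weighting schemes.
\<close>

definition ws_bounded :: "'j itself \<Rightarrow> ('a::complex_banach \<Rightarrow> 'a) \<Rightarrow> bool"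
  where "ws_bounded _ T \<longleftrightarrow>
    (\<exists>(J :: 'j set) R f. weighting_scheme J R f \<and>
       bdd_above ((\<lambda>j. onorm (analytic_calculus (f j) T)) ` J))"

end

theory Submission
  imports Defs
begin

text \<open>
  Let \<open>z\<close> be a peripheral eigenvector and \<open>u = \<bar>z\<bar>\<close>.  Positivity gives \<open>u \<le> T u\<close>, so that the
  whole question is why \<open>u \<le> T u\<close> must be an equation and how the phase of \<open>z\<close> acts on the space.

  Expanding the functions of a weighting scheme in power series turns (WS)-boundedness into the
  existence of uniformly bounded averages \<open>A\<^sub>n = \<Sum>\<^sub>k a\<^sub>n\<^sub>k T\<^sup>k\<close> whose non-negative weights sum to 1 and
  escape to infinity (\<open>ws_bounded_averages\<close>).  Choose a positive functional \<open>\<phi>\<close> with \<open>\<phi> u > 0\<close>.  The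
  vectors \<open>x\<close> for which \<open>\<phi> (A\<^sub>n (T\<^sup>k \<bar>x\<bar>))\<close> tends to 0 for all \<open>k\<close> form a closed \<open>T\<close>-invariant ideal.
  It does not contain \<open>u\<close>, because \<open>A\<^sub>n u \<ge> u\<close>, so it is trivial by irreducibility (\<open>average_null\<close>).
  On the other hand it contains every \<open>x\<close> with \<open>T\<^sup>k x \<rightarrow> 0\<close> (\<open>orbit_not_null\<close>).  It also contains
  \<open>T u - u\<close>: the numbers \<open>\<phi> (T\<^sup>k u)\<close> increase, boundedness of the averages bounds them, and for
  every \<open>k\<close>, \<open>\<phi> (A\<^sub>n (T\<^sup>k u))\<close> tends to their limit as well.  Hence \<open>T u = u\<close>
  (\<open>subharmonic_fixed\<close>).

  A positive fixed vector generates a dense ideal, thus two disjoint positive fixed vectors cannot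
  both be non-zero.  So the real fixed vectors are totally ordered, which makes the fixed space
  one-dimensional and excludes Jordan chains at 1.

  For the rotational symmetry, the ideal generated by \<open>u\<close> is treated like an algebra of continuous
  functions with unit \<open>u\<close>.  Instead of a representation theorem only the points are used: the
  lattice homomorphisms \<open>\<phi>\<close> of the ideal with \<open>\<phi> u = 1\<close> determine the order, and there are products
  with respect to them (\<open>character_attains_gauge\<close>, \<open>multiplicable_in_ideal\<close>).  At each such point \<open>\<phi>\<close>
  the functional \<open>\<phi> \<circ> T\<close> is a mean value that takes the unimodular \<open>z\<close> to the unimodular number
  \<open>\<lambda> \<phi>(z)\<close>; so it is concentrated where \<open>z\<close> has this value, that is, \<open>T (z f) = \<lambda> z T f\<close>
  (\<open>mult_intertwines\<close>).  Multiplication by \<open>z\<close> is an isometry and extends to the whole space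
  (\<open>eigenvector_rotation\<close>); it is a similarity between \<open>T\<close> and \<open>\<lambda> T\<close> and carries the fixed space
  to the eigenspace of \<open>\<lambda>\<close>.  Everything that is claimed about peripheral eigenvalues follows.

  The lattice homomorphisms and the functional \<open>\<phi>\<close> come from the same application of Zorn's lemma,
  to sublinear functionals (\<open>exists_linear_functional\<close>).
\<close>

section \<open>Complex vector spaces with a conjugation\<close>

lemma scaleC_of_real: "complex_of_real r *\<^sub>C x = r *\<^sub>R x"
  by (simp add: scaleR_scaleC)

lemma scaleC_scaleR: "c *\<^sub>C (r *\<^sub>R x) = (c * of_real r) *\<^sub>C (x::'a::complex_vector)"
  by (simp add: scaleR_scaleC scaleC_scaleC)

lemma scaleR_scaleC_assoc: "r *\<^sub>R (c *\<^sub>C x) = (of_real r * c) *\<^sub>C (x::'a::complex_vector)"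
  by (simp add: scaleR_scaleC scaleC_scaleC)

instance complex_banach \<subseteq> banach ..

lemma cdim_span_singleton: "x \<noteq> 0 \<Longrightarrow> cdim (cspan {x}) = 1"
proof -
  assume "x \<noteq> 0"
  then have "\<not> cdependent {x}" by (simp add: cvec.dependent_single)
  then have "cdim (cspan {x}) = card {x}" by (rule cvec.dim_span_eq_card_independent)
  then show ?thesis by simp
qed

lemma bounded_bilinear_scaleC:
  "bounded_bilinear (scaleC :: complex \<Rightarrow> 'a \<Rightarrow> 'a::complex_normed_vector)"
  by unfold_locales
    (auto simp: scaleC_add_left scaleC_add_right scaleC_scaleR scaleR_scaleC_assoc scaleR_conv_of_real
      scaleC_scaleC norm_scaleC intro!: exI [of _ 1])

lemmas tendsto_scaleC = bounded_bilinear.tendsto [OF bounded_bilinear_scaleC]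
lemmas continuous_on_scaleC = bounded_bilinear.continuous_on [OF bounded_bilinear_scaleC]
lemmas bounded_linear_scaleC_right = bounded_bilinear.bounded_linear_right [OF bounded_bilinear_scaleC]
lemmas bounded_linear_scaleC_left = bounded_bilinear.bounded_linear_left [OF bounded_bilinear_scaleC]

lemma vconj_0 [simp]: "vconj (0::'a::complex_conj_vector) = 0"
  using vconj_add [of 0 "0::'a"] by simp

lemma vconj_minus: "vconj (- x) = - vconj (x::'a::complex_conj_vector)"
  using vconj_scaleC [of "-1" x] by (simp add: cvec.scale_minus_left)

lemma vconj_diff: "vconj (x - y) = vconj x - vconj (y::'a::complex_conj_vector)"
  using vconj_add [of x "- y"] by (simp add: vconj_minus)

lemma vconj_scaleR: "vconj (r *\<^sub>R x) = r *\<^sub>R vconj (x::'a::complex_conj_vector)"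
  by (simp add: scaleR_scaleC vconj_scaleC)

definition imag_part :: "'a::complex_conj_vector \<Rightarrow> 'a"
  where "imag_part x = real_part (- \<i> *\<^sub>C x)"

lemma vconj_real_part [simp]: "vconj (real_part x) = real_part x"
  by (simp add: real_part_def vconj_scaleR vconj_add vconj_vconj add.commute)

lemma vconj_imag_part [simp]: "vconj (imag_part x) = imag_part x"
  by (simp add: imag_part_def)

lemma real_part_real: "vconj x = x \<Longrightarrow> real_part x = x"
  by (simp add: real_part_def flip: scaleR_2)

lemma real_part_add: "real_part (x + y) = real_part x + real_part y"
  by (simp add: real_part_def vconj_add algebra_simps)

lemma real_part_scaleR: "real_part (r *\<^sub>R x) = r *\<^sub>R real_part x"
  by (simp add: real_part_def vconj_scaleR algebra_simps)

lemma real_part_minus: "real_part (- x) = - real_part x"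
  using real_part_scaleR [of "-1" x] by simp

lemma real_plus_imag: "x = real_part x + \<i> *\<^sub>C imag_part x"
proof -
  have "\<i> *\<^sub>C imag_part x = (1/2) *\<^sub>R (x - vconj x)"
    by (simp add: imag_part_def real_part_def vconj_scaleC vconj_minus scaleC_add_right
        scaleC_scaleC scaleR_scaleC cvec.scale_right_diff_distrib cvec.scale_minus_left cvec.scale_minus_right)
  moreover have "real_part x + (1/2) *\<^sub>R (x - vconj x) = (1/2) *\<^sub>R x + (1/2) *\<^sub>R x"
    by (simp add: real_part_def algebra_simps)
  ultimately show ?thesis
    by (simp flip: scaleR_add_left)
qed

lemma real_part_scaleC_real:
  assumes "vconj x = x"
  shows "real_part (c *\<^sub>C x) = Re c *\<^sub>R x"
proof -
  have "real_part (c *\<^sub>C x) = (1/2) *\<^sub>R ((c + cnj c) *\<^sub>C x)"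
    by (simp add: real_part_def vconj_scaleC assms scaleC_add_left)
  also have "c + cnj c = complex_of_real (2 * Re c)"
    by (simp add: complex_eq_iff)
  finally show ?thesis
    by (simp add: scaleC_of_real del: of_real_mult)
qed

lemma real_part_scaleC:
  "real_part (c *\<^sub>C x) = Re c *\<^sub>R real_part x - Im c *\<^sub>R imag_part (x::'a::complex_conj_vector)"
proof -
  have "c *\<^sub>C x = c *\<^sub>C real_part x + (c * \<i>) *\<^sub>C imag_part x"
    by (subst real_plus_imag) (simp add: scaleC_add_right scaleC_scaleC)
  then show ?thesis
    by (simp add: real_part_add real_part_scaleC_real)
qed

lemma imag_part_scaleC:
  "imag_part (c *\<^sub>C x) = Re c *\<^sub>R imag_part x + Im c *\<^sub>R real_part (x::'a::complex_conj_vector)"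
  using real_part_scaleC [of "- \<i> * c" x] by (simp add: imag_part_def scaleC_scaleC)

lemma imag_part_add: "imag_part (x + y) = imag_part x + imag_part (y::'a::complex_conj_vector)"
  by (simp add: imag_part_def scaleC_add_right flip: real_part_add)

lemma imag_part_real: "vconj x = (x::'a::complex_conj_vector) \<Longrightarrow> imag_part x = 0"
  using real_part_scaleC_real [of x "- \<i>"] by (simp add: imag_part_def)

lemma real_part_vconj: "real_part (vconj x) = real_part x"
  by (simp add: real_part_def vconj_vconj add.commute)

section \<open>The modulus and the lattice operations\<close>

lemma abs_nonneg: "0 \<le> \<bar>z::'a::complex_banach_lattice\<bar>"
proof -
  have "real_part z \<le> \<bar>z\<bar>" "- real_part z \<le> \<bar>z\<bar>"
    using abs_upper [of 0 z] abs_upper [of pi z] by (simp_all add: cvec.scale_minus_left real_part_minus)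
  then have "0 \<le> 2 *\<^sub>R \<bar>z\<bar>"
    using add_mono [of "real_part z" "\<bar>z\<bar>" "- real_part z" "\<bar>z\<bar>"] by (simp add: scaleR_2)
  then have "(1/2) *\<^sub>R 0 \<le> (1/2) *\<^sub>R (2 *\<^sub>R \<bar>z\<bar>)"
    by (intro scaleR_left_mono) auto
  then show ?thesis by simp
qed

lemma vconj_abs [simp]: "vconj \<bar>z::'a::complex_banach_lattice\<bar> = \<bar>z\<bar>"
  by (intro nonneg_real abs_nonneg)

lemma real_part_le_abs: "real_part z \<le> \<bar>z::'a::complex_banach_lattice\<bar>"
  using abs_upper [of 0 z] by simp

lemma le_abs: "vconj x = x \<Longrightarrow> x \<le> \<bar>x::'a::complex_banach_lattice\<bar>"
  using real_part_le_abs [of x] by (simp add: real_part_real)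

lemma abs_zero_eq: "\<bar>z::'a::complex_banach_lattice\<bar> = 0 \<longleftrightarrow> z = 0"
  by (metis norm_abs norm_eq_zero)

lemma abs_0 [simp]: "\<bar>0::'a::complex_banach_lattice\<bar> = 0"
  by (simp add: abs_zero_eq)

lemma abs_triangle: "\<bar>x + y\<bar> \<le> \<bar>x\<bar> + \<bar>y::'a::complex_banach_lattice\<bar>"
  by (rule abs_least) (simp add: scaleC_add_right real_part_add add_mono abs_upper)

lemma abs_cis: "\<bar>cis t *\<^sub>C z\<bar> = \<bar>z::'a::complex_banach_lattice\<bar>"
proof (rule antisym)
  show le: "\<bar>cis t *\<^sub>C z\<bar> \<le> \<bar>z\<bar>" for t and z :: 'a
    by (rule abs_least) (simp add: scaleC_scaleC cis_mult abs_upper)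
  show "\<bar>z\<bar> \<le> \<bar>cis t *\<^sub>C z\<bar>"
    using le [of "-t" "cis t *\<^sub>C z"] by (simp add: scaleC_scaleC cis_mult)
qed

lemma abs_scaleR:
  assumes "0 \<le> r"
  shows "\<bar>r *\<^sub>R z\<bar> = r *\<^sub>R \<bar>z::'a::complex_banach_lattice\<bar>"
proof (cases "r = 0")
  case False
  have le: "\<bar>r *\<^sub>R z\<bar> \<le> r *\<^sub>R \<bar>z\<bar>" if "r \<ge> 0" for r and z :: 'a
  proof (rule abs_least)
    fix t
    have "real_part (cis t *\<^sub>C r *\<^sub>R z) = r *\<^sub>R real_part (cis t *\<^sub>C z)"
      by (simp add: scaleC_scaleR scaleR_scaleC_assoc mult.commute flip: real_part_scaleR)
    then show "real_part (cis t *\<^sub>C r *\<^sub>R z) \<le> r *\<^sub>R \<bar>z\<bar>"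
      using that by (simp add: scaleR_left_mono abs_upper)
  qed
  have "r *\<^sub>R \<bar>inverse r *\<^sub>R (r *\<^sub>R z)\<bar> \<le> r *\<^sub>R inverse r *\<^sub>R \<bar>r *\<^sub>R z\<bar>"
    using assms by (intro scaleR_left_mono le) auto
  then show ?thesis
    using False assms by (intro antisym le) auto
qed simp

lemma abs_scaleC: "\<bar>c *\<^sub>C z\<bar> = cmod c *\<^sub>R \<bar>z::'a::complex_banach_lattice\<bar>"
proof -
  have "c *\<^sub>C z = cmod c *\<^sub>R (cis (Arg c) *\<^sub>C z)"
    by (metis rcis_cmod_Arg rcis_def scaleR_scaleC_assoc)
  then show ?thesis by (simp add: abs_scaleR abs_cis)
qed

lemma abs_minus: "\<bar>- z\<bar> = \<bar>z::'a::complex_banach_lattice\<bar>"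
  using abs_scaleC [of "-1" z] by (simp add: cvec.scale_minus_left)

lemma abs_minus_commute: "\<bar>x - y\<bar> = \<bar>y - x::'a::complex_banach_lattice\<bar>"
  using abs_minus [of "x - y"] by simp

lemma abs_vconj: "\<bar>vconj z\<bar> = \<bar>z::'a::complex_banach_lattice\<bar>"
proof (rule antisym)
  show le: "\<bar>vconj z\<bar> \<le> \<bar>z\<bar>" for z :: 'a
  proof (rule abs_least)
    fix t
    have "real_part (cis t *\<^sub>C vconj z) = real_part (vconj (cis (- t) *\<^sub>C z))"
      by (simp add: vconj_scaleC cis_cnj)
    then show "real_part (cis t *\<^sub>C vconj z) \<le> \<bar>z\<bar>"
      by (simp add: real_part_vconj abs_upper)
  qed
  show "\<bar>z\<bar> \<le> \<bar>vconj z\<bar>"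
    using le [of "vconj z"] by (simp add: vconj_vconj)
qed

lemma norm_vconj: "norm (vconj z) = norm (z::'a::complex_banach_lattice)"
  by (metis abs_vconj norm_abs)

lemma bounded_linear_vconj: "bounded_linear (vconj :: 'a::complex_banach_lattice \<Rightarrow> 'a)"
  by (rule bounded_linear_intro [where K = 1]) (auto simp: vconj_add vconj_scaleR norm_vconj)

lemma abs_of_nonneg: "0 \<le> x \<Longrightarrow> \<bar>x::'a::complex_banach_lattice\<bar> = x"
proof (rule antisym)
  assume x: "0 \<le> x"
  then show "x \<le> \<bar>x\<bar>" by (simp add: le_abs nonneg_real)
  show "\<bar>x\<bar> \<le> x"
    by (rule abs_least)
      (use x in \<open>simp add: real_part_scaleC_real nonneg_real scaleR_left_le_one_le\<close>)
qed

lemma abs_abs: "\<bar>\<bar>z\<bar>\<bar> = \<bar>z::'a::complex_banach_lattice\<bar>"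
  by (simp add: abs_of_nonneg abs_nonneg)

text \<open>
  For real \<open>w\<close> the vectors whose supremum is the modulus are the multiples \<open>cos t * w\<close>; each of them
  lies below \<open>w\<close> or \<open>- w\<close> scaled down, so the modulus is the least upper bound of \<open>w\<close> and \<open>- w\<close>.
\<close>

lemma abs_le_real:
  assumes "vconj w = (w::'a::complex_banach_lattice)" "w \<le> u" "- w \<le> u"
  shows "\<bar>w\<bar> \<le> u"
proof (rule abs_least)
  fix t :: real
  have "0 \<le> (1/2) *\<^sub>R ((u - w) + (u - - w))"
    using assms by (intro scaleR_nonneg_nonneg add_nonneg_nonneg) (simp_all only: diff_ge_0_iff_ge)
  then have u: "0 \<le> u"
    by (simp flip: scaleR_2)
  show "real_part (cis t *\<^sub>C w) \<le> u"
  proof -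
    have le: "c *\<^sub>R v \<le> u" if "0 \<le> c" "c \<le> 1" "v \<le> u" for c and v :: 'a
      using scaleR_left_mono [OF \<open>v \<le> u\<close> \<open>0 \<le> c\<close>] scaleR_left_le_one_le [OF u \<open>c \<le> 1\<close>]
      by (rule order_trans)
    show ?thesis
    proof (cases "0 \<le> cos t")
      case True
      then show ?thesis
        using assms le [of "cos t" w] by (simp add: real_part_scaleC_real)
    next
      case False
      moreover have "- cos t \<le> 1" using cos_ge_minus_one [of t] by linarith
      ultimately show ?thesis
        using assms le [of "- cos t" "- w"] by (simp add: real_part_scaleC_real)
    qed
  qed
qed

lemma minus_le_abs: "vconj x = x \<Longrightarrow> - x \<le> \<bar>x::'a::complex_banach_lattice\<bar>"
  using le_abs [of "- x"] by (simp add: vconj_minus abs_minus)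

lemma abs_diff_abs_le: "\<bar>\<bar>x\<bar> - \<bar>y\<bar>\<bar> \<le> \<bar>x - y::'a::complex_banach_lattice\<bar>"
proof (rule abs_le_real)
  show "\<bar>x\<bar> - \<bar>y\<bar> \<le> \<bar>x - y\<bar>"
    using abs_triangle [of "x - y" y] by (simp add: algebra_simps)
  show "- (\<bar>x\<bar> - \<bar>y\<bar>) \<le> \<bar>x - y\<bar>"
    using abs_triangle [of "y - x" x] by (simp add: algebra_simps abs_minus_commute)
qed (simp add: vconj_diff)

lemma norm_mono_abs: "\<bar>x\<bar> \<le> \<bar>y\<bar> \<Longrightarrow> norm x \<le> norm (y::'a::complex_banach_lattice)"
  using norm_mono [of "\<bar>x\<bar>" "\<bar>y\<bar>"] by (simp add: abs_nonneg norm_abs)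

lemma norm_abs_diff_le: "norm (\<bar>x\<bar> - \<bar>y\<bar>) \<le> norm (x - y::'a::complex_banach_lattice)"
  by (intro norm_mono_abs abs_diff_abs_le)

lemma tendsto_abs: "(f \<longlongrightarrow> l) F \<Longrightarrow> ((\<lambda>i. \<bar>f i::'a::complex_banach_lattice\<bar>) \<longlongrightarrow> \<bar>l\<bar>) F"
  unfolding tendsto_iff dist_norm
  by (smt (verit, ccfv_threshold) eventually_mono norm_abs_diff_le)

lemma continuous_on_abs: "continuous_on S f \<Longrightarrow> continuous_on S (\<lambda>x. \<bar>f x::'a::complex_banach_lattice\<bar>)"
  unfolding continuous_on_def by (auto intro: tendsto_abs)

text \<open>
  The cone is the set of fixed points of the modulus, which is continuous since it is a
  contraction.
\<close>

lemma closed_nonneg: "closed {x::'a::complex_banach_lattice. 0 \<le> x}"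
proof -
  have "{x::'a::complex_banach_lattice. 0 \<le> x} = {x. \<bar>x\<bar> = x}"
    by (metis abs_nonneg abs_of_nonneg)
  moreover have "closed {x::'a::complex_banach_lattice. \<bar>x\<bar> = x}"
    by (intro closed_Collect_eq continuous_on_abs continuous_on_id)
  ultimately show ?thesis by simp
qed

lemma tendsto_nonneg:
  assumes "(f \<longlongrightarrow> (l::'a::complex_banach_lattice)) F" "F \<noteq> bot" "eventually (\<lambda>i. 0 \<le> f i) F"
  shows "0 \<le> l"
  using Lim_in_closed_set [OF closed_nonneg _ assms(2,1)] assms(3) by simp

lemma tendsto_order_le:
  assumes "(f \<longlongrightarrow> l) F" "(g \<longlongrightarrow> (m::'a::complex_banach_lattice)) F" "F \<noteq> bot" "eventually (\<lambda>i. f i \<le> g i) F"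
  shows "l \<le> m"
  using tendsto_nonneg [OF tendsto_diff [OF assms(2,1)] assms(3)] assms(4)
  by (simp add: eventually_mono)

lemma archimedean_le:
  assumes "\<And>e. e > 0 \<Longrightarrow> (x::'a::complex_banach_lattice) \<le> e *\<^sub>R u"
  shows "x \<le> 0"
proof (rule tendsto_order_le)
  show "((\<lambda>e. e *\<^sub>R u) \<longlongrightarrow> 0) (at_right 0)"
    by (rule tendsto_eq_intros | simp)+
  show "eventually (\<lambda>e. x \<le> e *\<^sub>R u) (at_right 0)"
    using assms by (auto simp: eventually_at_right_field intro: exI [of _ 1])
qed auto

lemma nonneg_scaleR_cancel:
  assumes "0 \<le> u" "u \<noteq> 0" "0 \<le> c *\<^sub>R (u::'a::complex_banach_lattice)"
  shows "0 \<le> c"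
proof (rule ccontr)
  assume "\<not> 0 \<le> c"
  then have "0 \<le> - c" "c \<noteq> 0" by auto
  with assms have "0 \<le> (- c) *\<^sub>R u" by (intro scaleR_nonneg_nonneg)
  then have "c *\<^sub>R u = 0" using assms by (simp add: antisym)
  with \<open>c \<noteq> 0\<close> assms show False by simp
qed

text \<open>
  Joins and meets of real vectors are expressed through the modulus.  This makes them total
  functions, and their continuity is inherited from that of the modulus.
\<close>

definition vsup :: "'a::complex_banach_lattice \<Rightarrow> 'a \<Rightarrow> 'a"
  where "vsup x y = (1/2) *\<^sub>R (x + y + \<bar>x - y\<bar>)"

definition vinf :: "'a::complex_banach_lattice \<Rightarrow> 'a \<Rightarrow> 'a"
  where "vinf x y = (1/2) *\<^sub>R (x + y - \<bar>x - y\<bar>)"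

definition pos_part :: "'a::complex_banach_lattice \<Rightarrow> 'a"
  where "pos_part x = (1/2) *\<^sub>R (\<bar>x\<bar> + x)"

lemma half_le_iff: "(1/2) *\<^sub>R a \<le> (b::'a::ordered_real_vector) \<longleftrightarrow> a \<le> b + b"
proof
  assume "(1/2) *\<^sub>R a \<le> b"
  then have "2 *\<^sub>R (1/2) *\<^sub>R a \<le> 2 *\<^sub>R b" by (intro scaleR_left_mono) auto
  then show "a \<le> b + b" by (simp add: scaleR_2)
next
  assume "a \<le> b + b"
  then have "(1/2) *\<^sub>R a \<le> (1/2) *\<^sub>R (2 *\<^sub>R b)"
    by (intro scaleR_left_mono) (auto simp: scaleR_2)
  then show "(1/2) *\<^sub>R a \<le> b" by simp
qed

lemma le_half_iff: "b \<le> (1/2) *\<^sub>R (a::'a::ordered_real_vector) \<longleftrightarrow> b + b \<le> a"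
  using half_le_iff [of "- a" "- b"] by (metis (no_types, lifting) add.inverse_distrib_swap add.inverse_inverse neg_le_iff_le scaleR_minus_right)

lemma vsup_upper:
  assumes "vconj x = x" "vconj y = (y::'a::complex_banach_lattice)"
  shows "x \<le> vsup x y" "y \<le> vsup x y"
proof -
  have "x - y \<le> \<bar>x - y\<bar>" "- (x - y) \<le> \<bar>x - y\<bar>"
    by (rule le_abs minus_le_abs, simp add: vconj_diff assms)+
  then show "x \<le> vsup x y" "y \<le> vsup x y"
    unfolding vsup_def le_half_iff by (simp_all add: algebra_simps)
qed

lemma vsup_least:
  assumes "vconj x = x" "vconj y = (y::'a::complex_banach_lattice)" "x \<le> w" "y \<le> w"
  shows "vsup x y \<le> w"
proof -
  have "x + y + \<bar>x - y\<bar> \<le> w + w"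
  proof -
    have "\<bar>x - y\<bar> \<le> w + w - (x + y)"
    proof (rule abs_le_real)
      show "x - y \<le> w + w - (x + y)" "- (x - y) \<le> w + w - (x + y)"
        using add_mono [OF assms(3,3)] add_mono [OF assms(4,4)] by (simp_all add: algebra_simps)
    qed (simp add: assms vconj_diff)
    then show ?thesis by (simp add: algebra_simps)
  qed
  then show ?thesis by (simp add: vsup_def half_le_iff)
qed

lemma vsup_real: "vconj x = x \<Longrightarrow> vconj y = y \<Longrightarrow> vconj (vsup x y) = vsup x (y::'a::complex_banach_lattice)"
  by (simp add: vsup_def vconj_scaleR vconj_add vconj_diff)

lemma vsup_add: "vsup (x + a) (y + a) = vsup x y + (a::'a::complex_banach_lattice)"
proof -
  have "(1/2) *\<^sub>R (x + a + (y + a) + \<bar>x - y\<bar>) = (1/2) *\<^sub>R (x + y + \<bar>x - y\<bar>) + (1/2) *\<^sub>R (2 *\<^sub>R a)"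
    by (simp only: scaleR_2 scaleR_add_right) (simp add: algebra_simps)
  then show ?thesis by (simp add: vsup_def)
qed

lemma vinf_eq: "vinf x y = - vsup (- x) (- y::'a::complex_banach_lattice)"
  by (simp add: vinf_def vsup_def algebra_simps abs_minus_commute)

lemma vinf_lower:
  assumes "vconj x = x" "vconj y = (y::'a::complex_banach_lattice)"
  shows "vinf x y \<le> x" "vinf x y \<le> y"
  using vsup_upper [of "- x" "- y"] assms by (auto simp: vinf_eq vconj_minus minus_le_iff)

lemma vinf_greatest:
  assumes "vconj x = x" "vconj y = (y::'a::complex_banach_lattice)" "w \<le> x" "w \<le> y"
  shows "w \<le> vinf x y"
  using vsup_least [of "- x" "- y" "- w"] assms by (auto simp: vinf_eq vconj_minus le_minus_iff)

lemma tendsto_vinf: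
  assumes "(f \<longlongrightarrow> l) F" "(g \<longlongrightarrow> (m::'a::complex_banach_lattice)) F"
  shows "((\<lambda>i. vinf (f i) (g i)) \<longlongrightarrow> vinf l m) F"
  unfolding vinf_def by (intro tendsto_intros assms tendsto_abs)

lemma pos_part_nonneg: "vconj x = x \<Longrightarrow> 0 \<le> pos_part (x::'a::complex_banach_lattice)"
  using minus_le_abs [of x] by (simp add: pos_part_def le_half_iff neg_le_iff_le minus_le_iff
      flip: diff_minus_eq_add)

lemma pos_part_ge: "vconj x = x \<Longrightarrow> x \<le> pos_part (x::'a::complex_banach_lattice)"
  using le_abs [of x] by (simp add: pos_part_def le_half_iff)

lemma pos_part_least:
  "vconj x = x \<Longrightarrow> x \<le> w \<Longrightarrow> 0 \<le> w \<Longrightarrow> pos_part (x::'a::complex_banach_lattice) \<le> w"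
  using vsup_least [of x 0 w] by (simp add: pos_part_def vsup_def add.commute)

lemma pos_part_le_abs: "vconj x = x \<Longrightarrow> pos_part x \<le> \<bar>x::'a::complex_banach_lattice\<bar>"
  by (intro pos_part_least le_abs abs_nonneg)

lemma pos_part_diff: "pos_part x - pos_part (- x) = (x::'a::complex_banach_lattice)"
  by (simp add: pos_part_def abs_minus flip: scaleR_diff_right scaleR_2)

lemma pos_part_add_minus: "pos_part x + pos_part (- x) = \<bar>x::'a::complex_banach_lattice\<bar>"
  by (simp add: pos_part_def abs_minus flip: scaleR_add_right scaleR_2)

lemma pos_part_zero_iff: "vconj x = x \<Longrightarrow> pos_part x = 0 \<longleftrightarrow> x \<le> (0::'a::complex_banach_lattice)"
  by (metis antisym order_refl pos_part_ge pos_part_least pos_part_nonneg)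

lemma pos_part_disjoint: "vinf (pos_part x) (pos_part (- x)) = (0::'a::complex_banach_lattice)"
  by (simp add: vinf_def pos_part_diff pos_part_add_minus)

lemma pos_part_add:
  assumes "vconj x = x" "vconj y = (y::'a::complex_banach_lattice)"
  shows "pos_part (x + y) \<le> pos_part x + pos_part y"
  using assms by (intro pos_part_least add_mono pos_part_ge add_nonneg_nonneg pos_part_nonneg)
    (simp_all add: vconj_add)

lemma pos_part_scaleR:
  "0 \<le> r \<Longrightarrow> pos_part (r *\<^sub>R x) = r *\<^sub>R pos_part (x::'a::complex_banach_lattice)"
  by (simp add: pos_part_def abs_scaleR scaleR_add_right)

lemma real_part_abs_le: "\<bar>real_part z\<bar> \<le> \<bar>z::'a::complex_banach_lattice\<bar>"
  by (rule abs_le_real)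
     (use real_part_le_abs [of z] real_part_le_abs [of "- z"] in \<open>auto simp: real_part_minus abs_minus\<close>)

lemma imag_part_abs_le: "\<bar>imag_part z\<bar> \<le> \<bar>z::'a::complex_banach_lattice\<bar>"
  using real_part_abs_le [of "- \<i> *\<^sub>C z"] by (simp add: imag_part_def abs_minus abs_scaleC cvec.scale_minus_left)

section \<open>Linear functionals below sublinear functionals\<close>

definition sublinear_on :: "'a::real_vector set \<Rightarrow> ('a \<Rightarrow> real) \<Rightarrow> bool"
  where "sublinear_on V p \<longleftrightarrow>
    (\<forall>x\<in>V. \<forall>y\<in>V. p (x + y) \<le> p x + p y) \<and> (\<forall>x\<in>V. \<forall>r\<ge>0. p (r *\<^sub>R x) = r * p x)"

lemma sublinear_on_zero:
  assumes "sublinear_on V p" "subspace V"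
  shows "p 0 = 0"
proof -
  have "p (0 *\<^sub>R 0) = 0 * p 0"
    using assms unfolding sublinear_on_def by (meson order_refl subspace_0)
  then show ?thesis by simp
qed

lemma sublinear_on_minus:
  assumes "sublinear_on V p" "subspace V" "x \<in> V"
  shows "- p (- x) \<le> p x"
proof -
  have "p (x + - x) \<le> p x + p (- x)"
    using assms unfolding sublinear_on_def by (meson subspace_neg)
  then show ?thesis using sublinear_on_zero [OF assms(1,2)] by simp
qed

text \<open>
  The operation \<open>s\<close> serves two purposes.  If it is the join, a linear functional \<open>\<phi>\<close> with
  \<open>\<phi> (s x y) \<le> max (\<phi> x) (\<phi> y)\<close> is a lattice homomorphism; if it is the first projection, this
  inequality is void and linear functionals are obtained as in the Hahn-Banach theorem.
\<close>

locale sup_sublinear =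
  fixes V :: "'a::real_vector set" and s :: "'a \<Rightarrow> 'a \<Rightarrow> 'a"
  assumes subspace: "subspace V"
    and sup_in: "x \<in> V \<Longrightarrow> y \<in> V \<Longrightarrow> s x y \<in> V"
    and sup_add: "s (x + a) (y + a) = s x y + a"
begin

text \<open>
  With the value 0 outside of \<open>V\<close>, comparing functionals on \<open>V\<close> is the same as comparing them
  pointwise, so they are partially ordered as Zorn's lemma requires.
\<close>

definition functionals :: "('a \<Rightarrow> real) \<Rightarrow> ('a \<Rightarrow> real) set"
  where "functionals p = {q. sublinear_on V q \<and> (\<forall>x\<in>V. \<forall>y\<in>V. q (s x y) \<le> max (q x) (q y)) \<and>
    (\<forall>x\<in>V. q x \<le> p x) \<and> (\<forall>x. x \<notin> V \<longrightarrow> q x = 0)}"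

text \<open>
  The largest sublinear functional below \<open>q\<close> whose value at \<open>- a\<close> is \<open>- q a\<close>, that is, which is linear
  on the line through \<open>a\<close>.
\<close>

definition slope :: "('a \<Rightarrow> real) \<Rightarrow> 'a \<Rightarrow> 'a \<Rightarrow> real"
  where "slope q a x = (if x \<in> V then INF t\<in>{0..}. q (x + t *\<^sub>R a) - t * q a else 0)"

text \<open>
  By monotonicity the infimum in the definition is a limit for \<open>t \<rightarrow> \<infinity>\<close>.  For this reason it is
  compatible with sums and with maxima.
\<close>

lemma slope_antimono:
  assumes q: "sublinear_on V q" and V: "a \<in> V" "x \<in> V" and t: "0 \<le> t" "t \<le> t'"
  shows "q (x + t' *\<^sub>R a) - t' * q a \<le> q (x + t *\<^sub>R a) - t * q a"
proof -
  have "q ((x + t *\<^sub>R a) + (t' - t) *\<^sub>R a) \<le> q (x + t *\<^sub>R a) + q ((t' - t) *\<^sub>R a)"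
    using q V subspace unfolding sublinear_on_def by (meson subspace_add subspace_scale)
  also have "q ((t' - t) *\<^sub>R a) = (t' - t) * q a"
    using q V t unfolding sublinear_on_def by auto
  also have "(x + t *\<^sub>R a) + (t' - t) *\<^sub>R a = x + t' *\<^sub>R a"
    by (simp add: algebra_simps)
  finally show ?thesis by (simp add: algebra_simps)
qed

lemma slope_lower:
  assumes q: "sublinear_on V q" and V: "a \<in> V" "x \<in> V" and t: "0 \<le> t"
  shows "- q (- x) \<le> q (x + t *\<^sub>R a) - t * q a"
proof -
  have "q ((x + t *\<^sub>R a) + - x) \<le> q (x + t *\<^sub>R a) + q (- x)"
    using q V subspace unfolding sublinear_on_def by (meson subspace_add subspace_neg subspace_scale)
  moreover have "q (t *\<^sub>R a) = t * q a"
    using q V t unfolding sublinear_on_def by auto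
  ultimately show ?thesis by simp
qed

lemma slope_bdd:
  assumes "sublinear_on V q" "a \<in> V" "x \<in> V"
  shows "bdd_below ((\<lambda>t. q (x + t *\<^sub>R a) - t * q a) ` {0..})"
  using slope_lower [OF assms] by (intro bdd_belowI2 [of _ "- q (- x)"]) auto

lemma slope_le:
  assumes "sublinear_on V q" "a \<in> V" "x \<in> V" "0 \<le> t"
  shows "slope q a x \<le> q (x + t *\<^sub>R a) - t * q a"
  using assms slope_bdd [OF assms(1-3)] by (auto simp: slope_def intro!: cINF_lower)

lemma slope_approx:
  assumes "sublinear_on V q" "a \<in> V" "x \<in> V" "0 < e"
  shows "\<exists>t\<ge>0. \<forall>t'\<ge>t. q (x + t' *\<^sub>R a) - t' * q a < slope q a x + e"
proof -
  have "(INF t\<in>{0..}. q (x + t *\<^sub>R a) - t * q a) < slope q a x + e"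
    using assms by (simp add: slope_def)
  then obtain t where "0 \<le> t" "q (x + t *\<^sub>R a) - t * q a < slope q a x + e"
    by (subst (asm) cINF_less_iff) (use slope_bdd [OF assms(1-3)] in auto)
  with slope_antimono [OF assms(1-3)] show ?thesis
    by (meson order_le_less_trans)
qed

text \<open>
  As the expressions decrease with \<open>t\<close>, all large \<open>t\<close> are almost optimal for two given vectors.
  For the inequality about \<open>s\<close>, translation invariance moves \<open>t *\<^sub>R a\<close> inside of \<open>s\<close>.
\<close>

lemma slope_functional:
  assumes q: "q \<in> functionals p" and a: "a \<in> V"
  shows "slope q a \<in> functionals p"
proof -
  have sub: "sublinear_on V q" and qs: "\<And>x y. x \<in> V \<Longrightarrow> y \<in> V \<Longrightarrow> q (s x y) \<le> max (q x) (q y)"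
    using q by (auto simp: functionals_def)
  have add: "slope q a (x + y) \<le> slope q a x + slope q a y" if V: "x \<in> V" "y \<in> V" for x y
  proof (rule field_le_epsilon)
    fix e :: real assume "0 < e"
    then have e: "0 < e / 2" by simp
    obtain t where t: "0 \<le> t" "q (x + t *\<^sub>R a) - t * q a < slope q a x + e / 2"
      using slope_approx [OF sub a V(1) e] by blast
    obtain t' where t': "0 \<le> t'" "q (y + t' *\<^sub>R a) - t' * q a < slope q a y + e / 2"
      using slope_approx [OF sub a V(2) e] by blast
    have "slope q a (x + y) \<le> q ((x + y) + (t + t') *\<^sub>R a) - (t + t') * q a"
      using sub a V t t' subspace by (intro slope_le) (auto simp: subspace_add)
    also have "(x + y) + (t + t') *\<^sub>R a = (x + t *\<^sub>R a) + (y + t' *\<^sub>R a)"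
      by (simp add: algebra_simps)
    also have "q \<dots> \<le> q (x + t *\<^sub>R a) + q (y + t' *\<^sub>R a)"
      using sub a V subspace unfolding sublinear_on_def by (meson subspace_add subspace_scale)
    finally show "slope q a (x + y) \<le> slope q a x + slope q a y + e"
      using t t' by (simp add: algebra_simps)
  qed
  have le: "slope q a (r *\<^sub>R x) \<le> r * slope q a x" if V: "x \<in> V" and r: "0 < r" for x r
  proof (rule field_le_epsilon)
    fix e :: real assume "0 < e"
    then have e: "0 < e / r" using r by simp
    obtain t where t: "0 \<le> t" "q (x + t *\<^sub>R a) - t * q a < slope q a x + e / r"
      using slope_approx [OF sub a V(1) e] by blast
    have "slope q a (r *\<^sub>R x) \<le> q (r *\<^sub>R x + (r * t) *\<^sub>R a) - (r * t) * q a"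
      using sub a V t r subspace by (intro slope_le) (auto simp: subspace_scale)
    also have "r *\<^sub>R x + (r * t) *\<^sub>R a = r *\<^sub>R (x + t *\<^sub>R a)"
      by (simp add: algebra_simps)
    also have "q \<dots> = r * q (x + t *\<^sub>R a)"
      using sub a V subspace r unfolding sublinear_on_def by (meson subspace_add subspace_scale less_imp_le)
    also have "r * q (x + t *\<^sub>R a) - (r * t) * q a = r * (q (x + t *\<^sub>R a) - t * q a)"
      by (simp add: algebra_simps)
    also have "\<dots> \<le> r * (slope q a x + e / r)"
      using t r by (intro mult_left_mono) auto
    finally show "slope q a (r *\<^sub>R x) \<le> r * slope q a x + e"
      using r by (simp add: algebra_simps)
  qed
  have zero: "slope q a 0 = 0"
  proof (rule antisym)
    have 0: "q 0 = 0" "0 \<in> V"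
      using sub subspace by (auto simp: sublinear_on_zero subspace_0)
    show "slope q a 0 \<le> 0"
      using slope_le [OF sub a 0(2), of 0] 0 by simp
    show "0 \<le> slope q a 0"
      using slope_lower [OF sub a 0(2)] 0 by (auto simp: slope_def intro!: cINF_greatest)
  qed
  have scale: "slope q a (r *\<^sub>R x) = r * slope q a x" if V: "x \<in> V" and r: "0 \<le> r" for x r
  proof (cases "r = 0")
    case False
    then have r: "0 < r" using r by simp
    have "slope q a (inverse r *\<^sub>R (r *\<^sub>R x)) \<le> inverse r * slope q a (r *\<^sub>R x)"
      using V r subspace by (intro le) (auto simp: subspace_scale)
    then have "r * slope q a x \<le> slope q a (r *\<^sub>R x)"
      using r by (simp add: field_simps)
    then show ?thesis using le [OF V r] by simp
  qed (simp add: zero)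
  have sup: "slope q a (s x y) \<le> max (slope q a x) (slope q a y)" if V: "x \<in> V" "y \<in> V" for x y
  proof (rule field_le_epsilon)
    fix e :: real assume e: "0 < e"
    obtain t where t: "0 \<le> t" "\<And>t'. t \<le> t' \<Longrightarrow> q (x + t' *\<^sub>R a) - t' * q a < slope q a x + e"
      using slope_approx [OF sub a V(1) e] by blast
    obtain t' where t': "0 \<le> t'" "\<And>t. t' \<le> t \<Longrightarrow> q (y + t *\<^sub>R a) - t * q a < slope q a y + e"
      using slope_approx [OF sub a V(2) e] by blast
    define r where "r = max t t'"
    have "slope q a (s x y) \<le> q (s x y + r *\<^sub>R a) - r * q a"
      using sub a V t sup_in by (intro slope_le) (auto simp: r_def)
    also have "q (s x y + r *\<^sub>R a) = q (s (x + r *\<^sub>R a) (y + r *\<^sub>R a))"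
      by (simp add: sup_add)
    also have "\<dots> \<le> max (q (x + r *\<^sub>R a)) (q (y + r *\<^sub>R a))"
      using V a subspace by (intro qs) (auto simp: subspace_add subspace_scale)
    also have "max (q (x + r *\<^sub>R a)) (q (y + r *\<^sub>R a)) - r * q a \<le> max (slope q a x) (slope q a y) + e"
      using t(2) [of r] t'(2) [of r] by (auto simp: r_def max_def split: if_splits)
    finally show "slope q a (s x y) \<le> max (slope q a x) (slope q a y) + e" by simp
  qed
  have "slope q a x \<le> p x" if "x \<in> V" for x
    using slope_le [OF sub a that, of 0] q that by (auto simp: functionals_def intro: order_trans)
  then show ?thesis
    using add scale sup by (auto simp: functionals_def sublinear_on_def slope_def)
qed

text \<open>
  The pointwise infimum of a chain stays sublinear and compatible with \<open>s\<close>, because a single member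
  of the chain is almost optimal for any two given vectors.  It is finite since sublinearity bounds
  each member from below by the negative of \<open>q\<^sub>0 (- x)\<close>.
\<close>

lemma minimal_functional:
  assumes "q\<^sub>0 \<in> functionals p"
  obtains q where "q \<in> functionals q\<^sub>0" "\<And>q'. q' \<in> functionals q \<Longrightarrow> q' = q"
proof -
  let ?P = "\<lambda>q q' :: 'a \<Rightarrow> real. \<forall>x. q' x \<le> q x"
  let ?A = "functionals q\<^sub>0"
  have "\<exists>m\<in>?A. \<forall>a\<in>?A. ?P m a \<longrightarrow> a = m"
  proof (rule predicate_Zorn)
    show "partial_order_on ?A (relation_of ?P ?A)"
      by (rule partial_order_on_relation_ofI) (auto intro: order_trans simp: fun_eq_iff antisym)
    fix C assume C: "C \<in> Chains (relation_of ?P ?A)"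
    then have CA: "C \<subseteq> ?A"
      and lin: "\<And>q q'. q \<in> C \<Longrightarrow> q' \<in> C \<Longrightarrow> ?P q q' \<or> ?P q' q"
      by (auto simp: Chains_def relation_of_def)
    show "\<exists>u\<in>?A. \<forall>a\<in>C. ?P a u"
    proof (cases "C = {}")
      case True
      with assms show ?thesis by (auto simp: functionals_def)
    next
      case False
      define u where "u x = (INF q\<in>C. q x)" for x
      have sub: "sublinear_on V q" if "q \<in> C" for q
        using CA that by (auto simp: functionals_def)
      have bdd: "bdd_below ((\<lambda>q. q x) ` C)" for x
      proof (cases "x \<in> V")
        case True
        have "- q\<^sub>0 (- x) \<le> q x" if "q \<in> C" for q
        proof -
          have "q (- x) \<le> q\<^sub>0 (- x)"
            using CA that True subspace by (auto simp: functionals_def subspace_neg)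
          then show ?thesis using sublinear_on_minus [OF sub [OF that] subspace True] by simp
        qed
        then show ?thesis by (auto intro!: bdd_belowI2 [of _ "- q\<^sub>0 (- x)"])
      next
        case False
        then have "(\<lambda>q. q x) ` C \<subseteq> {0}"
          using CA by (auto simp: functionals_def)
        then show ?thesis by (auto intro!: bdd_belowI2 [of _ 0])
      qed
      have le: "u x \<le> q x" if "q \<in> C" for q x
        unfolding u_def by (rule cINF_lower [OF bdd that])
      have approx: "\<exists>q\<in>C. q x < u x + e \<and> q y < u y + e" if "0 < e" for x y and e :: real
      proof -
        have "(INF q\<in>C. q x) < u x + e" "(INF q\<in>C. q y) < u y + e"
          using that by (auto simp: u_def)
        then obtain q q' where "q \<in> C" "q x < u x + e" "q' \<in> C" "q' y < u y + e"
          using bdd False by (subst (asm) (1 2) cINF_less_iff) auto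
        with lin [of q q'] show ?thesis by (meson order_le_less_trans)
      qed
      have "u (x + y) \<le> u x + u y" if V: "x \<in> V" "y \<in> V" for x y
      proof (rule field_le_epsilon)
        fix e :: real assume "0 < e"
        then obtain q where q: "q \<in> C" "q x < u x + e / 2" "q y < u y + e / 2"
          using approx [of "e / 2"] by auto
        have "q (x + y) \<le> q x + q y"
          using sub [OF q(1)] V by (auto simp: sublinear_on_def)
        then show "u (x + y) \<le> u x + u y + e"
          using le [OF q(1), of "x + y"] q by linarith
      qed
      moreover have "u (r *\<^sub>R x) = r * u x" if V: "x \<in> V" and r: "0 \<le> r" for x r
      proof (rule antisym)
        show "u (r *\<^sub>R x) \<le> r * u x"
        proof (rule field_le_epsilon)
          fix e :: real assume e: "0 < e"
          then obtain q where q: "q \<in> C" "q x < u x + e / (r + 1)"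
            using approx [of "e / (r + 1)"] r by auto
          have "u (r *\<^sub>R x) \<le> r * q x"
            using sub [OF q(1)] le [OF q(1)] V r by (metis sublinear_on_def)
          also have "\<dots> \<le> r * (u x + e / (r + 1))"
            using q r by (intro mult_left_mono) auto
          also have "\<dots> \<le> r * u x + e"
            using r e by (simp add: field_simps)
          finally show "u (r *\<^sub>R x) \<le> r * u x + e" .
        qed
        have "r * u x \<le> q (r *\<^sub>R x)" if "q \<in> C" for q
          using sub [OF that] le [OF that, of x] V r by (auto simp: sublinear_on_def mult_left_mono)
        then show "r * u x \<le> u (r *\<^sub>R x)"
          using False by (subst (2) u_def) (auto intro: cINF_greatest)
      qed
      moreover have "u (s x y) \<le> max (u x) (u y)" if V: "x \<in> V" "y \<in> V" for x y
      proof (rule field_le_epsilon)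
        fix e :: real assume "0 < e"
        then obtain q where q: "q \<in> C" "q x < u x + e" "q y < u y + e"
          using approx by blast
        have "q (s x y) \<le> max (q x) (q y)"
          using CA q V by (auto simp: functionals_def)
        then show "u (s x y) \<le> max (u x) (u y) + e"
          using le [OF q(1), of "s x y"] q by linarith
      qed
      moreover have "u x \<le> q\<^sub>0 x" if "x \<in> V" for x
      proof -
        obtain q where "q \<in> C" using False by blast
        with le [of q x] CA that show ?thesis by (force simp: functionals_def)
      qed
      moreover have "u x = 0" if "x \<notin> V" for x
      proof -
        have "(\<lambda>q. q x) ` C = {0}"
          using CA that False by (force simp: functionals_def)
        then show ?thesis by (simp add: u_def)
      qed
      ultimately have "u \<in> ?A" by (simp add: functionals_def sublinear_on_def)
      with le show ?thesis by blast
    qed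
  qed
  then obtain q where q: "q \<in> ?A" and min: "\<And>q'. q' \<in> ?A \<Longrightarrow> ?P q q' \<Longrightarrow> q' = q"
    by blast
  have "q' = q" if "q' \<in> functionals q" for q'
  proof (rule min)
    show "q' \<in> ?A" using that q unfolding functionals_def by (auto intro: order_trans)
    show "?P q q'"
    proof
      fix x show "q' x \<le> q x"
        using that q by (cases "x \<in> V") (auto simp: functionals_def)
    qed
  qed
  with q that show ?thesis by blast
qed

text \<open>
  A minimal functional \<open>q\<close> coincides with all its modifications \<open>slope q a\<close>, and evaluating these
  at \<open>t = 1\<close> yields \<open>q x + q a \<le> q (x + a)\<close>, so \<open>q\<close> is additive.
\<close>

theorem exists_linear_functional:
  assumes sub: "sublinear_on V p" and sup: "\<And>x y. x \<in> V \<Longrightarrow> y \<in> V \<Longrightarrow> p (s x y) \<le> max (p x) (p y)"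
    and u: "u \<in> V"
  obtains \<phi> where "\<And>x y. x \<in> V \<Longrightarrow> y \<in> V \<Longrightarrow> \<phi> (x + y) = \<phi> x + \<phi> y"
    "\<And>r x. x \<in> V \<Longrightarrow> \<phi> (r *\<^sub>R x) = r * \<phi> x"
    "\<And>x. x \<in> V \<Longrightarrow> \<phi> x \<le> p x"
    "\<And>x y. x \<in> V \<Longrightarrow> y \<in> V \<Longrightarrow> \<phi> (s x y) \<le> max (\<phi> x) (\<phi> y)"
    "\<phi> u = p u"
proof -
  define p' where "p' x = (if x \<in> V then p x else 0)" for x
  have "p' \<in> functionals p"
    using sub sup subspace by (auto simp: functionals_def p'_def sublinear_on_def sup_in subspace_add subspace_scale)
  \<comment> \<open>Starting below this modification of \<open>p\<close> yields \<open>\<phi> (- u) \<le> - p u\<close>, and so equality at \<open>u\<close>.\<close>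
  then have p'u: "slope p' u \<in> functionals p"
    using u by (rule slope_functional)
  from minimal_functional [OF this] obtain q where
    q: "q \<in> functionals (slope p' u)" and min: "\<And>q'. q' \<in> functionals q \<Longrightarrow> q' = q" by blast
  have qq: "q \<in> functionals q"
    using q by (auto simp: functionals_def)
  have subq: "sublinear_on V q"
    using q by (auto simp: functionals_def)
  have q_le: "q x \<le> p x" if "x \<in> V" for x
    using q p'u that unfolding functionals_def by (auto intro: order_trans)
  have add: "q (x + y) = q x + q y" if V: "x \<in> V" "y \<in> V" for x y
  proof (rule antisym)
    show "q (x + y) \<le> q x + q y" using subq V by (auto simp: sublinear_on_def)
    have "slope q y = q" using min slope_functional [OF qq V(2)] by blast
    then have "q x \<le> q (x + 1 *\<^sub>R y) - 1 * q y"
      using slope_le [OF subq V(2,1), of 1] by simp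
    then show "q x + q y \<le> q (x + y)" by simp
  qed
  have minus: "q (- x) = - q x" if "x \<in> V" for x
    using add [of x "- x"] that subspace sublinear_on_zero [OF subq subspace] by (simp add: subspace_neg)
  have scale: "q (r *\<^sub>R x) = r * q x" if "x \<in> V" for r x
  proof (cases "0 \<le> r")
    case True
    then show ?thesis using subq that by (auto simp: sublinear_on_def)
  next
    case False
    then have "0 \<le> - r" by simp
    with subq that have "q ((- r) *\<^sub>R x) = - r * q x" unfolding sublinear_on_def by blast
    then show ?thesis
      using minus [of "r *\<^sub>R x"] that subspace by (simp add: subspace_scale)
  qed
  have mu: "- u \<in> V" using u subspace by (simp add: subspace_neg)
  have "q (- u) \<le> slope p' u (- u)"
    using q mu by (auto simp: functionals_def)
  also have "\<dots> \<le> p' (- u + 1 *\<^sub>R u) - 1 * p' u"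
    using \<open>p' \<in> functionals p\<close> u mu by (intro slope_le) (auto simp: functionals_def)
  also have "\<dots> = - p u"
    using u subspace sublinear_on_zero [OF sub subspace] by (simp add: p'_def subspace_0)
  finally have "p u \<le> q u" using minus [OF u] by simp
  then have "q u = p u" using q_le [OF u] by simp
  show ?thesis
    by (rule that [of q])
       (use q \<open>q u = p u\<close> in \<open>auto simp: add scale q_le functionals_def\<close>)
qed

end

section \<open>Positive functionals\<close>

text \<open>
  The sublinear functional is the norm of the positive part.  It vanishes at negative vectors, which
  makes the linear functionals below it positive.
\<close>

theorem exists_positive_functional:
  fixes u :: "'a::complex_banach_lattice"
  assumes u: "0 \<le> u"
  obtains \<phi> :: "'a \<Rightarrow> real"
  where "bounded_linear \<phi>" "\<And>x. 0 \<le> x \<Longrightarrow> 0 \<le> \<phi> x" "\<phi> u = norm u"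
proof -
  let ?V = "{x::'a. vconj x = x}"
  interpret sup_sublinear ?V "\<lambda>x y. x"
    by unfold_locales (auto simp: subspace_def vconj_add vconj_scaleR)
  let ?p = "\<lambda>x::'a. norm (pos_part x)"
  have "sublinear_on ?V ?p"
    unfolding sublinear_on_def
  proof (intro conjI ballI allI impI)
    fix x y :: 'a assume "x \<in> ?V" "y \<in> ?V"
    then have "norm (pos_part (x + y)) \<le> norm (pos_part x + pos_part y)"
      by (intro norm_mono pos_part_add pos_part_nonneg) (auto simp: vconj_add)
    then show "norm (pos_part (x + y)) \<le> norm (pos_part x) + norm (pos_part y)"
      using norm_triangle_ineq order_trans by blast
  qed (simp add: pos_part_scaleR)
  then obtain \<phi> where \<phi>: "\<And>x y. x \<in> ?V \<Longrightarrow> y \<in> ?V \<Longrightarrow> \<phi> (x + y) = \<phi> x + \<phi> y"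
    "\<And>r x. x \<in> ?V \<Longrightarrow> \<phi> (r *\<^sub>R x) = r * \<phi> x" "\<And>x. x \<in> ?V \<Longrightarrow> \<phi> x \<le> ?p x" "\<phi> u = ?p u"
    by (rule exists_linear_functional [of ?p u]) (use u in \<open>auto simp: nonneg_real\<close>)
  have minus: "\<phi> (- x) = - \<phi> x" if "vconj x = x" for x
    using \<phi>(2) [of x "-1"] that by simp
  have p_le: "?p x \<le> norm x" if "vconj x = x" for x
    using norm_mono [OF pos_part_nonneg pos_part_le_abs] that by (simp add: norm_abs)
  have bound: "\<bar>\<phi> x\<bar> \<le> norm x" if "vconj x = x" for x
    using \<phi>(3) [of x] \<phi>(3) [of "- x"] p_le [of x] p_le [of "- x"] that minus [of x]
    by (auto simp: vconj_minus)
  show ?thesis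
  proof (rule that [of "\<lambda>x. \<phi> (real_part x)"])
    show "bounded_linear (\<lambda>x. \<phi> (real_part x))"
    proof (rule bounded_linear_intro [where K = 1])
      fix x :: 'a
      have "norm (real_part x) \<le> norm x"
        by (intro norm_mono_abs real_part_abs_le)
      then show "norm (\<phi> (real_part x)) \<le> norm x * 1"
        using bound [of "real_part x"] by simp
    qed (auto simp: \<phi> real_part_add real_part_scaleR)
    show "0 \<le> \<phi> (real_part x)" if "0 \<le> x" for x
    proof -
      have "pos_part (- x) = 0"
        using that by (simp add: pos_part_zero_iff vconj_minus nonneg_real)
      then have "\<phi> (- x) \<le> 0"
        using \<phi>(3) [of "- x"] that by (simp add: vconj_minus nonneg_real)
      then show ?thesis
        using that by (simp add: minus real_part_real nonneg_real)
    qed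
    show "\<phi> (real_part u) = norm u"
      using u \<phi>(4) by (simp add: real_part_real nonneg_real pos_part_def abs_of_nonneg flip: scaleR_2)
  qed
qed

section \<open>Lattice ideals\<close>

lemma principal_ideal_iff:
  assumes "0 \<le> (u::'a::complex_banach_lattice)"
  shows "y \<in> principal_ideal u \<longleftrightarrow> (\<exists>c. \<bar>y\<bar> \<le> c *\<^sub>R u)"
proof
  assume "\<exists>c. \<bar>y\<bar> \<le> c *\<^sub>R u"
  then obtain c where "\<bar>y\<bar> \<le> c *\<^sub>R u" ..
  also have "\<dots> \<le> (\<bar>c\<bar> + 1) *\<^sub>R u"
    using assms by (intro scaleR_right_mono) auto
  finally show "y \<in> principal_ideal u"
    by (auto simp: principal_ideal_def intro!: exI [of _ "\<bar>c\<bar> + 1"])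
qed (auto simp: principal_ideal_def)

lemma lattice_ideal_principal_ideal:
  assumes u: "0 \<le> (u::'a::complex_banach_lattice)"
  shows "lattice_ideal (principal_ideal u)"
  unfolding lattice_ideal_def cvec.subspace_def
proof (intro conjI allI impI ballI)
  show "0 \<in> principal_ideal u" unfolding principal_ideal_iff [OF u] by (intro exI [of _ 0]) simp
next
  fix x y :: 'a assume "x \<in> principal_ideal u" "y \<in> principal_ideal u"
  then obtain c d where "\<bar>x\<bar> \<le> c *\<^sub>R u" "\<bar>y\<bar> \<le> d *\<^sub>R u" by (auto simp: principal_ideal_iff [OF u])
  then have "\<bar>x + y\<bar> \<le> (c + d) *\<^sub>R u"
    unfolding scaleR_add_left by (meson abs_triangle add_mono order_trans)
  then show "x + y \<in> principal_ideal u" by (auto simp: principal_ideal_iff [OF u])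
next
  fix c and x :: 'a assume "x \<in> principal_ideal u"
  then obtain d where "\<bar>x\<bar> \<le> d *\<^sub>R u" by (auto simp: principal_ideal_iff [OF u])
  then have "\<bar>c *\<^sub>C x\<bar> \<le> cmod c *\<^sub>R d *\<^sub>R u"
    unfolding abs_scaleC by (intro scaleR_left_mono) auto
  then show "c *\<^sub>C x \<in> principal_ideal u" by (auto simp: principal_ideal_iff [OF u])
next
  fix x y assume "y \<in> principal_ideal u" "\<bar>x\<bar> \<le> \<bar>y\<bar>"
  then show "x \<in> principal_ideal u" unfolding principal_ideal_iff [OF u] using order_trans by blast
qed

lemma lattice_ideal_scaleR: "lattice_ideal I \<Longrightarrow> x \<in> I \<Longrightarrow> r *\<^sub>R x \<in> I"
  unfolding lattice_ideal_def scaleR_scaleC using cvec.subspace_scale by blast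

lemma lattice_ideal_scaleC: "lattice_ideal I \<Longrightarrow> x \<in> I \<Longrightarrow> c *\<^sub>C x \<in> I"
  unfolding lattice_ideal_def using cvec.subspace_scale by blast

lemma lattice_ideal_add: "lattice_ideal I \<Longrightarrow> x \<in> I \<Longrightarrow> y \<in> I \<Longrightarrow> x + y \<in> I"
  unfolding lattice_ideal_def using cvec.subspace_add by blast

lemma lattice_ideal_diff: "lattice_ideal I \<Longrightarrow> x \<in> I \<Longrightarrow> y \<in> I \<Longrightarrow> x - y \<in> I"
  unfolding lattice_ideal_def using cvec.subspace_diff by blast

lemma lattice_ideal_minus: "lattice_ideal I \<Longrightarrow> x \<in> I \<Longrightarrow> - x \<in> I"
  unfolding lattice_ideal_def using cvec.subspace_neg by blast

lemma lattice_ideal_0: "lattice_ideal I \<Longrightarrow> 0 \<in> I"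
  unfolding lattice_ideal_def using cvec.subspace_0 by blast

lemma lattice_ideal_solid: "lattice_ideal I \<Longrightarrow> y \<in> I \<Longrightarrow> \<bar>x\<bar> \<le> \<bar>y\<bar> \<Longrightarrow> x \<in> I"
  unfolding lattice_ideal_def by blast

lemma lattice_ideal_abs: "lattice_ideal I \<Longrightarrow> x \<in> I \<Longrightarrow> \<bar>x\<bar> \<in> I"
  by (rule lattice_ideal_solid) (auto simp: abs_abs)

lemma lattice_ideal_vconj: "lattice_ideal I \<Longrightarrow> x \<in> I \<Longrightarrow> vconj x \<in> I"
  by (rule lattice_ideal_solid) (auto simp: abs_vconj)

lemma lattice_ideal_real_part: "lattice_ideal I \<Longrightarrow> x \<in> I \<Longrightarrow> real_part x \<in> I"
  by (rule lattice_ideal_solid) (auto simp: real_part_abs_le)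

lemma lattice_ideal_imag_part: "lattice_ideal I \<Longrightarrow> x \<in> I \<Longrightarrow> imag_part x \<in> I"
  by (rule lattice_ideal_solid) (auto simp: imag_part_abs_le)

lemma lattice_ideal_vsup: "lattice_ideal I \<Longrightarrow> x \<in> I \<Longrightarrow> y \<in> I \<Longrightarrow> vsup x y \<in> I"
  unfolding vsup_def by (intro lattice_ideal_scaleR lattice_ideal_add lattice_ideal_abs lattice_ideal_diff)

section \<open>Characters of a principal ideal\<close>

text \<open>
  The points of the compact space on which the principal ideal of \<open>u\<close> would be represented by
  continuous functions with \<open>u\<close> as the constant 1.
\<close>

definition characters :: "'a::complex_banach_lattice \<Rightarrow> ('a \<Rightarrow> complex) set"
  where "characters u = {\<phi>.
    (\<forall>x\<in>principal_ideal u. \<forall>y\<in>principal_ideal u. \<phi> (x + y) = \<phi> x + \<phi> y) \<and>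
    (\<forall>c. \<forall>x\<in>principal_ideal u. \<phi> (c *\<^sub>C x) = c * \<phi> x) \<and>
    (\<forall>x\<in>principal_ideal u. \<phi> \<bar>x\<bar> = of_real (cmod (\<phi> x))) \<and>
    \<phi> u = 1}"

text \<open>
  The maximum of \<open>x\<close> as a function on that space.
\<close>

definition gauge :: "'a::complex_banach_lattice \<Rightarrow> 'a \<Rightarrow> real"
  where "gauge u x = Inf {c. x \<le> c *\<^sub>R u}"

locale order_unit =
  fixes u :: "'a::complex_banach_lattice"
  assumes nonneg: "0 \<le> u" and nonzero: "u \<noteq> 0"
begin

abbreviation "E \<equiv> principal_ideal u"
abbreviation "K \<equiv> characters u"

lemma ideal: "lattice_ideal E"
  by (rule lattice_ideal_principal_ideal [OF nonneg])

lemmas in_ideal [simp, intro] =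
  lattice_ideal_scaleR [OF ideal] lattice_ideal_scaleC [OF ideal] lattice_ideal_add [OF ideal]
  lattice_ideal_diff [OF ideal] lattice_ideal_minus [OF ideal] lattice_ideal_0 [OF ideal]
  lattice_ideal_abs [OF ideal] lattice_ideal_vconj [OF ideal]
  lattice_ideal_real_part [OF ideal] lattice_ideal_imag_part [OF ideal] lattice_ideal_vsup [OF ideal]

lemma unit_in [simp, intro]: "u \<in> E"
  unfolding principal_ideal_iff [OF nonneg] by (intro exI [of _ 1]) (simp add: abs_of_nonneg nonneg)

lemma unit_real [simp]: "vconj u = u"
  using nonneg by (rule nonneg_real)

lemma scale_unit_le_iff: "a *\<^sub>R u \<le> b *\<^sub>R u \<longleftrightarrow> a \<le> b"
proof
  assume "a *\<^sub>R u \<le> b *\<^sub>R u"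
  then have "0 \<le> (b - a) *\<^sub>R u" by (simp add: scaleR_diff_left)
  then show "a \<le> b" using nonneg_scaleR_cancel [OF nonneg nonzero] by fastforce
qed (simp add: scaleR_right_mono nonneg)

text \<open>
  The infimum is attained because the positive cone is Archimedean.
\<close>

lemma gauge_le_iff:
  assumes "x \<in> E" "vconj x = x"
  shows "gauge u x \<le> c \<longleftrightarrow> x \<le> c *\<^sub>R u"
proof -
  obtain d where d: "\<bar>x\<bar> \<le> d *\<^sub>R u"
    using assms by (auto simp: principal_ideal_iff [OF nonneg])
  have ne: "d \<in> {c. x \<le> c *\<^sub>R u}"
    using d le_abs [OF assms(2)] by (auto intro: order_trans)
  have bdd: "bdd_below {c. x \<le> c *\<^sub>R u}"
  proof (rule bdd_belowI)
    fix c assume "c \<in> {c. x \<le> c *\<^sub>R u}"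
    moreover have "(- d) *\<^sub>R u \<le> x"
      using d minus_le_abs [OF assms(2)] by (metis minus_le_iff order_trans scaleR_minus_left)
    ultimately have "(- d) *\<^sub>R u \<le> c *\<^sub>R u" by auto
    then show "- d \<le> c" by (simp only: scale_unit_le_iff)
  qed
  have attained: "x \<le> gauge u x *\<^sub>R u"
  proof -
    have "x - gauge u x *\<^sub>R u \<le> e *\<^sub>R u" if "e > 0" for e
    proof -
      have "Inf {c. x \<le> c *\<^sub>R u} < gauge u x + e" using that by (simp add: gauge_def)
      then obtain c where "x \<le> c *\<^sub>R u" "c < gauge u x + e"
        by (subst (asm) cInf_less_iff) (use ne bdd in auto)
      then have "x \<le> (gauge u x + e) *\<^sub>R u"
        by (meson less_imp_le order_trans scale_unit_le_iff)
      then show ?thesis by (simp add: scaleR_add_left diff_le_eq add.commute)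
    qed
    then have "x - gauge u x *\<^sub>R u \<le> 0" by (rule archimedean_le)
    then show ?thesis by simp
  qed
  show ?thesis
  proof
    show "gauge u x \<le> c" if "x \<le> c *\<^sub>R u"
      unfolding gauge_def by (rule cInf_lower) (use that bdd in auto)
    show "x \<le> c *\<^sub>R u" if "gauge u x \<le> c"
      using attained that scale_unit_le_iff order_trans by blast
  qed
qed

lemma le_gauge: "x \<in> E \<Longrightarrow> vconj x = x \<Longrightarrow> x \<le> gauge u x *\<^sub>R u"
  using gauge_le_iff by blast

lemma gauge_unit_scale: "gauge u (a *\<^sub>R u) = a"
  using gauge_le_iff [of "a *\<^sub>R u"] by (auto simp: vconj_scaleR scale_unit_le_iff intro: antisym)

lemma sublinear_gauge: "sublinear_on {x \<in> E. vconj x = x} (gauge u)"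
  unfolding sublinear_on_def
proof (intro conjI ballI allI impI)
  fix x y assume "x \<in> {x \<in> E. vconj x = x}" "y \<in> {x \<in> E. vconj x = x}"
  then show "gauge u (x + y) \<le> gauge u x + gauge u y"
    by (subst gauge_le_iff) (auto simp: vconj_add scaleR_add_left intro!: add_mono le_gauge)
next
  fix x and r :: real assume x: "x \<in> {x \<in> E. vconj x = x}" and r: "0 \<le> r"
  show "gauge u (r *\<^sub>R x) = r * gauge u x"
  proof (cases "r = 0")
    case True
    then show ?thesis using gauge_unit_scale [of 0] by simp
  next
    case False
    with r have r: "0 < r" by simp
    have le: "gauge u (r *\<^sub>R x) \<le> r * gauge u x" if "0 < r" "x \<in> {x \<in> E. vconj x = x}" for r x
      using that
      by (subst gauge_le_iff) (auto simp: vconj_scaleR intro!: scaleR_left_mono le_gauge simp flip: scaleR_scaleR)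
    have "gauge u (inverse r *\<^sub>R r *\<^sub>R x) \<le> inverse r * gauge u (r *\<^sub>R x)"
      using r x by (intro le) (auto simp: vconj_scaleR)
    then show ?thesis
      using le [OF r x] r by (simp add: field_simps)
  qed
qed

lemma finite_upper_bound:
  assumes "finite F" "F \<subseteq> {x \<in> E. vconj x = x}" "F \<noteq> {}"
    and \<phi>: "\<And>x y. x \<in> {x \<in> E. vconj x = x} \<Longrightarrow> y \<in> {x \<in> E. vconj x = x} \<Longrightarrow> \<phi> (vsup x y) \<le> max (\<phi> x) (\<phi> y)"
    and b: "\<And>x. x \<in> F \<Longrightarrow> \<phi> x \<le> (b::real)"
  obtains s where "s \<in> E" "vconj s = s" "\<And>x. x \<in> F \<Longrightarrow> x \<le> s" "\<phi> s \<le> b"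
proof -
  have "\<exists>s. s \<in> E \<and> vconj s = s \<and> (\<forall>x\<in>F. x \<le> s) \<and> \<phi> s \<le> b"
    using assms(1,3,2) b
  proof (induction F rule: finite_ne_induct)
    case (singleton x)
    then show ?case by (intro exI [of _ x]) auto
  next
    case (insert x F)
    then obtain s where s: "s \<in> E" "vconj s = s" "\<And>x. x \<in> F \<Longrightarrow> x \<le> s" "\<phi> s \<le> b"
      by auto
    have x: "x \<in> E" "vconj x = x" "\<phi> x \<le> b" using insert by auto
    show ?case
    proof (intro exI [of _ "vsup x s"] conjI ballI)
      show "\<phi> (vsup x s) \<le> b" using \<phi> [of x s] s x by auto
      show "y \<le> vsup x s" if "y \<in> insert x F" for y
        using that s vsup_upper [OF x(2) s(2)] by (auto intro: order_trans)
    qed (use s x in \<open>auto simp: vsup_real\<close>)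
  qed
  with that show ?thesis by blast
qed

text \<open>
  The gauge is sublinear and turns joins into maxima, so there is a linear functional below it that
  does the same and has the same value at the given vector.  Its complex-linear extension respects
  the modulus: the modulus of \<open>z\<close> is a supremum over the circle, and up to \<open>d * \<bar>z\<bar>\<close> it is bounded by
  the join of the vectors \<open>real_part (w *\<^sub>C z)\<close> for \<open>w\<close> in a finite \<open>d\<close>-net of the circle.
\<close>

theorem character_attains_gauge:
  assumes x\<^sub>0: "x\<^sub>0 \<in> E" "vconj x\<^sub>0 = x\<^sub>0"
  obtains \<phi> where "\<phi> \<in> K" "\<phi> x\<^sub>0 = of_real (gauge u x\<^sub>0)"
proof -
  let ?V = "{x \<in> E. vconj x = x}"
  interpret sup_sublinear ?V vsup
    by unfold_locales (auto simp: subspace_def vconj_add vconj_scaleR vsup_real vsup_add)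
  have sup: "gauge u (vsup x y) \<le> max (gauge u x) (gauge u y)" if "x \<in> ?V" "y \<in> ?V" for x y
  proof (subst gauge_le_iff)
    have "x \<le> max (gauge u x) (gauge u y) *\<^sub>R u" "y \<le> max (gauge u x) (gauge u y) *\<^sub>R u"
      using that by (auto simp flip: gauge_le_iff)
    then show "vsup x y \<le> max (gauge u x) (gauge u y) *\<^sub>R u"
      using that by (intro vsup_least) auto
  qed (use that in \<open>auto simp: vsup_real\<close>)
  obtain \<phi> where \<phi>: "\<And>x y. x \<in> ?V \<Longrightarrow> y \<in> ?V \<Longrightarrow> \<phi> (x + y) = \<phi> x + \<phi> y"
    "\<And>r x. x \<in> ?V \<Longrightarrow> \<phi> (r *\<^sub>R x) = r * \<phi> x" "\<And>x. x \<in> ?V \<Longrightarrow> \<phi> x \<le> gauge u x"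
    "\<And>x y. x \<in> ?V \<Longrightarrow> y \<in> ?V \<Longrightarrow> \<phi> (vsup x y) \<le> max (\<phi> x) (\<phi> y)" "\<phi> x\<^sub>0 = gauge u x\<^sub>0"
    by (rule exists_linear_functional [OF sublinear_gauge sup, of x\<^sub>0]) (use x\<^sub>0 in auto)
  have minus: "\<phi> (- x) = - \<phi> x" if "x \<in> ?V" for x
    using \<phi>(2) [of x "-1"] that by simp
  have nonpos: "\<phi> x \<le> 0" if "x \<in> ?V" "x \<le> 0" for x
  proof -
    have "gauge u x \<le> 0" using that by (simp add: gauge_le_iff)
    then show ?thesis using \<phi>(3) [OF that(1)] by simp
  qed
  have mono: "\<phi> x \<le> \<phi> y" if "x \<in> ?V" "y \<in> ?V" "x \<le> y" for x y
    using nonpos [of "x + - y"] minus [of y] \<phi>(1) [of x "- y"] that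
    by (auto simp: vconj_add vconj_minus vconj_diff)
  have "\<phi> u \<le> 1" "\<phi> (- u) \<le> - 1"
    using \<phi>(3) [of u] \<phi>(3) [of "- u"] gauge_unit_scale [of 1] gauge_unit_scale [of "-1"]
    by (auto simp: vconj_minus)
  then have unit: "\<phi> u = 1" using minus [of u] by simp
  define \<psi> where "\<psi> z = Complex (\<phi> (real_part z)) (\<phi> (imag_part z))" for z
  have V: "real_part z \<in> ?V" "imag_part z \<in> ?V" if "z \<in> E" for z
    using that by auto
  have \<psi>_real: "\<psi> z = of_real (\<phi> z)" if "z \<in> ?V" for z
    using that \<phi>(2) [of 0 0] by (auto simp: \<psi>_def real_part_real imag_part_real complex_eq_iff)
  have \<psi>_add: "\<psi> (x + y) = \<psi> x + \<psi> y" if "x \<in> E" "y \<in> E" for x y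
    using V [OF that(1)] V [OF that(2)] by (simp add: \<psi>_def real_part_add imag_part_add \<phi>(1) complex_eq_iff)
  have \<psi>_scale: "\<psi> (c *\<^sub>C x) = c * \<psi> x" if "x \<in> E" for c x
  proof -
    have "\<phi> (a *\<^sub>R v + b *\<^sub>R w) = a * \<phi> v + b * \<phi> w" if "v \<in> ?V" "w \<in> ?V" for a b v w
      using that by (subst \<phi>(1)) (auto simp: \<phi>(2) vconj_scaleR)
    from this [of _ _ "Re c" "- Im c"] this [of _ _ "Re c" "Im c"] V [OF that]
    show ?thesis
      by (auto simp: \<psi>_def real_part_scaleC imag_part_scaleC complex_eq_iff algebra_simps)
  qed
  have Re_\<psi>: "Re (\<psi> (c *\<^sub>C z)) = \<phi> (real_part (c *\<^sub>C z))" for c z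
    by (simp add: \<psi>_def)
  have \<psi>_abs: "\<phi> \<bar>z\<bar> = cmod (\<psi> z)" if z: "z \<in> E" for z
  proof (rule antisym)
    have "cmod (\<psi> z) = Re (cis (- Arg (\<psi> z)) * \<psi> z)"
    proof -
      have "cis (- Arg (\<psi> z)) * \<psi> z = cis (- Arg (\<psi> z)) * (of_real (cmod (\<psi> z)) * cis (Arg (\<psi> z)))"
        by (metis rcis_cmod_Arg rcis_def)
      also have "\<dots> = of_real (cmod (\<psi> z))"
        by (simp add: cis_mult mult.left_commute)
      finally show ?thesis by simp
    qed
    also have "\<dots> = \<phi> (real_part (cis (- Arg (\<psi> z)) *\<^sub>C z))"
      using z by (simp add: \<psi>_scale flip: Re_\<psi>)
    also have "\<dots> \<le> \<phi> \<bar>z\<bar>"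
      using z by (intro mono abs_upper) auto
    finally show "cmod (\<psi> z) \<le> \<phi> \<bar>z\<bar>" .
    show "\<phi> \<bar>z\<bar> \<le> cmod (\<psi> z)"
    proof (rule field_le_epsilon)
      fix e :: real assume e: "0 < e"
      have A: "0 \<le> \<phi> \<bar>z\<bar>"
        using mono [of 0 "\<bar>z\<bar>"] \<phi>(2) [of 0 0] z by (simp add: abs_nonneg)
      define d where "d = e / (\<phi> \<bar>z\<bar> + 1)"
      have d: "0 < d" using e A by (simp add: d_def)
      obtain F where F: "finite F" "F \<subseteq> sphere 0 1" "sphere (0::complex) 1 \<subseteq> (\<Union>x\<in>F. ball x d)"
        using seq_compact_imp_totally_bounded [of "sphere (0::complex) 1"] d
        by (auto simp: compact_eq_seq_compact_metric [symmetric])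
      have F1: "\<exists>w\<in>F. dist w (cis t) < d" for t
        using F(3) by (auto simp: subset_iff)
      have "\<phi> x \<le> cmod (\<psi> z)" if x: "x \<in> (\<lambda>w. real_part (w *\<^sub>C z)) ` F" for x
      proof -
        obtain w where w: "w \<in> F" "x = real_part (w *\<^sub>C z)" using x by auto
        then have "\<phi> x = Re (w * \<psi> z)" using z by (simp add: \<psi>_scale flip: Re_\<psi>)
        also have "\<dots> \<le> cmod (w * \<psi> z)" by (rule complex_Re_le_cmod)
        also have "\<dots> = cmod (\<psi> z)" using w F by (auto simp: norm_mult)
        finally show ?thesis .
      qed
      moreover have "(\<lambda>w. real_part (w *\<^sub>C z)) ` F \<subseteq> ?V" using z by auto
      moreover have "F \<noteq> {}" using F1 [of 0] by auto
      ultimately obtain s where s: "s \<in> E" "vconj s = s"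
        "\<And>x. x \<in> (\<lambda>w. real_part (w *\<^sub>C z)) ` F \<Longrightarrow> x \<le> s" "\<phi> s \<le> cmod (\<psi> z)"
        using finite_upper_bound [of "(\<lambda>w. real_part (w *\<^sub>C z)) ` F" \<phi> "cmod (\<psi> z)"] F(1) \<phi>(4)
        by blast
      have "\<bar>z\<bar> \<le> s + d *\<^sub>R \<bar>z\<bar>"
      proof (rule abs_least)
        fix t
        obtain w where w: "w \<in> F" "dist w (cis t) < d" using F1 by blast
        have "real_part ((cis t - w) *\<^sub>C z) \<le> \<bar>(cis t - w) *\<^sub>C z\<bar>"
          by (rule real_part_le_abs)
        also have "\<dots> \<le> d *\<^sub>R \<bar>z\<bar>"
          unfolding abs_scaleC using w
          by (intro scaleR_right_mono abs_nonneg) (simp add: dist_norm norm_minus_commute)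
        finally have "real_part (w *\<^sub>C z) + real_part ((cis t - w) *\<^sub>C z) \<le> s + d *\<^sub>R \<bar>z\<bar>"
          using s(3) w by (intro add_mono) auto
        then show "real_part (cis t *\<^sub>C z) \<le> s + d *\<^sub>R \<bar>z\<bar>"
          by (simp add: cvec.scale_left_diff_distrib flip: real_part_add)
      qed
      then have "\<phi> \<bar>z\<bar> \<le> \<phi> (s + d *\<^sub>R \<bar>z\<bar>)"
        using z s by (intro mono) (auto simp: vconj_add vconj_scaleR)
      also have "\<dots> = \<phi> s + d * \<phi> \<bar>z\<bar>"
        using z s by (subst \<phi>(1)) (auto simp: vconj_scaleR \<phi>(2))
      also have "d * \<phi> \<bar>z\<bar> \<le> e"
        using A e by (simp add: d_def field_simps)
      finally show "\<phi> \<bar>z\<bar> \<le> cmod (\<psi> z) + e" using s(4) by simp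
    qed
  qed
  have "\<psi> \<in> K"
    unfolding characters_def using \<psi>_add \<psi>_scale \<psi>_abs
    by (auto simp: \<psi>_real unit)
  moreover have "\<psi> x\<^sub>0 = of_real (gauge u x\<^sub>0)"
    using x\<^sub>0 \<phi>(5) by (simp add: \<psi>_real)
  ultimately show ?thesis by (rule that)
qed

context
  fixes \<phi> assumes \<phi>: "\<phi> \<in> K"
begin

lemma character_add: "x \<in> E \<Longrightarrow> y \<in> E \<Longrightarrow> \<phi> (x + y) = \<phi> x + \<phi> y"
  and character_scaleC: "x \<in> E \<Longrightarrow> \<phi> (c *\<^sub>C x) = c * \<phi> x"
  and character_abs: "x \<in> E \<Longrightarrow> \<phi> \<bar>x\<bar> = of_real (cmod (\<phi> x))"
  and character_unit: "\<phi> u = 1"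
  using \<phi> by (auto simp: characters_def)

lemma character_scaleR: "x \<in> E \<Longrightarrow> \<phi> (r *\<^sub>R x) = of_real r * \<phi> x"
  by (simp add: scaleR_scaleC character_scaleC)

lemma character_minus: "x \<in> E \<Longrightarrow> \<phi> (- x) = - \<phi> x"
  using character_scaleC [of x "-1"] by (simp add: cvec.scale_minus_left)

lemma character_diff: "x \<in> E \<Longrightarrow> y \<in> E \<Longrightarrow> \<phi> (x - y) = \<phi> x - \<phi> y"
  using character_add [of x "- y"] by (simp add: character_minus)

lemma character_zero: "\<phi> 0 = 0"
  using character_scaleC [of 0 0] by simp

lemma character_nonneg:
  assumes "x \<in> E" "0 \<le> x" shows "0 \<le> \<phi> x"
  using character_abs [of x] assms
  by (metis Im_complex_of_real Re_complex_of_real abs_of_nonneg less_eq_complex_def norm_ge_zero zero_complex.simps)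

lemma character_mono:
  assumes "x \<in> E" "y \<in> E" "x \<le> y" shows "\<phi> x \<le> \<phi> y"
  using character_nonneg [of "y - x"] assms by (simp add: character_diff)

lemma character_real:
  assumes "x \<in> E" "vconj x = x" shows "Im (\<phi> x) = 0"
proof -
  have "0 \<le> \<phi> (\<bar>x\<bar> - x)" "0 \<le> \<phi> \<bar>x\<bar>"
    using assms by (auto intro!: character_nonneg abs_nonneg simp: le_abs)
  then show ?thesis using assms by (simp add: character_diff less_eq_complex_def)
qed

lemma character_real_part: "x \<in> E \<Longrightarrow> \<phi> (real_part x) = of_real (Re (\<phi> x))"
  and character_imag_part: "x \<in> E \<Longrightarrow> \<phi> (imag_part x) = of_real (Im (\<phi> x))"
proof -
  assume x: "x \<in> E"
  have "\<phi> x = \<phi> (real_part x + \<i> *\<^sub>C imag_part x)" by (simp flip: real_plus_imag)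
  also have "\<dots> = \<phi> (real_part x) + \<i> * \<phi> (imag_part x)"
    using x by (simp add: character_add character_scaleC)
  finally show "\<phi> (real_part x) = of_real (Re (\<phi> x))" "\<phi> (imag_part x) = of_real (Im (\<phi> x))"
    using character_real [of "real_part x"] character_real [of "imag_part x"] x
    by (auto simp: complex_eq_iff)
qed

lemma character_vconj: "x \<in> E \<Longrightarrow> \<phi> (vconj x) = cnj (\<phi> x)"
proof -
  assume x: "x \<in> E"
  have "2 *\<^sub>R real_part x = x + vconj x" by (simp add: real_part_def)
  then have "\<phi> (2 *\<^sub>R real_part x) = \<phi> x + \<phi> (vconj x)" using x by (simp add: character_add)
  then show ?thesis using x by (simp add: character_scaleR character_real_part complex_eq_iff)
qed

end

text \<open>
  The character at which the gauge of \<open>- x\<close> is attained decides whether \<open>- x \<le> 0\<close>.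
\<close>

lemma character_nonneg_imp:
  assumes x: "x \<in> E" and ge: "\<And>\<phi>. \<phi> \<in> K \<Longrightarrow> 0 \<le> \<phi> x"
  shows "0 \<le> x"
proof -
  have nonpos: "y \<le> 0" if y: "y \<in> E" "vconj y = y" and "\<And>\<phi>. \<phi> \<in> K \<Longrightarrow> Re (\<phi> y) \<le> 0" for y
  proof -
    obtain \<phi> where "\<phi> \<in> K" "\<phi> y = of_real (gauge u y)"
      using character_attains_gauge [OF y] .
    with that have "gauge u y \<le> 0" by force
    then show ?thesis using y by (simp add: gauge_le_iff)
  qed
  have "imag_part x \<le> 0" "- imag_part x \<le> 0" "- real_part x \<le> 0"
    by (rule nonpos; use x ge in \<open>simp add: vconj_minus character_minus character_imag_part
        character_real_part less_eq_complex_def\<close>)+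
  then have "imag_part x = 0" "0 \<le> real_part x"
    by (auto intro: antisym)
  then show ?thesis using real_plus_imag [of x] by simp
qed

lemma le_if_characters:
  assumes "x \<in> E" "y \<in> E" "\<And>\<phi>. \<phi> \<in> K \<Longrightarrow> \<phi> x \<le> \<phi> y"
  shows "x \<le> y"
  using character_nonneg_imp [of "y - x"] assms by (simp add: character_diff)

lemma eq_if_characters:
  assumes "x \<in> E" "y \<in> E" "\<And>\<phi>. \<phi> \<in> K \<Longrightarrow> \<phi> x = \<phi> y"
  shows "x = y"
  by (intro antisym le_if_characters) (simp_all add: assms)

section \<open>Multiplication in a principal ideal\<close>

text \<open>
  The tent map of the unit interval, lifted to the order interval from 0 to \<open>u\<close>.
\<close>

definition tent :: "'a \<Rightarrow> 'a"
  where "tent x = u - \<bar>2 *\<^sub>R x - u\<bar>"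

lemma tent_range:
  assumes "0 \<le> x" "x \<le> u"
  shows "0 \<le> tent x" "tent x \<le> u"
proof -
  have "\<bar>2 *\<^sub>R x - u\<bar> \<le> u"
    using assms add_mono [OF assms(2,2)] add_mono [OF assms(1,1)]
    by (intro abs_le_real) (auto simp: vconj_diff vconj_scaleR nonneg_real scaleR_2 diff_le_eq)
  then show "0 \<le> tent x" "tent x \<le> u" by (auto simp: tent_def abs_nonneg)
qed

lemma order_interval_in: "0 \<le> x \<Longrightarrow> x \<le> u \<Longrightarrow> x \<in> E"
  unfolding principal_ideal_iff [OF nonneg] by (intro exI [of _ 1]) (simp add: abs_of_nonneg)

lemma character_tent:
  assumes "\<phi> \<in> K" "0 \<le> x" "x \<le> u"
  shows "Re (\<phi> (tent x)) = 1 - \<bar>2 * Re (\<phi> x) - 1\<bar>"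
proof -
  have x: "x \<in> E" using assms(2,3) by (rule order_interval_in)
  have "Im (\<phi> x) = 0" using x assms by (intro character_real) (auto simp: nonneg_real)
  then have "\<phi> (2 *\<^sub>R x - u) = of_real (2 * Re (\<phi> x) - 1)"
    using x assms by (simp add: character_diff character_scaleR character_unit complex_eq_iff)
  then show ?thesis
    using x assms by (simp add: tent_def character_diff character_abs character_unit norm_of_real del: of_real_diff of_real_mult)
qed

lemma tent_iterates_range: "0 \<le> x \<Longrightarrow> x \<le> u \<Longrightarrow> 0 \<le> (tent ^^ n) x \<and> (tent ^^ n) x \<le> u"
  by (induction n) (auto intro: tent_range)

text \<open>
  On the unit interval \<open>t - t\<^sup>2\<close> is the sum of \<open>4\<^sup>-\<^sup>k h\<^sup>k(t)\<close> over \<open>k \<ge> 1\<close>, where \<open>h\<close> is the tent map; this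
  is the iteration of \<open>t - t\<^sup>2 = (h(t) + (h(t) - h(t)\<^sup>2)) / 4\<close>.  The series makes sense in the lattice and
  converges in norm.  A character need not be continuous for the norm, but it is monotone, and the
  partial sums approximate the limit up to \<open>4\<^sup>-\<^sup>N u\<close> in the order.
\<close>

lemma exists_square_unit_interval:
  assumes x: "0 \<le> x" "x \<le> u"
  shows "\<exists>w\<in>E. \<forall>\<phi>\<in>K. \<phi> w = (\<phi> x)\<^sup>2"
proof -
  define P where "P N = (\<Sum>k<N. (1/4) ^ Suc k *\<^sub>R (tent ^^ Suc k) x)" for N
  note range = tent_iterates_range [OF x]
  have "summable (\<lambda>k. (1/4) ^ Suc k *\<^sub>R (tent ^^ Suc k) x)"
  proof (rule summable_comparison_test')
    show "summable (\<lambda>k. norm u * (1/4) ^ Suc k)"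
      by (intro summable_mult) (simp add: summable_geometric summable_Suc_iff)
    show "norm ((1/4) ^ Suc k *\<^sub>R (tent ^^ Suc k) x) \<le> norm u * (1/4) ^ Suc k" for k
      using norm_mono [of "(tent ^^ Suc k) x" u] range [of "Suc k"]
      by (simp add: mult_ac mult_left_mono del: funpow.simps)
  qed
  then obtain w where w: "P \<longlonglongrightarrow> w"
    unfolding P_def summable_def sums_def by blast
  have P_step: "P N \<le> P (N + m) \<and> P (N + m) \<le> P N + ((1/4) ^ N - (1/4) ^ (N + m)) *\<^sub>R u" for N m
  proof (induction m)
    case (Suc m)
    let ?d = "(1/4) ^ Suc (N + m) *\<^sub>R (tent ^^ Suc (N + m)) x"
    have d: "0 \<le> ?d" "?d \<le> ((1/4) ^ (N + m) - (1/4) ^ (N + Suc m)) *\<^sub>R u"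
    proof -
      show "0 \<le> ?d" using range [of "Suc (N + m)"] by (intro scaleR_nonneg_nonneg) auto
      have "?d \<le> (1/4) ^ Suc (N + m) *\<^sub>R u"
        using range [of "Suc (N + m)"] by (intro scaleR_left_mono) auto
      also have "\<dots> \<le> ((1/4) ^ (N + m) - (1/4) ^ (N + Suc m)) *\<^sub>R u"
        by (subst scale_unit_le_iff) simp
      finally show "?d \<le> ((1/4) ^ (N + m) - (1/4) ^ (N + Suc m)) *\<^sub>R u" .
    qed
    have "P (N + Suc m) = P (N + m) + ?d" by (simp add: P_def)
    moreover have "P N + 0 \<le> P (N + m) + ?d"
      using Suc d by (intro add_mono) auto
    moreover have "P (N + m) + ?d \<le> (P N + ((1/4) ^ N - (1/4) ^ (N + m)) *\<^sub>R u)
       + ((1/4) ^ (N + m) - (1/4) ^ (N + Suc m)) *\<^sub>R u"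
      using Suc d by (intro add_mono) auto
    moreover have "(P N + ((1/4) ^ N - (1/4) ^ (N + m)) *\<^sub>R u)
       + ((1/4) ^ (N + m) - (1/4) ^ (N + Suc m)) *\<^sub>R u = P N + ((1/4) ^ N - (1/4) ^ (N + Suc m)) *\<^sub>R u"
      unfolding add.assoc scaleR_add_left [symmetric] by simp
    ultimately show ?case by (simp only: add_0_right)
  qed simp
  have limit: "(\<lambda>m. P (m + N)) \<longlonglongrightarrow> w" for N
    using w by (rule LIMSEQ_ignore_initial_segment)
  have bounds: "P N \<le> w" "w \<le> P N + (1/4) ^ N *\<^sub>R u" for N
  proof -
    show "P N \<le> w"
      by (rule tendsto_order_le [OF tendsto_const limit [of N]]) (use P_step [of N] in \<open>auto simp: add.commute [of _ N]\<close>)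
    have "P (m + N) \<le> P N + (1/4) ^ N *\<^sub>R u" for m
    proof -
      have "((1/4) ^ N - (1/4) ^ (N + m)) *\<^sub>R u \<le> (1/4) ^ N *\<^sub>R u"
        by (subst scale_unit_le_iff) simp
      then have "P N + ((1/4) ^ N - (1/4) ^ (N + m)) *\<^sub>R u \<le> P N + (1/4) ^ N *\<^sub>R u"
        by simp
      with P_step [of N m] show ?thesis by (metis add.commute order_trans)
    qed
    then show "w \<le> P N + (1/4) ^ N *\<^sub>R u"
      by (intro tendsto_order_le [OF limit [of N] tendsto_const]) auto
  qed
  have P_in: "P N \<in> E" for N
    unfolding P_def by (induction N) (use range order_interval_in in \<open>auto simp del: funpow.simps\<close>)
  have w_in: "w \<in> E"
    using bounds [of 0] by (intro order_interval_in) (auto simp: P_def)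
  have x_in: "x \<in> E" using x by (rule order_interval_in)
  have "\<phi> (x - w) = (\<phi> x)\<^sup>2" if \<phi>: "\<phi> \<in> K" for \<phi>
  proof -
    define g where "g t = t - t\<^sup>2" for t :: real
    define t where "t k = Re (\<phi> ((tent ^^ k) x))" for k
    have t01: "0 \<le> t k" "t k \<le> 1" for k
    proof -
      have "(tent ^^ k) x \<in> E" using range order_interval_in by blast
      then show "0 \<le> t k" "t k \<le> 1"
        using range [of k] character_mono [OF \<phi>, of 0 "(tent ^^ k) x"] character_mono [OF \<phi>, of "(tent ^^ k) x" u]
        by (auto simp: t_def less_eq_complex_def character_zero [OF \<phi>] character_unit [OF \<phi>])
    qed
    have t_Suc: "t (Suc k) = 1 - \<bar>2 * t k - 1\<bar>" for k
      using character_tent [OF \<phi>] range by (simp add: t_def)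
    have g_step: "g (t k) = (1/4) * t (Suc k) + (1/4) * g (t (Suc k))" for k
      using t01 [of k] by (auto simp: t_Suc g_def abs_if power2_eq_square algebra_simps)
    have gP: "g (t 0) - Re (\<phi> (P N)) = (1/4) ^ N * g (t N)" for N
    proof (induction N)
      case 0 then show ?case by (simp add: P_def character_zero [OF \<phi>])
    next
      case (Suc N)
      have "Re (\<phi> (P (Suc N))) = Re (\<phi> (P N)) + (1/4) ^ Suc N * t (Suc N)"
      proof -
        have "(tent ^^ Suc N) x \<in> E" using range order_interval_in by blast
        then have "\<phi> (P N + (1/4) ^ Suc N *\<^sub>R (tent ^^ Suc N) x) = \<phi> (P N) + of_real ((1/4) ^ Suc N) * \<phi> ((tent ^^ Suc N) x)"
          using P_in [of N] by (simp add: character_add [OF \<phi>] character_scaleR [OF \<phi>] del: funpow.simps)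
        then show ?thesis by (simp add: P_def t_def del: funpow.simps of_real_power of_real_divide power_Suc)
      qed
      with Suc g_step [of N] show ?case by (simp add: algebra_simps)
    qed
    have g01: "0 \<le> g (t k)" "g (t k) \<le> 1" for k
    proof -
      have "g (t k) = t k * (1 - t k)" by (simp add: g_def power2_eq_square algebra_simps)
      then show "0 \<le> g (t k)" "g (t k) \<le> 1"
        using t01 [of k] mult_mono [of "t k" 1 "1 - t k" 1] by auto
    qed
    have "\<bar>Re (\<phi> w) - g (t 0)\<bar> \<le> (1/4) ^ N" for N
    proof -
      have "Re (\<phi> (P N)) \<le> Re (\<phi> w)" "Re (\<phi> w) \<le> Re (\<phi> (P N)) + (1/4) ^ N"
        using character_mono [OF \<phi> P_in w_in bounds(1), of N]
          character_mono [OF \<phi> w_in _ bounds(2), of N] P_in [of N]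
        by (auto simp: less_eq_complex_def character_add [OF \<phi>] character_scaleR [OF \<phi>] character_unit [OF \<phi>])
      moreover have "(1/4) ^ N * g (t N) \<le> (1/4) ^ N" "0 \<le> (1/4) ^ N * g (t N)"
        using g01 [of N] by (auto intro: mult_left_le)
      ultimately show ?thesis using gP [of N] by linarith
    qed
    moreover have "(\<lambda>N. (1/4) ^ N) \<longlonglongrightarrow> (0::real)" by (rule LIMSEQ_realpow_zero) auto
    ultimately have "\<bar>Re (\<phi> w) - g (t 0)\<bar> \<le> 0"
      by (intro LIMSEQ_le_const) auto
    moreover have "Im (\<phi> w) = 0" "Im (\<phi> x) = 0"
      using bounds [of 0] w_in x_in x by (auto intro!: character_real [OF \<phi>] nonneg_real simp: P_def)
    ultimately have "\<phi> w = \<phi> x - (\<phi> x)\<^sup>2"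
      by (simp add: complex_eq_iff g_def t_def power2_eq_square)
    then show ?thesis using w_in x_in by (simp add: character_diff [OF \<phi>])
  qed
  then show ?thesis
    using w_in x_in by (intro bexI [of _ "x - w"]) auto
qed

definition multiplicable :: "'a \<Rightarrow> 'a \<Rightarrow> bool"
  where "multiplicable f g \<longleftrightarrow> (\<exists>h\<in>E. \<forall>\<phi>\<in>K. \<phi> h = \<phi> f * \<phi> g)"

lemma multiplicable_square:
  assumes x: "x \<in> E" "vconj x = x"
  shows "multiplicable x x"
proof -
  obtain c where c: "c > 0" "\<bar>x\<bar> \<le> c *\<^sub>R u"
    using x by (auto simp: principal_ideal_def)
  \<comment> \<open>An affine substitution carries the order interval from \<open>- c u\<close> to \<open>c u\<close> onto the one from 0 to \<open>u\<close>.\<close>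
  define y where "y = (1 / (2 * c)) *\<^sub>R (c *\<^sub>R u + x)"
  have ge: "0 \<le> c *\<^sub>R u + x" and le: "0 \<le> c *\<^sub>R u - x"
    using c minus_le_abs [OF x(2)] le_abs [OF x(2)]
    by (metis diff_ge_0_iff_ge diff_minus_eq_add order_trans)+
  have u: "u = (1 / (2 * c)) *\<^sub>R ((2 * c) *\<^sub>R u)" using c by simp
  have "0 \<le> y" using ge c by (simp add: y_def scaleR_nonneg_nonneg)
  moreover have "y \<le> u"
  proof (subst u, unfold y_def, rule scaleR_left_mono)
    show "c *\<^sub>R u + x \<le> (2 * c) *\<^sub>R u"
    proof -
      have "(2 * c) *\<^sub>R u = c *\<^sub>R u + c *\<^sub>R u" by (simp flip: scaleR_add_left)
      with le show ?thesis by simp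
    qed
  qed (use c in simp)
  ultimately obtain w where w: "w \<in> E" "\<forall>\<phi>\<in>K. \<phi> w = (\<phi> y)\<^sup>2"
    using exists_square_unit_interval [of y] by auto
  have "\<phi> (c\<^sup>2 *\<^sub>R (4 *\<^sub>R w - 4 *\<^sub>R y + u)) = \<phi> x * \<phi> x" if \<phi>: "\<phi> \<in> K" for \<phi>
  proof -
    have y: "y \<in> E" "\<phi> y = (1 / (2 * of_real c)) * (of_real c + \<phi> x)"
      using x by (simp_all add: y_def character_scaleR [OF \<phi>] character_add [OF \<phi>] character_unit [OF \<phi>])
    have "\<phi> (c\<^sup>2 *\<^sub>R (4 *\<^sub>R w - 4 *\<^sub>R y + u)) = (of_real c)\<^sup>2 * (4 * (\<phi> y)\<^sup>2 - 4 * \<phi> y + 1)"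
      using w y(1) \<phi> by (simp add: character_scaleR [OF \<phi>] character_add [OF \<phi>] character_diff [OF \<phi>] character_unit [OF \<phi>])
    also have "\<dots> = \<phi> x * \<phi> x"
      using c unfolding y(2) by (simp add: field_simps power2_eq_square)
    finally show ?thesis .
  qed
  moreover have "c\<^sup>2 *\<^sub>R (4 *\<^sub>R w - 4 *\<^sub>R y + u) \<in> E"
    using w x by (auto simp: y_def)
  ultimately show ?thesis unfolding multiplicable_def by blast
qed

text \<open>
  Polarization.
\<close>

lemma multiplicable_real:
  assumes "x \<in> E" "vconj x = x" "y \<in> E" "vconj y = y"
  shows "multiplicable x y"
proof -
  have "multiplicable (x + y) (x + y)" "multiplicable (x - y) (x - y)"
    using assms by (auto intro!: multiplicable_square simp: vconj_add vconj_diff)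
  then obtain v w where "v \<in> E" "w \<in> E" "\<forall>\<phi>\<in>K. \<phi> v = \<phi> (x + y) * \<phi> (x + y)" "\<forall>\<phi>\<in>K. \<phi> w = \<phi> (x - y) * \<phi> (x - y)"
    unfolding multiplicable_def by blast
  then show ?thesis
    unfolding multiplicable_def using assms
    by (intro bexI [of _ "(1/4) *\<^sub>R (v - w)"])
      (auto simp: character_add character_diff character_scaleR algebra_simps)
qed

theorem multiplicable_in_ideal:
  assumes x: "x \<in> E" and y: "y \<in> E"
  shows "multiplicable x y"
proof -
  let ?r = real_part and ?i = imag_part
  have "multiplicable (?r x) (?r y)" "multiplicable (?r x) (?i y)" "multiplicable (?i x) (?r y)" "multiplicable (?i x) (?i y)"
    using assms by (auto intro: multiplicable_real)
  then obtain a b c d where abcd: "a \<in> E" "b \<in> E" "c \<in> E" "d \<in> E"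
    and *: "\<forall>\<phi>\<in>K. \<phi> a = \<phi> (?r x) * \<phi> (?r y)" "\<forall>\<phi>\<in>K. \<phi> b = \<phi> (?r x) * \<phi> (?i y)"
      "\<forall>\<phi>\<in>K. \<phi> c = \<phi> (?i x) * \<phi> (?r y)" "\<forall>\<phi>\<in>K. \<phi> d = \<phi> (?i x) * \<phi> (?i y)"
    unfolding multiplicable_def by blast
  have "\<phi> (a + \<i> *\<^sub>C (b + c) - d) = \<phi> x * \<phi> y" if \<phi>: "\<phi> \<in> K" for \<phi>
    using abcd * x y \<phi>
    by (simp add: character_add [OF \<phi>] character_diff [OF \<phi>] character_scaleC [OF \<phi>]
        character_real_part [OF \<phi>] character_imag_part [OF \<phi>] complex_eq_iff)
  then show ?thesis
    unfolding multiplicable_def using abcd by (intro bexI [of _ "a + \<i> *\<^sub>C (b + c) - d"]) auto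
qed

definition mult :: "'a \<Rightarrow> 'a \<Rightarrow> 'a"
  where "mult x y = (SOME h. h \<in> E \<and> (\<forall>\<phi>\<in>K. \<phi> h = \<phi> x * \<phi> y))"

lemma
  assumes "x \<in> E" "y \<in> E"
  shows mult_in [simp, intro]: "mult x y \<in> E"
    and character_mult: "\<phi> \<in> K \<Longrightarrow> \<phi> (mult x y) = \<phi> x * \<phi> y"
proof -
  have "\<exists>h. h \<in> E \<and> (\<forall>\<phi>\<in>K. \<phi> h = \<phi> x * \<phi> y)"
    using multiplicable_in_ideal [OF assms] by (auto simp: multiplicable_def)
  then have "mult x y \<in> E \<and> (\<forall>\<phi>\<in>K. \<phi> (mult x y) = \<phi> x * \<phi> y)"
    unfolding mult_def by (rule someI_ex)
  then show "mult x y \<in> E" "\<phi> \<in> K \<Longrightarrow> \<phi> (mult x y) = \<phi> x * \<phi> y" by auto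
qed

end

section \<open>The resolvent\<close>

lemma bounded_clinear_bounded: "bounded_clinear T \<Longrightarrow> bounded_linear T"
  by (simp add: bounded_clinear_def)

lemma bounded_clinear_scaleC: "bounded_clinear T \<Longrightarrow> T (c *\<^sub>C x) = c *\<^sub>C T x"
  by (simp add: bounded_clinear_def)

lemma bounded_clinearI:
  assumes "\<And>x y. T (x + y) = T x + T y" "\<And>c x. T (c *\<^sub>C x) = c *\<^sub>C T x" "\<And>x. norm (T x) \<le> norm x * B"
  shows "bounded_clinear T"
  unfolding bounded_clinear_def
  using assms by (auto intro!: bounded_linear_intro simp: scaleR_scaleC)

text \<open>
  The equation \<open>x + A x = y\<close> is a fixed point problem for the contraction \<open>x \<mapsto> y - A x\<close>.
\<close>

lemma perturbed_identity:
  fixes A :: "'a::{real_normed_vector, complete_space} \<Rightarrow> 'a"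
  assumes A: "bounded_linear A" and c: "c < 1" "0 \<le> c" and le: "\<And>x. norm (A x) \<le> c * norm x"
  shows "bij (\<lambda>x. x + A x)" and "(1 - c) * norm x \<le> norm (x + A x)"
proof -
  interpret A: bounded_linear A by fact
  show ge: "(1 - c) * norm x \<le> norm (x + A x)" for x
    using norm_diff_ineq [of x "A x"] le [of x] by (simp add: algebra_simps)
  have "\<exists>x. x + A x = y" for y
  proof -
    have "\<exists>!x. y - A x = x"
    proof (rule banach_fix_type [OF c(2,1)], intro allI)
      fix a b
      have "dist (y - A a) (y - A b) = norm (A (a - b))"
        by (simp add: dist_norm A.diff norm_minus_commute)
      then show "dist (y - A a) (y - A b) \<le> c * dist a b"
        using le [of "a - b"] by (simp add: dist_norm)
    qed
    then show ?thesis by (metis diff_add_cancel)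
  qed
  moreover have "x = y" if "x + A x = y + A y" for x y
  proof -
    have "(x - y) + A (x - y) = 0" using that by (simp add: A.diff algebra_simps)
    then have "(1 - c) * norm (x - y) \<le> 0" using ge [of "x - y"] by simp
    then have "norm (x - y) \<le> 0" using c by (simp add: mult_le_0_iff)
    then show ?thesis by simp
  qed
  ultimately show "bij (\<lambda>x. x + A x)" unfolding bij_def inj_def surj_def by metis
qed

lemma analytic_on_cball_larger:
  assumes f: "f analytic_on cball (0::complex) r" and r: "0 < r"
  obtains R where "r < R" "f holomorphic_on ball 0 R"
proof -
  obtain U where U: "open U" "cball 0 r \<subseteq> U" "f holomorphic_on U"
    using f unfolding analytic_on_holomorphic by blast
  obtain e where e: "e > 0" "(\<Union>x\<in>cball 0 r. ball x e) \<subseteq> U"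
    using compact_subset_open_imp_ball_epsilon_subset [OF compact_cball U(1,2)] .
  have "ball 0 (r + e) \<subseteq> U"
  proof
    fix w :: complex assume w: "w \<in> ball 0 (r + e)"
    have "w \<in> (\<Union>x\<in>cball 0 r. ball x e)"
    proof (cases "cmod w \<le> r")
      case False
      then have w0: "0 < cmod w" using r by linarith
      define v where "v = of_real (r / cmod w) * w"
      have "cmod v = \<bar>r / cmod w\<bar> * cmod w" by (simp only: v_def norm_mult norm_of_real)
      then have "cmod v = r" using False r w0 by simp
      moreover have "dist v w = cmod w - r"
      proof -
        have "v - w = of_real (r / cmod w - 1) * w" by (simp add: v_def algebra_simps)
        then have "cmod (v - w) = \<bar>r / cmod w - 1\<bar> * cmod w" by (simp only: norm_mult norm_of_real)
        also have "\<dots> = cmod w - r" using False r w0 by (simp add: abs_if field_simps)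
        finally show ?thesis by (simp add: dist_norm)
      qed
      ultimately show ?thesis using w by (auto intro!: bexI [of _ v])
    qed (use e in \<open>auto intro!: bexI [of _ w]\<close>)
    then show "w \<in> U" using e by blast
  qed
  with U(3) have "f holomorphic_on ball 0 (r + e)" by (rule holomorphic_on_subset)
  with e that [of "r + e"] show ?thesis by simp
qed

locale bounded_operator =
  fixes T :: "'a::complex_banach \<Rightarrow> 'a"
  assumes bounded_clinear: "bounded_clinear T"
begin

sublocale bounded_linear T
  using bounded_clinear by (rule bounded_clinear_bounded)

lemmas scaleC = bounded_clinear_scaleC [OF bounded_clinear]

abbreviation resolvent :: "complex \<Rightarrow> 'a \<Rightarrow> 'a"
  where "resolvent l \<equiv> inv (shift l T)"

lemma shift_add: "shift l T (x + y) = shift l T x + shift l T y"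
  by (simp add: shift_def add scaleC_add_right)

lemma shift_scaleC: "shift l T (c *\<^sub>C x) = c *\<^sub>C shift l T x"
  by (simp add: shift_def scaleC cvec.scale_right_diff_distrib scaleC_scaleC mult.commute)

lemma not_in_spectrumI:
  assumes bij: "bij (shift l T)" and bound: "\<And>x. norm x \<le> C * norm (shift l T x)"
  shows "l \<notin> spectrum T" "norm (resolvent l y) \<le> C * norm y"
proof -
  have 1: "shift l T (resolvent l y) = y" for y
    using bij by (simp add: bij_is_surj surj_f_inv_f)
  have 2: "resolvent l (shift l T y) = y" for y
    using bij by (simp add: bij_is_inj inv_f_f)
  show norm: "norm (resolvent l y) \<le> C * norm y" for y
    using bound [of "resolvent l y"] by (simp add: 1)
  have "bounded_clinear (resolvent l)"
  proof (rule bounded_clinearI)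
    show "resolvent l (x + y) = resolvent l x + resolvent l y" for x y
      using 2 [of "resolvent l x + resolvent l y"] by (simp add: shift_add 1)
    show "resolvent l (c *\<^sub>C x) = c *\<^sub>C resolvent l x" for c x
      using 2 [of "c *\<^sub>C resolvent l x"] by (simp add: shift_scaleC 1)
    show "norm (resolvent l x) \<le> norm x * C" for x
      using norm by (simp add: mult.commute)
  qed
  then show "l \<notin> spectrum T"
    unfolding spectrum_def using 1 2 by (auto simp: fun_eq_iff)
qed

lemma
  assumes "l \<notin> spectrum T"
  shows bounded_clinear_resolvent: "bounded_clinear (resolvent l)"
    and shift_resolvent: "shift l T (resolvent l y) = y"
    and resolvent_shift: "resolvent l (shift l T y) = y"
proof -
  obtain R where R: "bounded_clinear R" "R \<circ> shift l T = id" "shift l T \<circ> R = id"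
    using assms by (auto simp: spectrum_def)
  then have "resolvent l = R" by (intro inv_unique_comp)
  then show "bounded_clinear (resolvent l)" using R by simp
  from \<open>resolvent l = R\<close> show "shift l T (resolvent l y) = y" "resolvent l (shift l T y) = y"
    using R by (auto simp: fun_eq_iff)
qed

lemma resolvent_bound:
  assumes "l \<notin> spectrum T"
  obtains C where "C > 0" "\<And>x. norm (resolvent l x) \<le> C * norm x"
  using bounded_linear.pos_bounded [OF bounded_clinear_bounded [OF bounded_clinear_resolvent [OF assms]]]
  by (auto simp: mult.commute)

lemma large_not_in_spectrum:
  assumes K: "\<And>x. norm (T x) \<le> K * norm x" and l: "K < cmod l" and K0: "0 \<le> K"
  shows "l \<notin> spectrum T" "norm (resolvent l y) \<le> 1 / (cmod l - K) * norm y"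
proof -
  have l0: "l \<noteq> 0" using l K0 by auto
  define A where "A x = - (1 / l) *\<^sub>C T x" for x
  have A: "bounded_linear A"
    unfolding A_def using bounded_linear_compose [OF bounded_linear_scaleC_right bounded_linear_axioms] .
  have le: "norm (A x) \<le> K / cmod l * norm x" for x
    using K [of x] l0 by (simp add: A_def norm_scaleC norm_divide divide_simps)
  have c: "K / cmod l < 1" "0 \<le> K / cmod l" using l l0 K0 by auto
  have eq: "shift l T x = l *\<^sub>C (x + A x)" for x
    using l0 by (simp add: A_def shift_def cvec.scale_right_diff_distrib scaleC_scaleC cvec.scale_minus_left)
  have "bij (\<lambda>x. l *\<^sub>C x :: 'a)"
    using l0 by (intro bij_betw_byWitness [where f' = "\<lambda>x. (1 / l) *\<^sub>C x"]) (auto simp: scaleC_scaleC)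
  then have "bij ((\<lambda>x. l *\<^sub>C x) \<circ> (\<lambda>x. x + A x))"
    using perturbed_identity (1) [OF A c le] by (intro bij_comp)
  then have "bij (shift l T)" by (simp add: eq [abs_def] o_def)
  moreover have "norm x \<le> 1 / (cmod l - K) * norm (shift l T x)" for x
    using perturbed_identity (2) [OF A c le, of x] l l0
    by (simp add: eq norm_scaleC divide_simps) (simp add: algebra_simps)
  ultimately show "l \<notin> spectrum T" "norm (resolvent l y) \<le> 1 / (cmod l - K) * norm y"
    by (rule not_in_spectrumI)+
qed

lemma bdd_above_spectrum: "bdd_above (cmod ` spectrum T)"
proof -
  obtain K where "K > 0" "\<And>x. norm (T x) \<le> K * norm x"
    using pos_bounded by (auto simp: mult.commute)
  then show ?thesis
    by (intro bdd_aboveI2 [of _ _ K]) (meson large_not_in_spectrum(1) less_imp_le not_le)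
qed

lemma le_spectral_radius: "l \<in> spectrum T \<Longrightarrow> cmod l \<le> spectral_radius T"
  unfolding spectral_radius_def by (intro cSUP_upper bdd_above_spectrum)

lemma gt_spectral_radius: "spectral_radius T < cmod l \<Longrightarrow> l \<notin> spectrum T"
  using le_spectral_radius by force

lemma point_spectrum_subset: "point_spectrum T \<subseteq> spectrum T"
proof
  fix l assume "l \<in> point_spectrum T"
  then obtain x where x: "x \<noteq> 0" "T x = l *\<^sub>C x" by (auto simp: point_spectrum_def)
  show "l \<in> spectrum T"
  proof (rule ccontr)
    assume "l \<notin> spectrum T"
    then have "resolvent l (shift l T x) = x" "resolvent l (shift l T 0) = 0"
      by (auto simp: resolvent_shift)
    then show False using x by (simp add: shift_def zero)
  qed
qed

text \<open>
  For \<open>l\<close> near \<open>l\<^sub>0\<close>, \<open>l - T\<close> factors as \<open>l\<^sub>0 - T\<close> after a small perturbation of the identity.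
\<close>

lemma resolvent_nearby:
  assumes l\<^sub>0: "l\<^sub>0 \<notin> spectrum T" and C: "0 < C" "\<And>x. norm (resolvent l\<^sub>0 x) \<le> C * norm x"
    and l: "cmod (l - l\<^sub>0) * C \<le> 1 / 2"
  shows "l \<notin> spectrum T" "norm (resolvent l y) \<le> 2 * C * norm y"
proof -
  define A where "A x = (l - l\<^sub>0) *\<^sub>C resolvent l\<^sub>0 x" for x
  have A: "bounded_linear A"
    unfolding A_def using bounded_linear_compose [OF bounded_linear_scaleC_right
        bounded_clinear_bounded [OF bounded_clinear_resolvent [OF l\<^sub>0]]] .
  have le: "norm (A x) \<le> 1 / 2 * norm x" for x
  proof -
    have "norm (A x) \<le> cmod (l - l\<^sub>0) * (C * norm x)"
      unfolding A_def norm_scaleC by (intro mult_left_mono C) auto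
    also have "\<dots> = (cmod (l - l\<^sub>0) * C) * norm x" by simp
    also have "\<dots> \<le> 1 / 2 * norm x" using l by (intro mult_right_mono) auto
    finally show ?thesis .
  qed
  have eq: "shift l T x = shift l\<^sub>0 T (x + A x)" for x
    by (simp add: A_def shift_add shift_scaleC shift_resolvent [OF l\<^sub>0])
       (simp add: shift_def cvec.scale_left_diff_distrib)
  have "bij (shift l\<^sub>0 T)"
    using resolvent_shift [OF l\<^sub>0] shift_resolvent [OF l\<^sub>0]
    by (intro bij_betw_byWitness [where f' = "resolvent l\<^sub>0"]) auto
  then have "bij (shift l\<^sub>0 T \<circ> (\<lambda>x. x + A x))"
    using perturbed_identity (1) [OF A _ _ le] by (intro bij_comp) auto
  then have "bij (shift l T)" by (simp add: eq [abs_def] o_def)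
  moreover have "norm x \<le> 2 * C * norm (shift l T x)" for x
  proof -
    have "norm x \<le> 2 * norm (x + A x)"
      using perturbed_identity (2) [OF A _ _ le, of x] by auto
    also have "x + A x = resolvent l\<^sub>0 (shift l T x)"
      by (simp add: eq resolvent_shift [OF l\<^sub>0])
    finally show ?thesis using C(2) [of "shift l T x"] by linarith
  qed
  ultimately show "l \<notin> spectrum T" "norm (resolvent l y) \<le> 2 * C * norm y"
    by (rule not_in_spectrumI)+
qed

lemma resolvent_locally_bounded:
  assumes "l\<^sub>0 \<notin> spectrum T"
  obtains e C where "e > 0" "C > 0" "\<And>l y. dist l l\<^sub>0 < e \<Longrightarrow> l \<notin> spectrum T \<and> norm (resolvent l y) \<le> C * norm y"
proof -
  obtain C where C: "C > 0" "\<And>x. norm (resolvent l\<^sub>0 x) \<le> C * norm x"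
    using resolvent_bound [OF assms] by metis
  show ?thesis
  proof (rule that [of "1 / (2 * C)" "2 * C"])
    fix l y assume "dist l l\<^sub>0 < 1 / (2 * C)"
    then have "cmod (l - l\<^sub>0) * C \<le> 1 / 2" using C by (simp add: dist_norm field_simps)
    then show "l \<notin> spectrum T \<and> norm (resolvent l y) \<le> 2 * C * norm y"
      using resolvent_nearby [OF assms C] by blast
  qed (use C in auto)
qed

lemma resolvent_bounded_on_compact:
  assumes S: "compact S" "S \<inter> spectrum T = {}"
  obtains C where "\<And>l y. l \<in> S \<Longrightarrow> norm (resolvent l y) \<le> C * norm y"
proof -
  have "\<forall>l\<in>S. \<exists>e>0. \<exists>C. \<forall>m y. dist m l < e \<longrightarrow> norm (resolvent m y) \<le> C * norm y"
  proof
    fix l assume "l \<in> S"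
    then have "l \<notin> spectrum T" using S by auto
    then show "\<exists>e>0. \<exists>C. \<forall>m y. dist m l < e \<longrightarrow> norm (resolvent m y) \<le> C * norm y"
      by (rule resolvent_locally_bounded) blast
  qed
  then obtain e C where e: "\<forall>l\<in>S. e l > 0 \<and> (\<forall>m y. dist m l < e l \<longrightarrow> norm (resolvent m y) \<le> C l * norm y)"
    by metis
  obtain F where F: "F \<subseteq> S" "finite F" "S \<subseteq> (\<Union>l\<in>F. ball l (e l))"
    by (rule compactE_image [OF S(1), of S "\<lambda>l. ball l (e l)"]) (use e in auto)
  show ?thesis
  proof (rule that [of "Max (insert 0 (C ` F))"])
    fix l y assume "l \<in> S"
    then obtain m where m: "m \<in> F" "dist l m < e m" using F by (auto simp: dist_commute)
    then have "norm (resolvent l y) \<le> C m * norm y" using e F by blast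
    also have "\<dots> \<le> Max (insert 0 (C ` F)) * norm y"
      using F m by (intro mult_right_mono) (auto intro: Max_ge)
    finally show "norm (resolvent l y) \<le> Max (insert 0 (C ` F)) * norm y" .
  qed
qed

lemma resolvent_add: "l \<notin> spectrum T \<Longrightarrow> resolvent l (x + y) = resolvent l x + resolvent l y"
  and resolvent_diff: "l \<notin> spectrum T \<Longrightarrow> resolvent l (x - y) = resolvent l x - resolvent l y"
  using bounded_clinear_bounded [OF bounded_clinear_resolvent, of l]
  by (simp_all add: linear_add linear_diff bounded_linear.linear)

lemma resolvent_scaleC: "l \<notin> spectrum T \<Longrightarrow> resolvent l (c *\<^sub>C x) = c *\<^sub>C resolvent l x"
  using bounded_clinear_resolvent by (rule bounded_clinear_scaleC)

lemma resolvent_identity: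
  assumes l: "l \<notin> spectrum T" and m: "m \<notin> spectrum T"
  shows "resolvent l y - resolvent m y = (m - l) *\<^sub>C resolvent l (resolvent m y)"
proof -
  have "y = shift l T (resolvent m y) + (m - l) *\<^sub>C resolvent m y"
    using shift_resolvent [OF m, of y] by (simp add: shift_def cvec.scale_left_diff_distrib algebra_simps)
  then have "resolvent l y = resolvent l (shift l T (resolvent m y) + (m - l) *\<^sub>C resolvent m y)"
    by simp
  then show ?thesis
    by (simp add: resolvent_add resolvent_scaleC resolvent_shift l)
qed

lemma resolvent_commutes:
  assumes l: "l \<notin> spectrum T"
  shows "T (resolvent l y) = resolvent l (T y)"
proof -
  have "shift l T (T (resolvent l y)) = T (shift l T (resolvent l y))"
    by (simp add: shift_def diff scaleC)
  then have "shift l T (T (resolvent l y)) = T y"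
    by (simp add: shift_resolvent l)
  then show ?thesis using resolvent_shift [OF l, of "T (resolvent l y)"] by simp
qed

lemma scaled_resolvent:
  assumes l: "l \<notin> spectrum T"
  shows "l *\<^sub>C resolvent l y = y + resolvent l (T y)"
proof -
  have "l *\<^sub>C resolvent l y - T (resolvent l y) = y"
    using shift_resolvent [OF l, of y] by (simp only: fun_cong [OF shift_def [of l T], of "resolvent l y"])
  then show ?thesis by (simp only: resolvent_commutes [OF l] diff_eq_eq)
qed

text \<open>
  By the resolvent identity the difference is the resolvent at \<open>f i\<close>, whose norm stays bounded,
  applied to a vector that tends to 0.
\<close>

lemma tendsto_resolvent:
  assumes l\<^sub>0: "l\<^sub>0 \<notin> spectrum T" and f: "(f \<longlongrightarrow> l\<^sub>0) F" and v: "(v \<longlongrightarrow> v\<^sub>0) F"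
  shows "((\<lambda>i. resolvent (f i) (v i)) \<longlongrightarrow> resolvent l\<^sub>0 v\<^sub>0) F"
proof -
  obtain e C where e: "e > 0" "C > 0"
    "\<And>l y. dist l l\<^sub>0 < e \<Longrightarrow> l \<notin> spectrum T \<and> norm (resolvent l y) \<le> C * norm y"
    using resolvent_locally_bounded [OF l\<^sub>0] by metis
  let ?d = "\<lambda>i. (v i - v\<^sub>0) - (f i - l\<^sub>0) *\<^sub>C resolvent l\<^sub>0 v\<^sub>0"
  have "((\<lambda>i. resolvent (f i) (v i) - resolvent l\<^sub>0 v\<^sub>0) \<longlongrightarrow> 0) F"
  proof (rule Lim_null_comparison)
    have "eventually (\<lambda>i. dist (f i) l\<^sub>0 < e) F"
      using f e by (simp add: tendsto_iff)
    then show "eventually (\<lambda>i. norm (resolvent (f i) (v i) - resolvent l\<^sub>0 v\<^sub>0) \<le> C * norm (?d i)) F"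
    proof eventually_elim
      case (elim i)
      then have i: "f i \<notin> spectrum T" using e by blast
      have "resolvent (f i) (v i) - resolvent l\<^sub>0 v\<^sub>0
        = resolvent (f i) (v i - v\<^sub>0) + (resolvent (f i) v\<^sub>0 - resolvent l\<^sub>0 v\<^sub>0)"
        by (simp add: resolvent_diff i)
      also have "\<dots> = resolvent (f i) (?d i)"
        by (simp add: resolvent_identity i l\<^sub>0 resolvent_diff resolvent_scaleC cvec.scale_left_diff_distrib)
      finally show ?case using e elim by simp
    qed
    show "((\<lambda>i. C * norm (?d i)) \<longlongrightarrow> 0) F"
      by (rule tendsto_eq_intros tendsto_scaleC f v | simp)+
  qed
  then show ?thesis by (simp add: LIM_zero_iff)
qed

lemma continuous_on_resolvent:
  assumes "continuous_on S f" "continuous_on S v" "\<And>x. x \<in> S \<Longrightarrow> f x \<notin> spectrum T"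
  shows "continuous_on S (\<lambda>x. resolvent (f x) (v x))"
  using assms unfolding continuous_on_def by (auto intro: tendsto_resolvent)

lemma resolvent_has_derivative:
  assumes l: "l \<notin> spectrum T"
  shows "((\<lambda>l. resolvent l z) has_derivative (\<lambda>h. - (h *\<^sub>C resolvent l (resolvent l z)))) (at l)"
  unfolding has_derivative_iff_norm
proof
  show "bounded_linear (\<lambda>h. - (h *\<^sub>C resolvent l (resolvent l z)))"
    by (intro bounded_linear_minus bounded_linear_scaleC_left)
  let ?w = "resolvent l z"
  obtain e C where e: "e > 0" "C > 0"
    "\<And>m y. dist m l < e \<Longrightarrow> m \<notin> spectrum T \<and> norm (resolvent m y) \<le> C * norm y"
    using resolvent_locally_bounded [OF l] by metis
  show "((\<lambda>m. norm (resolvent m z - resolvent l z - - ((m - l) *\<^sub>C resolvent l ?w)) / norm (m - l)) \<longlongrightarrow> 0) (at l)"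
  proof (rule Lim_null_comparison)
    have "((\<lambda>m. resolvent m ?w - resolvent l ?w) \<longlongrightarrow> 0) (at l)"
      by (intro LIM_zero tendsto_resolvent l tendsto_ident_at tendsto_const)
    then show "((\<lambda>m. norm (resolvent m ?w - resolvent l ?w)) \<longlongrightarrow> 0) (at l)"
      by (rule tendsto_norm_zero)
    have "eventually (\<lambda>m. m \<noteq> l \<and> dist m l < e) (at l)"
      using e by (auto simp: eventually_at)
    then show "eventually (\<lambda>m. norm (norm (resolvent m z - resolvent l z - - ((m - l) *\<^sub>C resolvent l ?w)) / norm (m - l))
      \<le> norm (resolvent m ?w - resolvent l ?w)) (at l)"
    proof eventually_elim
      case (elim m)
      then have m: "m \<notin> spectrum T" using e by blast
      have "resolvent m z - resolvent l z - - ((m - l) *\<^sub>C resolvent l ?w)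
        = (l - m) *\<^sub>C (resolvent m ?w - resolvent l ?w)"
        by (simp only: resolvent_identity [OF m l, of z] cvec.scale_right_diff_distrib)
           (simp add: cvec.scale_left_diff_distrib)
      then show ?case
        using elim by (simp add: norm_scaleC norm_minus_commute)
    qed
  qed
qed

lemma resolvent_along_path:
  assumes g: "(g has_vector_derivative d) (at t within S)" and l: "g t \<notin> spectrum T"
  shows "((\<lambda>t. resolvent (g t) z) has_vector_derivative
    - (d *\<^sub>C resolvent (g t) (resolvent (g t) z))) (at t within S)"
proof -
  have "((\<lambda>t. resolvent (g t) z) has_derivative (\<lambda>h. - ((h *\<^sub>R d) *\<^sub>C resolvent (g t) (resolvent (g t) z)))) (at t within S)"
    using has_derivative_compose [OF g [unfolded has_vector_derivative_def] resolvent_has_derivative [OF l]] .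
  then show ?thesis
    unfolding has_vector_derivative_def by (simp add: scaleR_scaleC_assoc scaleR_conv_of_real)
qed

section \<open>The analytic functional calculus as a power series\<close>

definition circle :: "real \<Rightarrow> real \<Rightarrow> complex"
  where "circle r t = of_real r * exp (2 * of_real pi * \<i> * of_real t)"

lemma norm_circle: "cmod (circle r t) = \<bar>r\<bar>"
  by (simp add: circle_def norm_mult)

lemma circle_not_in_spectrum: "spectral_radius T < r \<Longrightarrow> circle r t \<notin> spectrum T"
  by (rule gt_spectral_radius) (simp add: norm_circle)

lemma continuous_on_circle: "continuous_on S (circle r)"
  unfolding circle_def [abs_def] by (intro continuous_intros)

lemma circle_derivative:
  "(circle r has_vector_derivative 2 * of_real pi * \<i> * circle r t) (at t within S)"
  unfolding circle_def [abs_def]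
  by (rule has_vector_derivative_real_field) (auto intro!: derivative_eq_intros)

lemma circle_power_integral: "((\<lambda>t. circle r t ^ Suc m) has_integral 0) {0..1}"
proof -
  let ?F = "\<lambda>t. (1 / (2 * of_real pi * \<i> * of_nat (Suc m))) * circle r t ^ Suc m"
  have "(?F has_vector_derivative circle r t ^ Suc m) (at t within {0..1})" for t
  proof -
    have "((\<lambda>t. circle r t ^ Suc m) has_vector_derivative
      (2 * of_real pi * \<i> * circle r t) * (of_nat (Suc m) * circle r t ^ m)) (at t within {0..1})"
      by (rule field_vector_diff_chain_within [OF circle_derivative, where g = "\<lambda>z. z ^ Suc m", unfolded o_def])
        (auto intro!: derivative_eq_intros simp del: power_Suc)
    then have "(?F has_vector_derivative (1 / (2 * of_real pi * \<i> * of_nat (Suc m))) *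
      ((2 * of_real pi * \<i> * circle r t) * (of_nat (Suc m) * circle r t ^ m))) (at t within {0..1})"
      by (rule has_vector_derivative_mult_right)
    then show ?thesis by (simp del: of_nat_Suc)
  qed
  then have "((\<lambda>t. circle r t ^ Suc m) has_integral ?F 1 - ?F 0) {0..1}"
    by (intro fundamental_theorem_of_calculus) auto
  moreover have "circle r 1 = circle r 0"
    by (simp add: circle_def exp_eq_1)
  ultimately show ?thesis by simp
qed

lemma resolvent_circle_continuous:
  assumes "spectral_radius T < r"
  shows "continuous_on S (\<lambda>t. resolvent (circle r t) z)"
  using assms by (intro continuous_on_resolvent continuous_on_circle circle_not_in_spectrum continuous_on_const)

text \<open>
  Differentiating with respect to the radius and with respect to the angle gives the same derivative
  of the resolvent up to a factor that does not depend on the angle.  Hence the derivative of the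
  integral in the radius is the integral of an angular derivative over a full period, which is 0.
  This replaces Cauchy's theorem for functions with values in a Banach space.
\<close>

lemma resolvent_circle_integral_const:
  assumes ab: "max 0 (spectral_radius T) < a" "a \<le> b"
  shows "integral {0..1} (\<lambda>t. resolvent (circle a t) z) = integral {0..1} (\<lambda>t. resolvent (circle b t) z)"
proof -
  let ?U = "{a..b}"
  let ?e = "\<lambda>t::real. exp (2 * of_real pi * \<i> * of_real t) :: complex"
  let ?D = "\<lambda>r t. - (?e t *\<^sub>C resolvent (circle r t) (resolvent (circle r t) z))"
  have zero: "integral {0..1} (?D r) = 0" if r: "r \<in> ?U" for r
  proof -
    have r': "r > 0" "spectral_radius T < r" using r ab by auto
    let ?c = "1 / (2 * of_real pi * \<i> * of_real r) :: complex"
    \<comment> \<open>The radial derivative \<open>?D\<close> is an angular derivative.\<close>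
    have "((\<lambda>t. ?c *\<^sub>C resolvent (circle r t) z) has_vector_derivative ?D r t) (at t within {0..1})" for t
    proof -
      have "((\<lambda>t. ?c *\<^sub>C resolvent (circle r t) z) has_vector_derivative
        ?c *\<^sub>C (- ((2 * of_real pi * \<i> * circle r t) *\<^sub>C resolvent (circle r t) (resolvent (circle r t) z)))) (at t within {0..1})"
        by (intro bounded_linear.has_vector_derivative [OF bounded_linear_scaleC_right]
            resolvent_along_path circle_derivative circle_not_in_spectrum r')
      moreover have "?c * (2 * of_real pi * \<i> * circle r t) = ?e t"
        using r' by (simp add: circle_def)
      ultimately show ?thesis
        by (simp add: cvec.scale_minus_right scaleC_scaleC)
    qed
    then have "(?D r has_integral (?c *\<^sub>C resolvent (circle r 1) z - ?c *\<^sub>C resolvent (circle r 0) z)) {0..1}"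
      by (intro fundamental_theorem_of_calculus) auto
    moreover have "circle r 1 = circle r 0"
      by (simp add: circle_def exp_eq_1)
    ultimately have "(?D r has_integral 0) {0..1}" by simp
    then show ?thesis by (rule integral_unique)
  qed
  have deriv: "((\<lambda>r. integral (cbox 0 1) (\<lambda>t. resolvent (circle r t) z)) has_vector_derivative
      integral (cbox 0 1) (?D r)) (at r within ?U)" if r: "r \<in> ?U" for r
  proof (rule leibniz_rule_vector_derivative)
    fix r t :: real assume r: "r \<in> ?U"
    have "((\<lambda>r. circle r t) has_vector_derivative ?e t) (at r within ?U)"
      unfolding circle_def [abs_def]
      by (rule has_vector_derivative_real_field) (auto intro!: derivative_eq_intros)
    then show "((\<lambda>r. resolvent (circle r t) z) has_vector_derivative ?D r t) (at r within ?U)"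
      using r ab by (intro resolvent_along_path circle_not_in_spectrum) auto
  next
    fix r assume "r \<in> ?U"
    then show "(\<lambda>t. resolvent (circle r t) z) integrable_on cbox 0 1"
      using ab by (intro integrable_continuous resolvent_circle_continuous) auto
  next
    have "continuous_on (?U \<times> cbox 0 1) (\<lambda>p. ?D (fst p) (snd p))"
      using ab unfolding circle_def
      by (intro continuous_on_minus continuous_on_scaleC continuous_on_resolvent continuous_intros)
        (auto intro!: circle_not_in_spectrum [unfolded circle_def])
    then show "continuous_on (?U \<times> cbox 0 1) (\<lambda>(r, t). ?D r t)"
      by (simp add: case_prod_beta)
  qed (use r in auto)
  have "((\<lambda>r. integral {0..1} (\<lambda>t. resolvent (circle r t) z)) has_vector_derivative 0) (at r within ?U)" if "r \<in> ?U" for r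
    using deriv [OF that] by (simp only: cbox_interval zero [OF that])
  then obtain c where "\<And>r. r \<in> ?U \<Longrightarrow> integral {0..1} (\<lambda>t. resolvent (circle r t) z) = c"
    by (rule has_vector_derivative_zero_constant [rotated]) auto
  then show ?thesis using ab by simp
qed

text \<open>
  The mean of the resolvent over a circle does not depend on the radius, and on large circles the
  resolvent is small.
\<close>

lemma resolvent_circle_integral:
  assumes r: "max 0 (spectral_radius T) < r"
  shows "((\<lambda>t. resolvent (circle r t) z) has_integral 0) {0..1}"
proof -
  let ?J = "\<lambda>r. integral {0..1} (\<lambda>t. resolvent (circle r t) z)"
  obtain K where K: "K > 0" "\<And>x. norm (T x) \<le> K * norm x"
    using pos_bounded by (auto simp: mult.commute)
  have "norm (?J r) \<le> 1 / n * norm z" if n: "n > max r K" for n :: real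
  proof -
    have "norm (resolvent (circle (n + K) t) z) \<le> 1 / n * norm z" for t
      using large_not_in_spectrum (2) [OF K(2), of "circle (n + K) t" z] K(1) n r by (simp add: norm_circle)
    then have "norm (?J (n + K)) \<le> 1 / n * norm z * (1 - 0)"
      using n r K by (intro integral_bound resolvent_circle_continuous) auto
    then show ?thesis
      using resolvent_circle_integral_const [OF r, of "n + K"] n K by simp
  qed
  then have "eventually (\<lambda>n. norm (?J r) \<le> 1 / n * norm z) at_top"
    using eventually_gt_at_top [of "max r K"] by (rule eventually_mono [rotated])
  moreover have "((\<lambda>n::real. 1 / n * norm z) \<longlongrightarrow> 0) at_top"
    by (rule tendsto_mult_left_zero) (simp add: tendsto_inverse_0_at_top filterlim_ident flip: inverse_eq_divide)
  ultimately have "norm (?J r) \<le> 0"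
    by (intro tendsto_lowerbound) auto
  then have "?J r = 0" by simp
  moreover have "(\<lambda>t. resolvent (circle r t) z) integrable_on {0..1}"
    using r by (intro integrable_continuous_real resolvent_circle_continuous) auto
  ultimately show ?thesis by (metis integrable_integral)
qed

text \<open>
  One factor \<open>l\<close> at a time is absorbed by \<open>l R(l) x = x + R(l) T x\<close>; the power of \<open>l\<close> that splits off
  has mean 0 unless it is constant.
\<close>

lemma power_resolvent_circle_integral:
  assumes r: "max 0 (spectral_radius T) < r"
  shows "((\<lambda>t. circle r t ^ Suc m *\<^sub>C resolvent (circle r t) x) has_integral (T ^^ m) x) {0..1}"
proof (induction m arbitrary: x)
  have step: "circle r t ^ Suc m *\<^sub>C resolvent (circle r t) x
      = circle r t ^ m *\<^sub>C x + circle r t ^ m *\<^sub>C resolvent (circle r t) (T x)" for m t x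
  proof -
    have "circle r t ^ Suc m *\<^sub>C resolvent (circle r t) x = circle r t ^ m *\<^sub>C (circle r t *\<^sub>C resolvent (circle r t) x)"
      by (simp add: scaleC_scaleC mult.commute)
    also have "circle r t *\<^sub>C resolvent (circle r t) x = x + resolvent (circle r t) (T x)"
      using r by (intro scaled_resolvent circle_not_in_spectrum) simp
    finally show ?thesis by (simp add: scaleC_add_right)
  qed
  case 0
  have "((\<lambda>t::real. x) has_integral x) {0..1}"
    using has_integral_const_real [of x 0 1] by simp
  then have "((\<lambda>t. x + resolvent (circle r t) (T x)) has_integral x + 0) {0..1}"
    by (intro has_integral_add resolvent_circle_integral r)
  then show ?case using step [of _ 0] by simp
  case (Suc m)
  have "((\<lambda>t. circle r t ^ Suc m *\<^sub>C x) has_integral 0 *\<^sub>C x) {0..1}"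
    using has_integral_linear [OF circle_power_integral [of r m] bounded_linear_scaleC_left [of x]]
    by (simp add: o_def)
  then have "((\<lambda>t. circle r t ^ Suc m *\<^sub>C x + circle r t ^ Suc m *\<^sub>C resolvent (circle r t) (T x))
      has_integral 0 *\<^sub>C x + (T ^^ m) (T x)) {0..1}"
    by (intro has_integral_add Suc)
  then show ?case by (simp add: step [of _ "Suc m"] funpow_Suc_right del: funpow.simps power_Suc)
qed

lemma resolvent_integral_circlepath:
  "resolvent_integral (circlepath 0 r) f T x
    = integral {0..1} (\<lambda>t. f (circle r t) *\<^sub>C (circle r t *\<^sub>C resolvent (circle r t) x))"
proof -
  let ?F = "\<lambda>t. f (circle r t) *\<^sub>C (circle r t *\<^sub>C resolvent (circle r t) x)"
  have eq: "circlepath 0 r t = circle r t" for t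
    by (simp add: circlepath circle_def)
  have "resolvent_integral (circlepath 0 r) f T x =
    (1 / (2 * of_real pi * \<i>)) *\<^sub>C integral {0..1} (\<lambda>t. (2 * of_real pi * \<i>) *\<^sub>C ?F t)"
  proof -
    have "(f (circlepath 0 r t) * vector_derivative (circlepath 0 r) (at t within {0..1})) *\<^sub>C
        resolvent (circlepath 0 r t) x = (2 * of_real pi * \<i>) *\<^sub>C ?F t" if "t \<in> {0..1}" for t
    proof -
      have "vector_derivative (circlepath 0 r) (at t within {0..1}) = 2 * of_real pi * \<i> * circle r t"
        using that by (simp add: vector_derivative_circlepath01 circle_def)
      then show ?thesis by (simp add: eq scaleC_scaleC mult_ac)
    qed
    then have "integral {0..1} (\<lambda>t. (f (circlepath 0 r t) * vector_derivative (circlepath 0 r) (at t within {0..1})) *\<^sub>C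
        resolvent (circlepath 0 r t) x) = integral {0..1} (\<lambda>t. (2 * of_real pi * \<i>) *\<^sub>C ?F t)"
      by (rule integral_cong)
    then show ?thesis by (simp only: resolvent_integral_def)
  qed
  also have "integral {0..1} (\<lambda>t. (2 * of_real pi * \<i>) *\<^sub>C ?F t) = (2 * of_real pi * \<i>) *\<^sub>C integral {0..1} ?F"
  proof (cases "?F integrable_on {0..1}")
    case True
    then show ?thesis
      using integral_linear [OF _ bounded_linear_scaleC_right, of ?F "{0..1}"] by (simp add: o_def)
  next
    case False
    have "\<not> (\<lambda>t. (2 * of_real pi * \<i>) *\<^sub>C ?F t) integrable_on {0..1}"
    proof
      assume "(\<lambda>t. (2 * of_real pi * \<i>) *\<^sub>C ?F t) integrable_on {0..1}"
      from integrable_linear [OF this bounded_linear_scaleC_right [of "1 / (2 * of_real pi * \<i>)"]]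
      show False using False by (simp add: o_def scaleC_scaleC)
    qed
    with False show ?thesis by (simp add: not_integrable_integral)
  qed
  finally show ?thesis by (simp add: scaleC_scaleC)
qed

text \<open>
  The Taylor series of \<open>f\<close> converges uniformly on the circle, where the resolvent is bounded, so
  the integral may be computed term by term.
\<close>

theorem analytic_calculus_power_series:
  assumes f: "f analytic_on cball 0 r" and r: "spectral_radius T < r" "0 < r"
  shows "(\<lambda>m. ((deriv ^^ m) f 0 / fact m) *\<^sub>C (T ^^ m) x) sums resolvent_integral (circlepath 0 r) f T x"
    and "\<exists>C. \<forall>x. norm (resolvent_integral (circlepath 0 r) f T x) \<le> C * norm x"
proof -
  let ?c = "\<lambda>m. (deriv ^^ m) f 0 / fact m"
  let ?F = "\<lambda>x t. f (circle r t) *\<^sub>C (circle r t *\<^sub>C resolvent (circle r t) x)"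
  obtain R where R: "r < R" "f holomorphic_on ball 0 R"
    using analytic_on_cball_larger [OF f r(2)] .
  have series: "(\<lambda>n. ?c n * w ^ n) sums f w" if "cmod w \<le> r" for w
    using holomorphic_power_series [OF R(2), of w] that R(1) by simp
  have summable: "summable (\<lambda>n. cmod (?c n) * r ^ n)"
  proof -
    define q where "q = (r + R) / 2"
    have q: "r < q" "q < R" using R by (auto simp: q_def)
    have "(\<lambda>n. ?c n * of_real q ^ n) sums f (of_real q)"
      using holomorphic_power_series [OF R(2), of "of_real q"] q r by simp
    then have "summable (\<lambda>n. norm (?c n * of_real r ^ n))"
      using q r by (intro powser_insidea [of _ "of_real q"]) (auto simp: sums_iff)
    then show ?thesis using r by (simp add: norm_mult norm_power norm_divide)
  qed
  have "compact (circle r ` {0..1})"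
    by (intro compact_continuous_image continuous_on_circle compact_Icc)
  moreover have "circle r ` {0..1} \<inter> spectrum T = {}"
    using circle_not_in_spectrum r by auto
  ultimately obtain C where C: "\<And>l y. l \<in> circle r ` {0..1} \<Longrightarrow> norm (resolvent l y) \<le> C * norm y"
    using resolvent_bounded_on_compact by metis
  show "(\<lambda>m. ?c m *\<^sub>C (T ^^ m) x) sums resolvent_integral (circlepath 0 r) f T x"
  proof -
    let ?G = "\<lambda>m t. (?c m * circle r t ^ m) *\<^sub>C (circle r t *\<^sub>C resolvent (circle r t) x)"
    have "uniform_limit {0..1} (\<lambda>n t. \<Sum>m<n. ?G m t) (\<lambda>t. \<Sum>m. ?G m t) sequentially"
    proof (rule Weierstrass_m_test)
      fix m and t :: real assume "t \<in> {0..1}"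
      then have "norm (resolvent (circle r t) x) \<le> C * norm x" using C by blast
      then have "cmod (?c m) * r ^ m * (r * norm (resolvent (circle r t) x)) \<le> cmod (?c m) * r ^ m * (r * (C * norm x))"
        using r by (intro mult_left_mono) auto
      then show "norm (?G m t) \<le> cmod (?c m) * r ^ m * (r * (C * norm x))"
        using r by (simp only: norm_scaleC norm_mult norm_power norm_circle abs_of_pos)
    qed (rule summable_mult2 [OF summable])
    moreover have "(\<Sum>m. ?G m t) = ?F x t" for t
    proof -
      have "(\<lambda>m. ?G m t) sums ?F x t"
        using r by (intro bounded_linear.sums [OF bounded_linear_scaleC_left] series) (simp add: norm_circle)
      then show ?thesis by (rule sums_unique [symmetric])
    qed
    ultimately have lim: "uniform_limit {0..1} (\<lambda>n t. \<Sum>m<n. ?G m t) (?F x) sequentially"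
      by simp
    have cont: "continuous_on {0..1} (\<lambda>t. \<Sum>m<n. ?G m t)" for n
      using r by (intro continuous_on_sum continuous_on_scaleC resolvent_circle_continuous
          continuous_on_mult continuous_on_const continuous_on_power continuous_on_circle)
    from uniform_limit_integral [OF lim cont] obtain I J where
      IJ: "\<And>n. ((\<lambda>t. \<Sum>m<n. ?G m t) has_integral I n) {0..1}" "(?F x has_integral J) {0..1}" "I \<longlonglongrightarrow> J"
      by auto
    have "(?G m has_integral ?c m *\<^sub>C (T ^^ m) x) {0..1}" for m
      using has_integral_linear [OF power_resolvent_circle_integral [of r m x] bounded_linear_scaleC_right [of "?c m"]] r
      by (simp add: o_def scaleC_scaleC mult_ac)
    then have "((\<lambda>t. \<Sum>m<n. ?G m t) has_integral (\<Sum>m<n. ?c m *\<^sub>C (T ^^ m) x)) {0..1}" for n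
      by (intro has_integral_sum) auto
    with IJ(1) have "I = (\<lambda>n. \<Sum>m<n. ?c m *\<^sub>C (T ^^ m) x)"
      by (intro ext) (rule has_integral_unique)
    with IJ(3) have "(\<lambda>m. ?c m *\<^sub>C (T ^^ m) x) sums J"
      unfolding sums_def by simp
    also have "J = resolvent_integral (circlepath 0 r) f T x"
      using IJ(2) by (simp add: resolvent_integral_circlepath integral_unique)
    finally show ?thesis .
  qed
  have "continuous_on {0..1} (\<lambda>t. f (circle r t))"
    by (rule continuous_on_compose2 [OF holomorphic_on_imp_continuous_on [OF R(2)] continuous_on_circle])
      (use R(1) r in \<open>auto simp: norm_circle\<close>)
  then have cont: "continuous_on {0..1} (?F x)" for x
    using r by (intro continuous_on_scaleC resolvent_circle_continuous continuous_on_circle)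
  have "bounded ((\<lambda>t. f (circle r t)) ` {0..1})"
    using \<open>continuous_on {0..1} (\<lambda>t. f (circle r t))\<close> by (intro compact_imp_bounded compact_continuous_image compact_Icc)
  then obtain B where B: "B > 0" "\<And>t. t \<in> {0..1} \<Longrightarrow> cmod (f (circle r t)) \<le> B"
    unfolding bounded_pos by auto
  have "norm (resolvent_integral (circlepath 0 r) f T x) \<le> (B * (r * C)) * norm x" for x
  proof -
    have "norm (integral {0..1} (?F x)) \<le> B * (r * (C * norm x)) * (1 - 0)"
    proof (intro integral_bound cont)
      fix t :: real assume t: "t \<in> {0..1}"
      show "norm (?F x t) \<le> B * (r * (C * norm x))"
        unfolding norm_scaleC norm_circle using t r B(1)
        by (intro mult_mono B C mult_nonneg_nonneg) auto
    qed auto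
    then show ?thesis by (simp add: resolvent_integral_circlepath mult_ac)
  qed
  then show "\<exists>C. \<forall>x. norm (resolvent_integral (circlepath 0 r) f T x) \<le> C * norm x"
    by blast
qed

end

section \<open>Averages of the powers of an operator\<close>

text \<open>
  The weights of any finite set of indices vanish in the limit, thus only the tail of \<open>v\<close> counts.
\<close>

lemma weighted_averages_tendsto:
  fixes a :: "nat \<Rightarrow> nat \<Rightarrow> real" and v :: "nat \<Rightarrow> 'b::real_normed_vector"
  assumes a: "\<And>n k. 0 \<le> a n k" "\<And>n. a n sums 1" "\<And>k. (\<lambda>n. a n k) \<longlonglongrightarrow> 0"
    and v: "v \<longlonglongrightarrow> l" and s: "\<And>n. (\<lambda>k. a n k *\<^sub>R v k) sums s n"
  shows "s \<longlonglongrightarrow> l"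
  unfolding tendsto_iff dist_norm
proof (intro allI impI)
  fix e :: real assume e: "0 < e"
  then obtain N where N: "\<And>k. k \<ge> N \<Longrightarrow> norm (v k - l) < e / 2"
    using LIMSEQ_D [OF v, of "e / 2"] by auto
  have bound: "norm (s n - l) \<le> (\<Sum>k<N. a n k * norm (v k - l)) + e / 2" for n
  proof (rule Lim_bounded)
    have "(\<lambda>k. a n k *\<^sub>R v k - a n k *\<^sub>R l) sums (s n - 1 *\<^sub>R l)"
      by (intro sums_diff s bounded_linear.sums [OF bounded_linear_scaleR_left a(2)])
    then show "(\<lambda>m. norm (\<Sum>k<m. a n k *\<^sub>R (v k - l))) \<longlonglongrightarrow> norm (s n - l)"
      by (simp add: sums_def scaleR_diff_right tendsto_norm)
    show "\<forall>m\<ge>0. norm (\<Sum>k<m. a n k *\<^sub>R (v k - l)) \<le> (\<Sum>k<N. a n k * norm (v k - l)) + e / 2"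
    proof (intro allI impI)
      fix m
      have "norm (\<Sum>k<m. a n k *\<^sub>R (v k - l)) \<le> (\<Sum>k<m. a n k * norm (v k - l))"
        using a(1) by (intro order_trans [OF norm_sum] sum_mono) simp
      also have "\<dots> \<le> (\<Sum>k<m. (if k < N then a n k * norm (v k - l) else 0) + a n k * (e / 2))"
      proof (intro sum_mono)
        fix k
        have "a n k * norm (v k - l) \<le> a n k * (e / 2)" if "\<not> k < N"
          using a(1) N [of k] that by (intro mult_left_mono) auto
        then show "a n k * norm (v k - l) \<le> (if k < N then a n k * norm (v k - l) else 0) + a n k * (e / 2)"
          using a(1) [of n k] e by auto
      qed
      also have "\<dots> = (\<Sum>k<m. if k < N then a n k * norm (v k - l) else 0) + (\<Sum>k<m. a n k) * (e / 2)"
        by (simp add: sum.distrib sum_distrib_right)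
      also have "(\<Sum>k<m. if k < N then a n k * norm (v k - l) else 0) \<le> (\<Sum>k<N. a n k * norm (v k - l))"
      proof -
        have "(\<Sum>k<m. if k < N then a n k * norm (v k - l) else 0) = (\<Sum>k\<in>{..<m} \<inter> {k. k < N}. a n k * norm (v k - l))"
          by (simp add: sum.inter_restrict)
        also have "\<dots> \<le> (\<Sum>k<N. a n k * norm (v k - l))"
          using a(1) by (intro sum_mono2) auto
        finally show ?thesis .
      qed
      also have "(\<Sum>k<m. a n k) * (e / 2) \<le> 1 * (e / 2)"
        using sum_le_suminf [of "a n" "{..<m}"] a(1,2) e
        by (intro mult_right_mono) (auto simp: sums_iff)
      finally show "norm (\<Sum>k<m. a n k *\<^sub>R (v k - l)) \<le> (\<Sum>k<N. a n k * norm (v k - l)) + e / 2"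
        by simp
    qed
  qed
  have "(\<lambda>n. \<Sum>k<N. a n k * norm (v k - l)) \<longlonglongrightarrow> (\<Sum>k<N. 0 * norm (v k - l))"
    by (intro tendsto_sum tendsto_mult_right a(3))
  then have "eventually (\<lambda>n. (\<Sum>k<N. a n k * norm (v k - l)) < e / 2) sequentially"
    using e by (intro order_tendstoD) auto
  then show "eventually (\<lambda>n. norm (s n - l) < e) sequentially"
    by eventually_elim (use bound in \<open>smt (verit) field_sum_of_halves\<close>)
qed

text \<open>
  Properties that hold eventually along a net are satisfied at some index; this is all that is
  needed to pass from a net to a sequence.
\<close>

lemma eventually_net_filter:
  assumes "directed_on J R" "eventually P (net_filter J R)"
  shows "\<exists>j\<in>J. P j"
proof -
  note directed = assms(1) [unfolded directed_on_def]
  have ne: "J \<noteq> {}" using directed by (elim conjE)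
  have refl: "\<forall>i\<in>J. R i i" using directed by (elim conjE)
  have trans: "\<forall>i\<in>J. \<forall>j\<in>J. \<forall>k\<in>J. R i j \<longrightarrow> R j k \<longrightarrow> R i k" using directed by (elim conjE)
  have bound: "\<forall>i\<in>J. \<forall>j\<in>J. \<exists>k\<in>J. R i k \<and> R j k" using directed by (elim conjE)
  have "\<exists>i\<in>J. eventually P (principal {j \<in> J. R i j})"
    using assms(2) unfolding net_filter_def
  proof (subst (asm) eventually_INF_base)
    fix i j assume ij: "i \<in> J" "j \<in> J"
    with bound obtain k where k: "k \<in> J" "R i k" "R j k" by blast
    have "R i l \<and> R j l" if "l \<in> J" "R k l" for l
      using trans ij k that by blast
    then show "\<exists>k\<in>J. principal {l \<in> J. R k l} \<le> inf (principal {l \<in> J. R i l}) (principal {l \<in> J. R j l})"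
      using k by (intro bexI [of _ k]) auto
  qed (use ne in auto)
  then obtain i where i: "i \<in> J" "\<forall>l\<in>{j \<in> J. R i j}. P l"
    unfolding eventually_principal by (rule bexE)
  with refl have "P i" by simp
  with i(1) show ?thesis by (rule bexI [rotated])
qed

context bounded_operator
begin

lemma funpow_bounded_linear: "bounded_linear (T ^^ k)"
  by (induction k) (auto simp: id_def bounded_linear_ident o_def
      intro!: bounded_linear_compose [OF bounded_linear_axioms])

lemma analytic_calculus_sums:
  assumes T: "spectral_radius T = 1" and f: "f analytic_on cball 0 1"
  shows "(\<lambda>m. ((deriv ^^ m) f 0 / fact m) *\<^sub>C (T ^^ m) x) sums analytic_calculus f T x"
    and "norm (analytic_calculus f T x) \<le> onorm (analytic_calculus f T) * norm x"
proof -
  let ?P = "\<lambda>\<rho>. spectral_radius T < \<rho> \<and> 0 < \<rho> \<and> f analytic_on cball 0 \<rho>"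
  obtain R where R: "1 < R" "f holomorphic_on ball 0 R"
    using analytic_on_cball_larger [OF f] by auto
  have "f analytic_on ball 0 R" using R by (simp add: analytic_on_open)
  then have "f analytic_on cball 0 ((1 + R) / 2)"
    using R by (elim analytic_on_subset) auto
  then have "?P ((1 + R) / 2)" using R T by auto
  then have \<rho>: "?P (SOME \<rho>. ?P \<rho>)" by (rule someI)
  then show sums: "(\<lambda>m. ((deriv ^^ m) f 0 / fact m) *\<^sub>C (T ^^ m) x) sums analytic_calculus f T x" for x
    unfolding analytic_calculus_def by (intro analytic_calculus_power_series) auto
  obtain C where C: "\<And>x. norm (analytic_calculus f T x) \<le> C * norm x"
    using analytic_calculus_power_series (2) [of f "SOME \<rho>. ?P \<rho>"] \<rho>
    unfolding analytic_calculus_def by blast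
  have "bounded_linear (analytic_calculus f T)"
  proof (rule bounded_linear_intro [where K = C])
    fix x y :: 'a and r :: real
    interpret pow: bounded_linear "T ^^ k" for k by (rule funpow_bounded_linear)
    show "analytic_calculus f T (x + y) = analytic_calculus f T x + analytic_calculus f T y"
      using sums_add [OF sums [of x] sums [of y]] sums [of "x + y"]
      by (simp add: pow.add scaleC_add_right sums_iff)
    show "analytic_calculus f T (r *\<^sub>R x) = r *\<^sub>R analytic_calculus f T x"
      using sums_scaleR_right [OF sums [of x], of r] sums [of "r *\<^sub>R x"]
      by (simp add: pow.scaleR scaleC_scaleR scaleR_scaleC_assoc mult.commute sums_iff)
    show "norm (analytic_calculus f T x) \<le> norm x * C" using C by (simp add: mult.commute)
  qed
  then show "norm (analytic_calculus f T x) \<le> onorm (analytic_calculus f T) * norm x"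
    by (rule onorm)
qed

text \<open>
  The weights are the Taylor coefficients of the functions \<open>f j\<close>.  Since they are non-negative, the
  \<open>k\<close>-th one is at most \<open>2\<^sup>k f j (1/2)\<close>, and a sequence of indices with \<open>f j (1/2) \<rightarrow> 0\<close> suffices to
  make all of them tend to 0.
\<close>

theorem ws_bounded_averages:
  assumes T: "spectral_radius T = 1" and ws: "ws_bounded TYPE('j) T"
  obtains a A M where "\<And>n k. 0 \<le> a n k" "\<And>n. a n sums 1" "\<And>k. (\<lambda>n. a n k) \<longlonglongrightarrow> 0"
    "\<And>n x. (\<lambda>k. a n k *\<^sub>R (T ^^ k) x) sums A n x" "\<And>n x. norm (A n x) \<le> M * norm x"
proof -
  obtain J :: "'j set" and R f where scheme: "weighting_scheme J R f"
    and bdd: "bdd_above ((\<lambda>j. onorm (analytic_calculus (f j) T)) ` J)"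
    using ws unfolding ws_bounded_def by blast
  have dir: "directed_on J R" and ana: "\<And>j. j \<in> J \<Longrightarrow> f j analytic_on cball 0 1"
    and one: "\<And>j. j \<in> J \<Longrightarrow> f j 1 = 1" and pos: "\<And>j k. j \<in> J \<Longrightarrow> (deriv ^^ k) (f j) 0 \<in> \<real>\<^sub>\<ge>\<^sub>0"
    and lim: "\<And>z. cmod z < 1 \<Longrightarrow> ((\<lambda>j. cmod (f j z)) \<longlongrightarrow> 0) (net_filter J R)"
    using scheme by (auto simp: weighting_scheme_def)
  have "\<exists>j\<in>J. cmod (f j (1/2)) < 1 / real (Suc n)" for n
    by (rule eventually_net_filter [OF dir], rule order_tendstoD [OF lim]) auto
  then obtain j where j: "\<And>n. j n \<in> J" "\<And>n. cmod (f (j n) (1/2)) < 1 / real (Suc n)"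
    by metis
  obtain M where M: "\<And>i. i \<in> J \<Longrightarrow> onorm (analytic_calculus (f i) T) \<le> M"
    using bdd by (auto simp: bdd_above_def)
  define a where "a n k = Re ((deriv ^^ k) (f (j n)) 0) / fact k" for n k
  have a: "(deriv ^^ k) (f (j n)) 0 / fact k = of_real (a n k)" "0 \<le> a n k" for n k
    using pos [OF j(1), of k n] by (auto simp: a_def nonneg_Reals_def)
  have series: "(\<lambda>k. of_real (a n k) * w ^ k) sums f (j n) w" if "cmod w \<le> 1" for n w
  proof -
    obtain R where R: "1 < R" "f (j n) holomorphic_on ball 0 R"
      using analytic_on_cball_larger [OF ana [OF j(1)]] by auto
    show ?thesis
      using holomorphic_power_series [OF R(2), of w] that R(1) by (simp add: a(1))
  qed
  show ?thesis
  proof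
    show "0 \<le> a n k" for n k by (rule a)
    show "a n sums 1" for n
      using sums_Re [OF series [of 1 n]] one [OF j(1)] by simp
    show "(\<lambda>n. a n k) \<longlonglongrightarrow> 0" for k
    proof (rule tendsto_sandwich [OF _ _ tendsto_const])
      show "(\<lambda>n. 2 ^ k * (1 / real (Suc n))) \<longlonglongrightarrow> 0"
        by (intro tendsto_mult_right_zero LIMSEQ_Suc [OF lim_1_over_n])
      have "a n k \<le> 2 ^ k * (1 / real (Suc n))" for n
      proof -
        have "(\<lambda>k. Re (of_real (a n k) * (1/2) ^ k)) sums Re (f (j n) (1/2))"
          by (intro sums_Re series) auto
        moreover have "Re (of_real (a n k) * (1/2) ^ k) = a n k * (1/2) ^ k" for k
        proof -
          have "of_real (a n k) * (1/2) ^ k = (of_real (a n k * (1/2) ^ k) :: complex)" by simp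
          then show ?thesis by (simp only: Re_complex_of_real)
        qed
        ultimately have "(\<lambda>k. a n k * (1/2) ^ k) sums Re (f (j n) (1/2))" by simp
        then have "(\<Sum>k\<in>{k}. a n k * (1/2) ^ k) \<le> Re (f (j n) (1/2))"
          using a(2) by (metis (no_types, lifting) finite.intros mult_nonneg_nonneg sum_le_suminf sums_iff zero_le_power
              zero_le_divide_1_iff zero_le_numeral)
        also have "\<dots> \<le> 1 / real (Suc n)"
          using j(2) [of n] complex_Re_le_cmod [of "f (j n) (1/2)"] by linarith
        finally show ?thesis by (simp add: power_divide field_simps)
      qed
      then show "eventually (\<lambda>n. a n k \<le> 2 ^ k * (1 / real (Suc n))) sequentially" by simp
    qed (use a in auto)
    show "(\<lambda>k. a n k *\<^sub>R (T ^^ k) x) sums analytic_calculus (f (j n)) T x" for n x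
      using analytic_calculus_sums (1) [OF T ana [OF j(1)], of n x] by (simp add: a scaleR_scaleC)
    show "norm (analytic_calculus (f (j n)) T x) \<le> M * norm x" for n x
      using analytic_calculus_sums (2) [OF T ana [OF j(1)], of n x] mult_right_mono [OF M [OF j(1)], of "norm x" n]
      by simp
  qed
qed

end

section \<open>Closed ideals and quasi-interior points\<close>

text \<open>
  Only solidity needs an argument.  For positive \<open>x \<le> \<bar>y\<bar>\<close> with \<open>y = lim f\<close>, the meets of \<open>x\<close> with
  \<open>\<bar>f n\<bar>\<close> are in the ideal and tend to \<open>x\<close>; a general \<open>x\<close> is a combination of four positive vectors.
\<close>

lemma lattice_ideal_closure:
  assumes I: "lattice_ideal (I :: 'a::complex_banach_lattice set)"
  shows "lattice_ideal (closure I)"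
proof -
  have add: "x + y \<in> closure I" if "x \<in> closure I" "y \<in> closure I" for x y
  proof -
    from that obtain f g where "\<And>n. f n \<in> I" "f \<longlonglongrightarrow> x" "\<And>n. g n \<in> I" "g \<longlonglongrightarrow> y"
      unfolding closure_sequential by blast
    then show ?thesis
      unfolding closure_sequential using lattice_ideal_add [OF I]
      by (intro exI [of _ "\<lambda>n. f n + g n"]) (auto intro: tendsto_add)
  qed
  have scale: "c *\<^sub>C x \<in> closure I" if "x \<in> closure I" for c x
  proof -
    from that obtain f where "\<And>n. f n \<in> I" "f \<longlonglongrightarrow> x"
      unfolding closure_sequential by blast
    then show ?thesis
      unfolding closure_sequential using lattice_ideal_scaleC [OF I]
      by (intro exI [of _ "\<lambda>n. c *\<^sub>C f n"]) (auto intro: tendsto_scaleC)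
  qed
  have nonneg: "x \<in> closure I" if y: "y \<in> closure I" and x: "0 \<le> x" "x \<le> \<bar>y\<bar>" for x y
  proof -
    from y obtain f where f: "\<And>n. f n \<in> I" "f \<longlonglongrightarrow> y"
      unfolding closure_sequential by blast
    have real: "vconj x = x" "\<And>n. vconj \<bar>f n\<bar> = \<bar>f n\<bar>" using x by (auto simp: nonneg_real)
    have "vinf x \<bar>f n\<bar> \<in> I" for n
    proof (rule lattice_ideal_solid [OF I f(1)])
      have "0 \<le> vinf x \<bar>f n\<bar>" using real x by (intro vinf_greatest abs_nonneg) auto
      then show "\<bar>vinf x \<bar>f n\<bar>\<bar> \<le> \<bar>f n\<bar>" using vinf_lower (2) [OF real] by (simp add: abs_of_nonneg)
    qed
    moreover have "(\<lambda>n. vinf x \<bar>f n\<bar>) \<longlonglongrightarrow> vinf x \<bar>y\<bar>"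
      by (intro tendsto_vinf tendsto_const tendsto_abs f)
    moreover have "vinf x \<bar>y\<bar> = x"
      using real x by (intro antisym vinf_lower vinf_greatest) auto
    ultimately show ?thesis
      unfolding closure_sequential by (intro exI [of _ "\<lambda>n. vinf x \<bar>f n\<bar>"]) simp
  qed
  have real: "x \<in> closure I" if y: "y \<in> closure I" and x: "vconj x = x" "\<bar>x\<bar> \<le> \<bar>y\<bar>" for x y
  proof -
    have "pos_part x \<in> closure I" "pos_part (- x) \<in> closure I"
      using x pos_part_le_abs [of x] pos_part_le_abs [of "- x"]
      by (auto intro!: nonneg [OF y] pos_part_nonneg simp: vconj_minus abs_minus intro: order_trans)
    then have "pos_part x + (-1) *\<^sub>C pos_part (- x) \<in> closure I"
      by (intro add scale)
    then show ?thesis by (simp add: cvec.scale_minus_left pos_part_diff)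
  qed
  have "x \<in> closure I" if y: "y \<in> closure I" and x: "\<bar>x\<bar> \<le> \<bar>y\<bar>" for x y
  proof -
    have "real_part x \<in> closure I" "imag_part x \<in> closure I"
      using real_part_abs_le [of x] imag_part_abs_le [of x] x by (auto intro!: real [OF y] intro: order_trans)
    then have "real_part x + \<i> *\<^sub>C imag_part x \<in> closure I" by (intro add scale)
    then show ?thesis by (simp flip: real_plus_imag)
  qed
  moreover have "0 \<in> closure I" using lattice_ideal_0 [OF I] closure_subset by blast
  ultimately show ?thesis
    unfolding lattice_ideal_def cvec.subspace_def using add scale by blast
qed

text \<open>
  A vector disjoint from \<open>p\<close> is disjoint from the ideal generated by \<open>p\<close>, by continuity from its
  closure, and so from itself.
\<close>

lemma quasi_interior_disjoint:
  fixes p m :: "'a::complex_banach_lattice"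
  assumes p: "quasi_interior p" and m: "0 \<le> m" "vinf p m = 0"
  shows "m = 0"
proof -
  have p0: "0 \<le> p" and "m \<in> closure (principal_ideal p)" using p by (auto simp: quasi_interior_def)
  then obtain f where f: "\<And>n. f n \<in> principal_ideal p" "f \<longlonglongrightarrow> m"
    unfolding closure_sequential by blast
  have real: "vconj p = p" "vconj m = m" using p0 m by (auto simp: nonneg_real)
  have "vinf \<bar>f n\<bar> m = 0" for n
  proof -
    obtain c where c: "\<bar>f n\<bar> \<le> c *\<^sub>R p" using f by (auto simp: principal_ideal_def)
    \<comment> \<open>A factor of at least 1 keeps \<open>(1 / d) *\<^sub>R w\<close> below \<open>w\<close>.\<close>
    define d where "d = max c 1"
    have d: "1 \<le> d" "\<bar>f n\<bar> \<le> d *\<^sub>R p"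
      using c p0 scaleR_right_mono [of c "max c 1" p] by (auto simp: d_def)
    define w where "w = vinf \<bar>f n\<bar> m"
    have w: "0 \<le> w" "w \<le> \<bar>f n\<bar>" "w \<le> m"
      unfolding w_def using real m by (auto intro!: vinf_greatest vinf_lower abs_nonneg)
    have "(1 / d) *\<^sub>R w \<le> (1 / d) *\<^sub>R (d *\<^sub>R p)"
      using w d by (intro scaleR_left_mono) (auto intro: order_trans)
    then have "(1 / d) *\<^sub>R w \<le> p" using d by simp
    moreover have "(1 / d) *\<^sub>R w \<le> m"
      using w d by (intro order_trans [OF scaleR_left_le_one_le]) auto
    ultimately have "(1 / d) *\<^sub>R w \<le> 0"
      using vinf_greatest [OF real, of "(1 / d) *\<^sub>R w"] m(2) by simp
    then have "d *\<^sub>R ((1 / d) *\<^sub>R w) \<le> d *\<^sub>R 0" using d by (intro scaleR_left_mono) auto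
    then have "w \<le> 0" using d by simp
    then have "w = 0" using w(1) by (rule antisym)
    then show ?thesis by (simp only: w_def)
  qed
  moreover have "(\<lambda>n. vinf \<bar>f n\<bar> m) \<longlonglongrightarrow> vinf \<bar>m\<bar> m"
    by (intro tendsto_vinf tendsto_abs f tendsto_const)
  ultimately have "vinf m m = 0"
    using m by (simp add: abs_of_nonneg LIMSEQ_const_iff)
  then show ?thesis by (simp add: vinf_def flip: scaleR_2)
qed

section \<open>Positive operators\<close>

locale positive_operator = bounded_operator T for T :: "'a::complex_banach_lattice \<Rightarrow> 'a" +
  assumes positive: "positive_op T"
begin

lemma nonneg: "0 \<le> x \<Longrightarrow> 0 \<le> T x"
  using positive by (simp add: positive_op_def)

lemma mono: "x \<le> y \<Longrightarrow> T x \<le> T y"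
  using nonneg [of "y - x"] by (simp add: diff)

lemma preserves_real:
  assumes "vconj x = x" shows "vconj (T x) = T x"
proof -
  have "vconj (T \<bar>x\<bar> - T (\<bar>x\<bar> - x)) = T \<bar>x\<bar> - T (\<bar>x\<bar> - x)"
    unfolding vconj_diff using assms
    by (intro arg_cong2 [where f = minus] nonneg_real nonneg abs_nonneg) (simp add: le_abs)
  then show ?thesis by (simp add: diff)
qed

lemma real_part_commutes: "real_part (T z) = T (real_part z)"
proof -
  have "T z = T (real_part z) + \<i> *\<^sub>C T (imag_part z)"
    by (subst real_plus_imag [of z]) (simp add: add scaleC)
  then show ?thesis
    using preserves_real [of "imag_part z"] preserves_real [of "real_part z"]
    by (simp add: real_part_add real_part_scaleC_real real_part_real)
qed

lemma imag_part_commutes: "imag_part (T z) = T (imag_part z)"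
  by (simp add: imag_part_def scaleC neg flip: real_part_commutes)

lemma abs_le: "\<bar>T z\<bar> \<le> T \<bar>z\<bar>"
  by (rule abs_least) (simp add: mono abs_upper real_part_commutes flip: scaleC)

lemma funpow_nonneg: "0 \<le> x \<Longrightarrow> 0 \<le> (T ^^ k) x"
  by (induction k) (auto intro: nonneg)

lemma funpow_mono: "x \<le> y \<Longrightarrow> (T ^^ k) x \<le> (T ^^ k) y"
  by (induction k) (auto intro: mono)

lemma funpow_incseq:
  assumes "u \<le> T u" shows "(T ^^ k) u \<le> (T ^^ Suc k) u"
  using funpow_mono [OF assms, of k] by (simp add: funpow_swap1)

end

section \<open>Irreducible operators with bounded averages\<close>

text \<open>
  What (WS)-boundedness provides for the order-theoretic arguments.  The weights of the averages \<open>A n\<close>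
  escape to infinity: each single weight tends to 0 although their sum is always 1.
\<close>

locale averaged_irreducible = positive_operator T for T :: "'a::complex_banach_lattice \<Rightarrow> 'a" +
  fixes a :: "nat \<Rightarrow> nat \<Rightarrow> real" and A :: "nat \<Rightarrow> 'a \<Rightarrow> 'a" and M :: real
  assumes irreducible: "irreducible_op T"
    and weight_nonneg: "0 \<le> a n k" and weight_sum: "a n sums 1" and weight_lim: "(\<lambda>n. a n k) \<longlonglongrightarrow> 0"
    and average: "(\<lambda>k. a n k *\<^sub>R (T ^^ k) x) sums A n x"
    and average_bound: "norm (A n x) \<le> M * norm x"
begin

lemma average_add: "A n (x + y) = A n x + A n y"
  using sums_add [OF average [of n x] average [of n y]] average [of n "x + y"]
  by (simp add: linear_add [OF bounded_linear.linear [OF funpow_bounded_linear]] scaleR_add_right sums_iff)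

lemma average_scaleR: "A n (r *\<^sub>R x) = r *\<^sub>R A n x"
  using sums_scaleR_right [OF average [of n x], of r] average [of n "r *\<^sub>R x"]
  by (simp add: linear_scale [OF bounded_linear.linear [OF funpow_bounded_linear]] mult.commute sums_iff)

lemma average_diff: "A n (x - y) = A n x - A n y"
  using average_add [of n "x - y" y] by (simp add: algebra_simps)

lemma average_nonneg:
  assumes "0 \<le> x" shows "0 \<le> A n x"
proof (rule tendsto_nonneg)
  show "(\<lambda>m. \<Sum>k<m. a n k *\<^sub>R (T ^^ k) x) \<longlonglongrightarrow> A n x" using average by (simp add: sums_def)
qed (use assms in \<open>auto intro!: always_eventually sum_nonneg scaleR_nonneg_nonneg weight_nonneg funpow_nonneg\<close>)

lemma average_ge:
  assumes "u \<le> T u" shows "u \<le> A n u"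
proof -
  have ge: "u \<le> (T ^^ k) u" for k
    by (induction k) (use funpow_incseq [OF assms] in \<open>auto intro: order_trans simp del: funpow.simps\<close>)
  have "(\<lambda>k. a n k *\<^sub>R (T ^^ k) u - a n k *\<^sub>R u) sums (A n u - 1 *\<^sub>R u)"
    by (intro sums_diff average bounded_linear.sums [OF bounded_linear_scaleR_left weight_sum])
  then have "(\<lambda>m. \<Sum>k<m. a n k *\<^sub>R ((T ^^ k) u - u)) \<longlonglongrightarrow> A n u - u"
    by (simp add: sums_def scaleR_diff_right)
  then have "0 \<le> A n u - u"
    by (rule tendsto_nonneg) (auto intro!: always_eventually sum_nonneg scaleR_nonneg_nonneg weight_nonneg simp: ge)
  then show ?thesis by simp
qed

text \<open>
  The set of all such \<open>x\<close> is a closed invariant ideal; it is closed because the averages are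
  uniformly bounded, and it does not contain \<open>u\<close> because \<open>u \<le> A n u\<close>.
\<close>

lemma average_null:
  assumes u: "0 \<le> u" "u \<noteq> 0" "u \<le> T u"
    and \<phi>: "bounded_linear \<phi>" "\<And>x. 0 \<le> x \<Longrightarrow> 0 \<le> \<phi> x" "\<phi> u = norm u"
    and x: "\<And>k. (\<lambda>n. \<phi> (A n ((T ^^ k) \<bar>x\<bar>))) \<longlonglongrightarrow> (0::real)"
  shows "x = 0"
proof -
  interpret \<phi>: bounded_linear \<phi> by fact
  let ?q = "\<lambda>n x. \<phi> (A n x)"
  let ?I = "{x. \<forall>k. (\<lambda>n. ?q n ((T ^^ k) \<bar>x\<bar>)) \<longlonglongrightarrow> 0}"
  have q_nonneg: "0 \<le> ?q n x" if "0 \<le> x" for n x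
    using that by (intro \<phi>(2) average_nonneg)
  have q_mono: "?q n x \<le> ?q n y" if "x \<le> y" for n x y
    using q_nonneg [of "y - x" n] that by (simp add: average_diff \<phi>.diff)
  have sandwich: "(\<lambda>n. ?q n x) \<longlonglongrightarrow> 0" if "0 \<le> x" "x \<le> y" "(\<lambda>n. ?q n y) \<longlonglongrightarrow> 0" for x y
    using that by (intro tendsto_sandwich [OF _ _ tendsto_const that(3)] always_eventually allI q_mono q_nonneg)
  have pow_add: "(T ^^ k) (x + y) = (T ^^ k) x + (T ^^ k) y" and pow_scale: "(T ^^ k) (r *\<^sub>R x) = r *\<^sub>R (T ^^ k) x" for k x y r
    by (simp_all add: linear_add linear_scale bounded_linear.linear funpow_bounded_linear)
  have solid: "x \<in> ?I" if y: "y \<in> ?I" and xy: "\<bar>x\<bar> \<le> \<bar>y\<bar>" for x y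
    using y xy by (auto intro: sandwich [OF funpow_nonneg [OF abs_nonneg] funpow_mono [OF xy]])
  have ideal: "lattice_ideal ?I"
    unfolding lattice_ideal_def cvec.subspace_def
  proof (intro conjI allI impI ballI)
    show "0 \<in> ?I"
      using pow_scale [of _ 0 0] average_scaleR [of _ 0 0] by (simp add: \<phi>.zero)
    show "x + y \<in> ?I" if "x \<in> ?I" "y \<in> ?I" for x y
    proof -
      have "(\<lambda>n. ?q n ((T ^^ k) (\<bar>x\<bar> + \<bar>y\<bar>))) \<longlonglongrightarrow> 0 + 0" for k
        unfolding pow_add average_add \<phi>.add using that by (intro tendsto_add) auto
      then show ?thesis
        by (auto intro: sandwich [OF funpow_nonneg [OF abs_nonneg] funpow_mono [OF abs_triangle]])
    qed
    show "c *\<^sub>C x \<in> ?I" if "x \<in> ?I" for c x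
      using that by (auto simp: abs_scaleC pow_scale average_scaleR \<phi>.scaleR intro: tendsto_mult_right_zero)
  qed (use solid in auto)
  have invariant: "T x \<in> ?I" if "x \<in> ?I" for x
  proof -
    have "(\<lambda>n. ?q n ((T ^^ k) \<bar>T x\<bar>)) \<longlonglongrightarrow> 0" for k
    proof (rule sandwich)
      have "(\<lambda>n. ?q n ((T ^^ Suc k) \<bar>x\<bar>)) \<longlonglongrightarrow> 0" using that by blast
      then show "(\<lambda>n. ?q n ((T ^^ k) (T \<bar>x\<bar>))) \<longlonglongrightarrow> 0" by (simp add: funpow_swap1)
    qed (auto intro: funpow_nonneg funpow_mono abs_nonneg abs_le)
    then show ?thesis by simp
  qed
  have "closed ?I"
    unfolding closed_sequential_limits
  proof (intro allI impI)
    fix f x assume f: "(\<forall>i. f i \<in> ?I) \<and> f \<longlonglongrightarrow> x"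
    obtain B where B: "B > 0" "\<And>x. \<bar>\<phi> x\<bar> \<le> B * norm x"
      using \<phi>.pos_bounded by (auto simp: mult.commute)
    have "(\<lambda>n. ?q n ((T ^^ k) \<bar>x\<bar>)) \<longlonglongrightarrow> 0" for k
    proof -
      obtain D where D: "D > 0" "\<And>x. norm ((T ^^ k) x) \<le> D * norm x"
        using bounded_linear.pos_bounded [OF funpow_bounded_linear] by (metis mult.commute)
      have q_le: "?q n ((T ^^ k) \<bar>z\<bar>) \<le> B * (\<bar>M\<bar> * (D * norm z))" for n z
      proof -
        have "norm (A n ((T ^^ k) \<bar>z\<bar>)) \<le> \<bar>M\<bar> * norm ((T ^^ k) \<bar>z\<bar>)"
          by (intro order_trans [OF average_bound] mult_right_mono) auto
        also have "\<dots> \<le> \<bar>M\<bar> * (D * norm z)"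
          using D(2) [of "\<bar>z\<bar>"] by (intro mult_left_mono) (auto simp: norm_abs)
        finally have "B * norm (A n ((T ^^ k) \<bar>z\<bar>)) \<le> B * (\<bar>M\<bar> * (D * norm z))"
          using B by (intro mult_left_mono) auto
        then show ?thesis using B(2) [of "A n ((T ^^ k) \<bar>z\<bar>)"] by linarith
      qed
      show ?thesis
      proof (rule tendstoI)
        fix e :: real assume e: "0 < e"
        have "(\<lambda>i. B * (\<bar>M\<bar> * (D * norm (x - f i)))) \<longlonglongrightarrow> B * (\<bar>M\<bar> * (D * norm (x - x)))"
          using f by (intro tendsto_intros) auto
        then have "eventually (\<lambda>i. B * (\<bar>M\<bar> * (D * norm (x - f i))) < e / 2) sequentially"
          using e by (intro order_tendstoD) auto
        then obtain i where i: "B * (\<bar>M\<bar> * (D * norm (x - f i))) < e / 2"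
          by (auto simp: eventually_sequentially)
        have "(\<lambda>n. ?q n ((T ^^ k) \<bar>f i\<bar>)) \<longlonglongrightarrow> 0" using f by blast
        then have "eventually (\<lambda>n. ?q n ((T ^^ k) \<bar>f i\<bar>) < e / 2) sequentially"
          using e by (intro order_tendstoD) auto
        then show "eventually (\<lambda>n. dist (?q n ((T ^^ k) \<bar>x\<bar>)) 0 < e) sequentially"
        proof eventually_elim
          case (elim n)
          have "?q n ((T ^^ k) \<bar>x\<bar>) \<le> ?q n ((T ^^ k) (\<bar>x - f i\<bar> + \<bar>f i\<bar>))"
            using abs_triangle [of "x - f i" "f i"] by (intro q_mono funpow_mono) simp
          also have "\<dots> < e"
            using q_le [of n "x - f i"] elim i by (simp add: pow_add average_add \<phi>.add)
          finally show ?case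
            using q_nonneg [OF funpow_nonneg [OF abs_nonneg], of n k x] by simp
        qed
      qed
    qed
    then show "x \<in> ?I" by simp
  qed
  then have "?I = {0} \<or> ?I = UNIV"
    using irreducible ideal invariant unfolding irreducible_op_def by blast
  moreover have "u \<notin> ?I"
  proof
    assume "u \<in> ?I"
    then have "(\<lambda>n. ?q n ((T ^^ 0) \<bar>u\<bar>)) \<longlonglongrightarrow> 0" by blast
    then have "(\<lambda>n. ?q n u) \<longlonglongrightarrow> 0" using u by (simp add: abs_of_nonneg)
    moreover have "norm u \<le> ?q n u" for n
      using \<phi>(2) [of "A n u - u"] average_ge [OF u(3)] \<phi>(3) by (simp add: \<phi>.diff)
    ultimately have "norm u \<le> 0" by (intro LIMSEQ_le_const) auto
    then show False using u by simp
  qed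
  moreover have "x \<in> ?I" using x by simp
  ultimately show ?thesis by blast
qed

lemma averages_tendsto:
  fixes v :: "nat \<Rightarrow> 'b::real_normed_vector"
  assumes "v \<longlonglongrightarrow> l" "\<And>n. (\<lambda>k. a n k *\<^sub>R v k) sums s n"
  shows "s \<longlonglongrightarrow> l"
  using weight_nonneg weight_sum weight_lim assms by (rule weighted_averages_tendsto)

text \<open>
  If the orbit of \<open>x\<close> tends to 0 then so do its averages, as the weights escape to infinity.
\<close>

theorem orbit_not_null:
  assumes u: "0 \<le> u" "u \<noteq> 0" "u \<le> T u" and x: "0 < x"
  shows "\<not> (\<lambda>k. (T ^^ k) x) \<longlonglongrightarrow> 0"
proof
  assume lim: "(\<lambda>k. (T ^^ k) x) \<longlonglongrightarrow> 0"
  obtain \<phi> where \<phi>: "bounded_linear \<phi>" "\<And>x. 0 \<le> x \<Longrightarrow> 0 \<le> \<phi> x" "\<phi> u = norm u"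
    using exists_positive_functional [OF u(1)] by blast
  have "(\<lambda>n. \<phi> (A n ((T ^^ j) \<bar>x\<bar>))) \<longlonglongrightarrow> 0" for j
  proof -
    have "(\<lambda>k. (T ^^ k) ((T ^^ j) x)) \<longlonglongrightarrow> 0"
      using LIMSEQ_ignore_initial_segment [OF lim, of j] by (simp add: funpow_add)
    then have "(\<lambda>n. A n ((T ^^ j) x)) \<longlonglongrightarrow> 0"
      using average by (rule averages_tendsto)
    then have "(\<lambda>n. \<phi> (A n ((T ^^ j) x))) \<longlonglongrightarrow> \<phi> 0"
      by (rule bounded_linear.tendsto [OF \<phi>(1)])
    then show ?thesis
      using x by (simp add: abs_of_nonneg linear_0 bounded_linear.linear [OF \<phi>(1)])
  qed
  then have "x = 0" by (intro average_null [OF u \<phi>])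
  then show False using x by simp
qed

text \<open>
  The numbers \<open>\<phi> (T\<^sup>k u)\<close> increase.  They are bounded by the bound for the averages, since the averages
  of the sequence truncated at an index tend to its value at this index.  Their limit is also the
  limit of \<open>\<phi> (A n (T\<^sup>j u))\<close> for every \<open>j\<close>, so \<open>T u - u\<close> is annihilated in the limit.
\<close>

theorem subharmonic_fixed:
  assumes u: "0 \<le> u" "u \<le> T u"
  shows "T u = u"
proof (cases "u = 0")
  case False
  obtain \<phi> where \<phi>: "bounded_linear \<phi>" "\<And>x. 0 \<le> x \<Longrightarrow> 0 \<le> \<phi> x" "\<phi> u = norm u"
    using exists_positive_functional [OF u(1)] by blast
  interpret \<phi>: bounded_linear \<phi> by fact
  obtain B where B: "B > 0" "\<And>x. \<bar>\<phi> x\<bar> \<le> B * norm x"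
    using \<phi>.pos_bounded by (auto simp: mult.commute)
  let ?c = "\<lambda>k. \<phi> ((T ^^ k) u)"
  have c_nonneg: "0 \<le> ?c k" for k
    using u by (intro \<phi>(2) funpow_nonneg)
  have inc: "incseq ?c"
  proof (rule incseq_SucI)
    show "?c k \<le> ?c (Suc k)" for k
      using \<phi>(2) [of "(T ^^ Suc k) u - (T ^^ k) u"] funpow_incseq [OF u(2), of k]
      by (simp add: \<phi>.diff del: funpow.simps)
  qed
  have sums: "(\<lambda>k. a n k *\<^sub>R \<phi> ((T ^^ k) x)) sums \<phi> (A n x)" for n x
    using \<phi>.sums [OF average] by (simp add: \<phi>.scaleR)
  have "?c m \<le> B * (M * norm u)" for m
  proof -
    \<comment> \<open>Truncation at \<open>m\<close> bounds the sequence and makes it eventually constant.\<close>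
    have lim: "(\<lambda>k. ?c (min k m)) \<longlonglongrightarrow> ?c m"
      by (rule tendsto_eventually, rule eventually_sequentiallyI [of m]) simp
    have le: "a n k *\<^sub>R ?c (min k m) \<le> a n k *\<^sub>R ?c k" "0 \<le> a n k *\<^sub>R ?c (min k m)" for n k
      using weight_nonneg [of n k] incseqD [OF inc, of "min k m" k] c_nonneg by (auto intro!: mult_left_mono)
    have summable: "summable (\<lambda>k. a n k *\<^sub>R ?c (min k m))" for n
      by (rule summable_comparison_test' [OF sums_summable [OF sums]]) (use le in auto)
    have "(\<lambda>n. \<Sum>k. a n k *\<^sub>R ?c (min k m)) \<longlonglongrightarrow> ?c m"
      using lim summable_sums [OF summable] by (rule averages_tendsto)
    moreover have "(\<Sum>k. a n k *\<^sub>R ?c (min k m)) \<le> B * (M * norm u)" for n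
    proof -
      have "(\<Sum>k. a n k *\<^sub>R ?c (min k m)) \<le> \<phi> (A n u)"
        using suminf_le [OF le(1) summable sums_summable [OF sums]] sums_unique [OF sums] by metis
      also have "\<dots> \<le> B * norm (A n u)" using B(2) [of "A n u"] by linarith
      also have "\<dots> \<le> B * (M * norm u)" using B by (intro mult_left_mono average_bound) auto
      finally show ?thesis .
    qed
    ultimately show ?thesis by (intro LIMSEQ_le_const2) auto
  qed
  then obtain L where L: "?c \<longlonglongrightarrow> L"
    using incseq_convergent [OF inc] by blast
  have qL: "(\<lambda>n. \<phi> (A n ((T ^^ j) u))) \<longlonglongrightarrow> L" for j
  proof (rule averages_tendsto)
    show "(\<lambda>k. \<phi> ((T ^^ k) ((T ^^ j) u))) \<longlonglongrightarrow> L"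
      using LIMSEQ_ignore_initial_segment [OF L, of j] by (simp add: funpow_add)
  qed (rule sums)
  let ?y = "T u - u"
  have "(\<lambda>n. \<phi> (A n ((T ^^ j) \<bar>?y\<bar>))) \<longlonglongrightarrow> 0" for j
  proof -
    have "(T ^^ j) \<bar>?y\<bar> = (T ^^ Suc j) u - (T ^^ j) u"
      using u by (simp add: abs_of_nonneg funpow_swap1
          linear_diff [OF bounded_linear.linear [OF funpow_bounded_linear]])
    then show ?thesis
      using tendsto_diff [OF qL [of "Suc j"] qL [of j]]
      by (simp add: average_diff \<phi>.diff del: funpow.simps)
  qed
  then have "?y = 0" by (intro average_null [OF u(1) False u(2) \<phi>])
  then show ?thesis by simp
qed (simp add: zero)

text \<open>
  The closure of the ideal generated by a positive fixed vector is invariant.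
\<close>

lemma fixed_quasi_interior:
  assumes p: "0 \<le> p" "p \<noteq> 0" "T p = p"
  shows "quasi_interior p"
proof -
  let ?I = "principal_ideal p"
  have "T ` closure ?I \<subseteq> closure ?I"
  proof (rule image_closure_subset)
    show "continuous_on (closure ?I) T"
      by (intro linear_continuous_on bounded_linear_axioms)
    have "T y \<in> ?I" if "y \<in> ?I" for y
    proof -
      obtain c where c: "\<bar>y\<bar> \<le> c *\<^sub>R p" using \<open>y \<in> ?I\<close> by (auto simp: principal_ideal_def)
      have "\<bar>T y\<bar> \<le> T (c *\<^sub>R p)" using abs_le mono [OF c] by (rule order_trans)
      then show ?thesis using p by (auto simp: scaleR principal_ideal_iff)
    qed
    then show "T ` ?I \<subseteq> closure ?I" using closure_subset by fast
  qed simp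
  moreover have "lattice_ideal (closure ?I)"
    by (intro lattice_ideal_closure lattice_ideal_principal_ideal p)
  ultimately have "closure ?I = {0} \<or> closure ?I = UNIV"
    using irreducible unfolding irreducible_op_def by (metis closed_closure)
  moreover have "p \<in> closure ?I"
  proof -
    have "\<bar>p\<bar> \<le> 1 *\<^sub>R p" using p by (simp add: abs_of_nonneg)
    then have "p \<in> ?I" unfolding principal_ideal_iff [OF p(1)] by blast
    then show ?thesis using closure_subset by blast
  qed
  ultimately show ?thesis using p by (auto simp: quasi_interior_def)
qed

text \<open>
  The modulus satisfies \<open>\<bar>z\<bar> = \<bar>T z\<bar> \<le> T \<bar>z\<bar>\<close>.
\<close>

lemma abs_eigenvector_fixed:
  assumes "T z = l *\<^sub>C z" "cmod l = 1"
  shows "T \<bar>z\<bar> = \<bar>z\<bar>"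
proof (rule subharmonic_fixed)
  show "\<bar>z\<bar> \<le> T \<bar>z\<bar>" using abs_le [of z] assms by (simp add: abs_scaleC)
qed (rule abs_nonneg)

text \<open>
  If \<open>v \<le> T v\<close> then the positive part of \<open>v\<close> is subharmonic too, hence fixed, hence quasi-interior;
  this leaves no room for the negative part, which is disjoint from it.
\<close>

lemma subharmonic_pos_part:
  assumes v: "vconj v = v" "v \<le> T v" and p: "pos_part v \<noteq> 0"
  shows "0 \<le> v" "T v = v"
proof -
  have "T (pos_part v) = pos_part v"
  proof (rule subharmonic_fixed)
    show "pos_part v \<le> T (pos_part v)"
    proof (rule pos_part_least [OF v(1)])
      show "v \<le> T (pos_part v)" using v(2) mono [OF pos_part_ge [OF v(1)]] by (rule order_trans)
    qed (intro nonneg pos_part_nonneg v)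
  qed (rule pos_part_nonneg [OF v(1)])
  then have "quasi_interior (pos_part v)"
    using v p by (intro fixed_quasi_interior pos_part_nonneg)
  moreover have "0 \<le> pos_part (- v)" by (rule pos_part_nonneg) (simp add: vconj_minus v(1))
  ultimately have "pos_part (- v) = 0" using pos_part_disjoint by (rule quasi_interior_disjoint)
  then have v_eq: "pos_part v = v" using pos_part_diff [of v] by simp
  show "0 \<le> v" using pos_part_nonneg [OF v(1)] by (simp only: v_eq)
  show "T v = v" using \<open>T (pos_part v) = pos_part v\<close> by (simp only: v_eq)
qed

lemma fixed_real_cases:
  assumes "vconj x = x" "T x = x"
  shows "0 \<le> x \<or> x \<le> 0"
  using subharmonic_pos_part (1) [of x] pos_part_zero_iff [of x] assms by auto

context
  fixes u assumes u: "0 \<le> u" "u \<noteq> 0" "T u = u"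
begin

interpretation order_unit u
  by unfold_locales (rule u)+

text \<open>
  Every real \<open>c\<close> satisfies \<open>c *\<^sub>R u \<le> x\<close> or \<open>x \<le> c *\<^sub>R u\<close>.  Both sets of numbers are closed and
  non-empty, so they meet because the line is connected.
\<close>

lemma fixed_real_multiple:
  assumes x: "vconj x = x" "T x = x"
  shows "\<exists>c. x = c *\<^sub>R u"
proof -
  let ?L = "{c. c *\<^sub>R u \<le> x}" and ?U = "{c. x \<le> c *\<^sub>R u}"
  have cover: "c \<in> ?L \<or> c \<in> ?U" for c
    using fixed_real_cases [of "x - c *\<^sub>R u"] x u
    by (auto simp: vconj_diff vconj_scaleR nonneg_real diff scaleR)
  have ne: "{c. y \<le> c *\<^sub>R u} \<noteq> {}" if "\<And>c. y \<le> c *\<^sub>R u \<or> c *\<^sub>R u \<le> y" for y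
  proof
    assume "{c. y \<le> c *\<^sub>R u} = {}"
    with that have le: "c *\<^sub>R u \<le> y" for c by blast
    have "u \<le> e *\<^sub>R y" if "e > 0" for e :: real
      using scaleR_left_mono [OF le [of "1 / e"], of e] that by simp
    then have "u \<le> 0" by (rule archimedean_le)
    then have "u = 0" using u(1) by (rule antisym)
    with u show False by simp
  qed
  have "?U \<noteq> {}" using ne [of x] cover by auto
  moreover have "?L \<noteq> {}"
  proof -
    have "- x \<le> c *\<^sub>R u \<or> c *\<^sub>R u \<le> - x" for c
      using cover [of "- c"] by (auto simp: minus_le_iff le_minus_iff)
    from ne [OF this] obtain c where "- x \<le> c *\<^sub>R u" by auto
    then have "- c \<in> ?L" by (simp add: minus_le_iff)
    then show ?thesis by blast
  qed
  moreover have "closed ?L" "closed ?U"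
  proof -
    have "closed ((\<lambda>c. x - c *\<^sub>R u) -` {x. 0 \<le> x})" "closed ((\<lambda>c. c *\<^sub>R u - x) -` {x. 0 \<le> x})"
      by (intro closed_vimage closed_nonneg continuous_intros)+
    then show "closed ?L" "closed ?U" by (simp_all add: vimage_def)
  qed
  moreover have "connected (UNIV :: real set)" by (rule connected_UNIV)
  ultimately have "?L \<inter> ?U \<noteq> {}"
    using cover unfolding connected_closed by (metis (no_types, lifting) Int_UNIV_right UnI1 UnI2 subsetI)
  then show ?thesis by (auto intro: antisym)
qed

lemma fixed_space: "ker (shift 1 T) = cspan {u}"
proof -
  have "x \<in> range (\<lambda>c. c *\<^sub>C u)" if "T x = x" for x
  proof -
    have "T (real_part x) = real_part x" "T (imag_part x) = imag_part x"
      using real_part_commutes [of x] imag_part_commutes [of x] by (simp_all add: that)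
    then obtain b c where "real_part x = b *\<^sub>R u" "imag_part x = c *\<^sub>R u"
      using fixed_real_multiple [of "real_part x"] fixed_real_multiple [of "imag_part x"] by auto
    then have "x = (of_real b + \<i> * of_real c) *\<^sub>C u"
      using real_plus_imag [of x] by (simp add: scaleR_scaleC scaleC_add_left scaleC_scaleC)
    then show ?thesis by blast
  qed
  then show ?thesis
    unfolding cvec.span_singleton ker_def shift_def using u by (auto simp: scaleC)
qed

lemma fixed_space_dim: "cdim (ker (shift 1 T)) = 1"
  unfolding fixed_space using u(2) by (rule cdim_span_singleton)

text \<open>
  If \<open>c > 0\<close> then \<open>v \<le> T v \<noteq> v\<close>, which forces \<open>v \<le> 0\<close>.  But then also
  \<open>T\<^sup>n v = v + n c u \<le> 0\<close> for all \<open>n\<close>, and \<open>u \<le> 0\<close> because the order is Archimedean.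
\<close>

lemma no_real_jordan_chain:
  assumes v: "vconj v = v" "T v = v + c *\<^sub>R u"
  shows "c = 0"
proof -
  have nonpos: "c \<le> 0" if v: "vconj v = v" "T v = v + c *\<^sub>R u" for v c
  proof (rule ccontr)
    assume "\<not> c \<le> 0"
    then have c: "0 < c" by simp
    then have Tv: "v \<le> T v" "T v \<noteq> v" using v u by (auto intro: scaleR_nonneg_nonneg)
    then have "pos_part v = 0" using subharmonic_pos_part (2) v by blast
    then have "0 \<le> - v" using v by (simp add: pos_part_zero_iff)
    have pow: "(T ^^ n) (- v) = - v - (real n * c) *\<^sub>R u" for n
    proof (induction n)
      case (Suc n)
      have "(T ^^ Suc n) (- v) = T (- v - (real n * c) *\<^sub>R u)" by (simp only: Suc funpow.simps o_apply)
      also have "\<dots> = - v - (real (Suc n) * c) *\<^sub>R u" by (simp add: diff neg scaleR u v algebra_simps)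
      finally show ?case .
    qed simp
    have "u \<le> e *\<^sub>R (- v)" if e: "e > 0" for e :: real
    proof -
      obtain n where n: "1 / (e * c) < real n" using reals_Archimedean2 by blast
      then have ne: "1 \<le> e * (real n * c)" using e c by (simp add: field_simps)
      have "0 \<le> - v - (real n * c) *\<^sub>R u"
        using funpow_nonneg [OF \<open>0 \<le> - v\<close>, of n] by (simp only: pow)
      then have "e *\<^sub>R ((real n * c) *\<^sub>R u) \<le> e *\<^sub>R (- v)"
        using e by (intro scaleR_left_mono) (simp_all only: diff_ge_0_iff_ge less_imp_le)
      moreover have "1 *\<^sub>R u \<le> (e * (real n * c)) *\<^sub>R u"
        using ne u by (intro scaleR_right_mono)
      ultimately show ?thesis by (simp only: scaleR_one scaleR_scaleR)
    qed
    then have "u \<le> 0" by (rule archimedean_le)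
    then have "u = 0" using u(1) by (rule antisym)
    with u show False by simp
  qed
  have "- c \<le> 0" using v by (intro nonpos [of "- v"]) (auto simp: vconj_minus neg)
  with nonpos [OF v] show ?thesis by simp
qed

lemma no_jordan_chain:
  assumes "shift 1 T (shift 1 T x) = 0"
  shows "shift 1 T x = 0"
proof -
  have "shift 1 T x \<in> cspan {u}" using assms unfolding fixed_space [symmetric] by (simp add: ker_def)
  then obtain c where c: "shift 1 T x = c *\<^sub>C u" by (auto simp: cvec.span_singleton)
  \<comment> \<open>With the sign in \<open>d\<close>, real and imaginary parts of \<open>T x\<close> have the form of a real Jordan chain.\<close>
  define d where "d = - c"
  have "T x = x + d *\<^sub>C u" using c by (simp add: shift_def d_def cvec.scale_minus_left algebra_simps)
  then have "T (real_part x) = real_part x + Re d *\<^sub>R u" "T (imag_part x) = imag_part x + Im d *\<^sub>R u"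
    using u(1) real_part_commutes [of x] imag_part_commutes [of x]
    by (simp_all add: real_part_add imag_part_add real_part_scaleC imag_part_scaleC real_part_real
        imag_part_real nonneg_real)
  then have "Re d = 0" "Im d = 0" using no_real_jordan_chain by (metis vconj_real_part vconj_imag_part)+
  then show ?thesis by (simp add: c d_def complex_eq_iff)
qed

lemma generalized_fixed_space: "1 \<le> n \<Longrightarrow> ker (shift 1 T ^^ n) = ker (shift 1 T)"
proof (induction n rule: dec_induct)
  case (step n)
  have "(shift 1 T ^^ Suc n) x = 0 \<longleftrightarrow> (shift 1 T ^^ n) (shift 1 T x) = 0" for x
    by (simp add: funpow_swap1)
  then have "(shift 1 T ^^ Suc n) x = 0 \<longleftrightarrow> shift 1 T (shift 1 T x) = 0" for x
    using step.IH by (auto simp: ker_def)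
  moreover have "shift 1 T 0 = 0" by (simp add: shift_def zero)
  ultimately show ?case using no_jordan_chain by (auto simp: ker_def)
qed simp

end

end

section \<open>Similarity of an operator to its rotations\<close>

lemma extend_isometry:
  fixes S :: "'a::complex_banach \<Rightarrow> 'a"
  assumes D: "csubspace D" "closure D = UNIV"
    and S: "\<And>x y. x \<in> D \<Longrightarrow> y \<in> D \<Longrightarrow> S (x + y) = S x + S y"
      "\<And>c x. x \<in> D \<Longrightarrow> S (c *\<^sub>C x) = c *\<^sub>C S x" "\<And>x. x \<in> D \<Longrightarrow> norm (S x) = norm x"
  obtains V where "bounded_clinear V" "\<And>x. x \<in> D \<Longrightarrow> V x = S x"
proof -
  have dist: "dist (S x) (S y) = dist x y" if "x \<in> D" "y \<in> D" for x y
  proof -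
    have "S (x + (-1) *\<^sub>C y) = S x + (-1) *\<^sub>C S y"
      by (simp only: S(1) [OF that(1) cvec.subspace_scale [OF D(1) that(2)]] S(2) [OF that(2)])
    then have "S (x - y) = S x - S y" by (simp add: cvec.scale_minus_left)
    moreover have "x - y \<in> D" using that D(1) by (simp add: cvec.subspace_diff)
    ultimately show ?thesis using S(3) [of "x - y"] by (simp add: dist_norm)
  qed
  then have "uniformly_continuous_on D S"
    unfolding uniformly_continuous_on_def by metis
  then obtain V where V: "uniformly_continuous_on (closure D) V" "\<And>x. x \<in> D \<Longrightarrow> S x = V x"
    using uniformly_continuous_on_extension_on_closure by metis
  then have "continuous_on UNIV V" using D by (simp add: uniformly_continuous_imp_continuous)
  then have lim: "(\<lambda>n. V (f n)) \<longlonglongrightarrow> V x" if "f \<longlonglongrightarrow> x" for f :: "nat \<Rightarrow> 'a" and x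
    using that by (simp add: continuous_on_eq_continuous_at continuous_at_sequentially o_def)
  have approx: "\<exists>f. (\<forall>n. f n \<in> D) \<and> f \<longlonglongrightarrow> x" for x
    using D(2) closure_sequential [of x D] by simp
  have "bounded_clinear V"
  proof (rule bounded_clinearI)
    fix x y :: 'a and c
    obtain f g where fg: "\<And>n. f n \<in> D" "f \<longlonglongrightarrow> x" "\<And>n. g n \<in> D" "g \<longlonglongrightarrow> y"
      using approx by metis
    have "(\<lambda>n. V (f n + g n)) \<longlonglongrightarrow> V x + V y"
      using tendsto_add [OF lim [OF fg(2)] lim [OF fg(4)]] fg(1,3) D(1)
      by (simp add: cvec.subspace_add S flip: V(2))
    then show "V (x + y) = V x + V y"
      using lim [OF tendsto_add [OF fg(2,4)]] LIMSEQ_unique by blast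
    have "(\<lambda>n. V (c *\<^sub>C f n)) \<longlonglongrightarrow> c *\<^sub>C V x"
      using tendsto_scaleC [OF tendsto_const [of c] lim [OF fg(2)]] fg(1) D(1)
      by (simp add: cvec.subspace_scale S flip: V(2))
    then show "V (c *\<^sub>C x) = c *\<^sub>C V x"
      using lim [OF tendsto_scaleC [OF tendsto_const fg(2)]] LIMSEQ_unique by blast
    have "(\<lambda>n. norm (V (f n))) \<longlonglongrightarrow> norm x"
      using tendsto_norm [OF fg(2)] fg(1) by (simp add: S flip: V(2))
    then show "norm (V x) \<le> norm x * 1"
      using tendsto_norm [OF lim [OF fg(2)]] LIMSEQ_unique by fastforce
  qed
  with V(2) that show ?thesis by metis
qed

lemma eq_on_dense:
  fixes f g :: "'a::metric_space \<Rightarrow> 'b::t2_space"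
  assumes "closure D = UNIV" "continuous_on UNIV f" "continuous_on UNIV g" "\<And>x. x \<in> D \<Longrightarrow> f x = g x"
  shows "f x = g x"
proof -
  have "closed {x. f x = g x}" using assms by (intro closed_Collect_eq)
  then have "closure D \<subseteq> {x. f x = g x}" using assms by (intro closure_minimal) auto
  then show ?thesis using assms by auto
qed

lemma bounded_clinear_continuous: "bounded_clinear V \<Longrightarrow> continuous_on S V"
  by (intro linear_continuous_on bounded_clinear_bounded)

lemma bounded_clinear_compose: "bounded_clinear f \<Longrightarrow> bounded_clinear g \<Longrightarrow> bounded_clinear (\<lambda>x. f (g x))"
  unfolding bounded_clinear_def by (auto intro: bounded_linear_compose)

lemma bounded_clinear_scaled: "bounded_clinear f \<Longrightarrow> bounded_clinear (\<lambda>x. c *\<^sub>C f x)"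
  unfolding bounded_clinear_def
  by (auto intro: bounded_linear_compose [OF bounded_linear_scaleC_right] simp: scaleC_scaleC mult.commute)

text \<open>
  For a peripheral eigenvalue \<open>l\<close> the isomorphism \<open>V\<close> is the multiplication by an eigenvector.
\<close>

locale rotation = bounded_operator T for T :: "'a::complex_banach \<Rightarrow> 'a" +
  fixes V W :: "'a \<Rightarrow> 'a" and l :: complex
  assumes V: "bounded_clinear V" and W: "bounded_clinear W"
    and VW: "V (W x) = x" and WV: "W (V x) = x"
    and intertwines: "T (V x) = l *\<^sub>C V (T x)" and nonzero: "l \<noteq> 0"
begin

lemmas V_scaleC = bounded_clinear_scaleC [OF V]
lemmas W_scaleC = bounded_clinear_scaleC [OF W]

lemma bij: "bij V"
  by (rule bij_betw_byWitness [where f' = W]) (auto simp: VW WV)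

lemma inverse: "rotation T W V (1 / l)"
proof
  show "T (W x) = (1 / l) *\<^sub>C W (T x)" for x
  proof -
    have "T x = l *\<^sub>C V (T (W x))" using intertwines [of "W x"] by (simp add: VW)
    then show ?thesis using nonzero by (simp add: W_scaleC WV scaleC_scaleC)
  qed
qed (use V W VW WV nonzero in auto)

lemma shift_rotated: "shift (l * m) T (V x) = l *\<^sub>C V (shift m T x)"
proof -
  have "V (m *\<^sub>C x - T x) = m *\<^sub>C V x - V (T x)"
    using V by (simp add: V_scaleC linear_diff [OF bounded_linear.linear [OF bounded_clinear_bounded]])
  then show ?thesis by (simp add: shift_def intertwines cvec.scale_right_diff_distrib scaleC_scaleC)
qed

lemma similar: "similar_op T (\<lambda>x. l *\<^sub>C T x)"
proof -
  have "inv V = W" by (rule inv_unique_comp) (auto simp: fun_eq_iff VW WV)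
  then have "(\<lambda>x. l *\<^sub>C T x) = inv V \<circ> T \<circ> V"
    by (simp add: fun_eq_iff intertwines W_scaleC WV)
  then show ?thesis unfolding similar_op_def using V bij by blast
qed

lemma resolvent_set_rotated:
  assumes "m \<notin> spectrum T" shows "l * m \<notin> spectrum T"
proof -
  let ?S = "resolvent m"
  note R = bounded_clinear_resolvent [OF assms] resolvent_shift [OF assms] shift_resolvent [OF assms]
  let ?R = "\<lambda>x. (1 / l) *\<^sub>C V (?S (W x))"
  have "bounded_clinear ?R"
    by (rule bounded_clinear_scaled [OF bounded_clinear_compose [OF V bounded_clinear_compose [OF R(1) W]]])
  moreover have "shift (l * m) T (?R x) = x" for x
    using nonzero by (simp add: shift_scaleC shift_rotated R VW scaleC_scaleC)
  moreover have "?R (shift (l * m) T x) = x" for x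
    using shift_rotated [of m "W x"] nonzero
    by (simp add: VW W_scaleC WV R bounded_clinear_scaleC [OF R(1)] V_scaleC scaleC_scaleC)
  ultimately have "bounded_clinear ?R \<and> ?R \<circ> shift (l * m) T = id \<and> shift (l * m) T \<circ> ?R = id"
    by (simp add: fun_eq_iff)
  then show ?thesis unfolding spectrum_def by blast
qed

lemma point_spectrum_rotated:
  assumes "m \<in> point_spectrum T" shows "l * m \<in> point_spectrum T"
proof -
  obtain x where x: "x \<noteq> 0" "T x = m *\<^sub>C x" using assms by (auto simp: point_spectrum_def)
  have "V x \<noteq> 0"
    using x WV [of x] W_scaleC [of 0 0] by auto
  moreover have "T (V x) = (l * m) *\<^sub>C V x" by (simp add: intertwines x V_scaleC scaleC_scaleC)
  ultimately show ?thesis by (auto simp: point_spectrum_def)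
qed

lemma kernel_rotated: "ker (shift l T ^^ n) = V ` ker (shift 1 T ^^ n)"
proof -
  have pow: "(shift l T ^^ n) (V x) = l ^ n *\<^sub>C V ((shift 1 T ^^ n) x)" for x
  proof (induction n)
    case (Suc n)
    then show ?case using shift_rotated [of 1 "(shift 1 T ^^ n) x"] by (simp add: shift_scaleC scaleC_scaleC mult.commute)
  qed simp
  have V0: "V x = 0 \<longleftrightarrow> x = 0" for x
    using WV [of x] W_scaleC [of 0 0] V_scaleC [of 0 0] by auto
  show ?thesis
  proof (intro equalityI subsetI)
    fix y assume "y \<in> ker (shift l T ^^ n)"
    then have "W y \<in> ker (shift 1 T ^^ n)" using pow [of "W y"] nonzero by (simp add: ker_def VW V0)
    then show "y \<in> V ` ker (shift 1 T ^^ n)" using VW [of y] by (metis imageI)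
  qed (auto simp: ker_def pow V0)
qed

end

lemma (in rotation)
  shows spectrum_rotated: "(\<lambda>m. l * m) ` spectrum T = spectrum T"
    and point_spectrum_rotated_eq: "(\<lambda>m. l * m) ` point_spectrum T = point_spectrum T"
proof -
  interpret inv: rotation T W V "1 / l" by (rule inverse)
  have l: "l * (m / l) = m" "1 / l * (l * m) = m" "1 / l * m = m / l" for m using nonzero by auto
  show "(\<lambda>m. l * m) ` spectrum T = spectrum T"
  proof (intro equalityI subsetI)
    fix m assume "m \<in> (\<lambda>m. l * m) ` spectrum T"
    then show "m \<in> spectrum T" using inv.resolvent_set_rotated l by force
  next
    fix m assume "m \<in> spectrum T"
    then have "m / l \<in> spectrum T" using resolvent_set_rotated [of "m / l"] l by auto
    then show "m \<in> (\<lambda>m. l * m) ` spectrum T" using l(1) [of m] by (metis imageI)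
  qed
  show "(\<lambda>m. l * m) ` point_spectrum T = point_spectrum T"
  proof (intro equalityI subsetI)
    fix m assume "m \<in> (\<lambda>m. l * m) ` point_spectrum T"
    then show "m \<in> point_spectrum T" using point_spectrum_rotated by auto
  next
    fix m assume "m \<in> point_spectrum T"
    then have "m / l \<in> point_spectrum T" using inv.point_spectrum_rotated [of m] by (simp add: l)
    then show "m \<in> (\<lambda>m. l * m) ` point_spectrum T" using l(1) [of m] by (metis imageI)
  qed
qed

context averaged_irreducible
begin

context
  fixes z l
  assumes eigen: "T z = l *\<^sub>C z" and unimodular: "cmod l = 1" and z_nonzero: "z \<noteq> 0"
begin

interpretation order_unit "\<bar>z\<bar>"
  by unfold_locales (use z_nonzero in \<open>auto simp: abs_nonneg abs_zero_eq\<close>)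

lemma z_in: "z \<in> E"
  unfolding principal_ideal_iff [OF nonneg] by (intro exI [of _ 1]) simp

lemma T_in:
  assumes "x \<in> E" shows "T x \<in> E"
proof -
  obtain c where c: "\<bar>x\<bar> \<le> c *\<^sub>R \<bar>z\<bar>" using assms by (auto simp: principal_ideal_def)
  have "\<bar>T x\<bar> \<le> T (c *\<^sub>R \<bar>z\<bar>)" using abs_le mono [OF c] by (rule order_trans)
  then show ?thesis
    unfolding principal_ideal_iff [OF nonneg] using abs_eigenvector_fixed [OF eigen unimodular] by (auto simp: scaleR)
qed

lemma character_unimodular:
  assumes "\<phi> \<in> K" shows "cmod (\<phi> z) = 1"
  using character_abs [OF assms z_in] character_unit [OF assms] by (metis norm_one norm_of_real abs_norm_cancel)

text \<open>
  At a character \<open>\<phi>\<close> put \<open>c = l * \<phi> z\<close>, a number of modulus 1.  The functional \<open>\<phi> \<circ> T\<close> takes the value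
  \<open>c\<close> at \<open>z\<close> and 1 at the unit, so it annihilates the positive vector \<open>v = \<bar>z\<bar> - Re (c\<^sup>* z)\<close>, where \<open>c\<^sup>*\<close>
  is the conjugate of \<open>c\<close>.  As a function, \<open>2 v\<close> is the square of \<open>\<bar>z - c\<bar>\<close>.  Hence \<open>\<phi> \<circ> T\<close> annihilates
  \<open>\<bar>z - c\<bar>\<close> as well, by the inequality \<open>r \<le> e + r\<^sup>2 / e\<close>, and does not distinguish \<open>z f\<close> from \<open>c f\<close>.
\<close>

lemma mult_intertwines:
  assumes f: "f \<in> E"
  shows "T (mult z f) = l *\<^sub>C mult z (T f)"
proof (rule eq_if_characters)
  fix \<phi> assume \<phi>: "\<phi> \<in> K"
  define c where "c = l * \<phi> z"
  have c: "cmod c = 1" by (simp add: c_def norm_mult unimodular character_unimodular [OF \<phi>])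
  define w where "w = z - c *\<^sub>C \<bar>z\<bar>"
  have w: "w \<in> E" using z_in by (auto simp: w_def)
  let ?v = "\<bar>z\<bar> - real_part (cnj c *\<^sub>C z)"
  have v: "?v \<in> E" using z_in by auto
  have "\<phi> (T ?v) = 0"
  proof -
    have "T ?v = \<bar>z\<bar> - real_part ((cnj c * l) *\<^sub>C z)"
      using abs_eigenvector_fixed [OF eigen unimodular]
      by (simp add: diff scaleC eigen scaleC_scaleC flip: real_part_commutes)
    then have "\<phi> (T ?v) = 1 - of_real (Re (cnj c * c))"
      using z_in by (simp add: character_diff [OF \<phi>] character_unit [OF \<phi>] character_real_part [OF \<phi>]
          character_scaleC [OF \<phi>] c_def mult.assoc)
    also have "cnj c * c = 1" using c by (metis complex_norm_square mult.commute of_real_1 power_one)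
    finally show ?thesis by simp
  qed
  have w_le: "\<bar>w\<bar> \<le> e *\<^sub>R \<bar>z\<bar> + (2 / e) *\<^sub>R ?v" if e: "e > 0" for e
  proof (rule le_if_characters)
    fix \<psi> assume \<psi>: "\<psi> \<in> K"
    define s where "s = \<psi> z"
    have s: "cmod s = 1" by (simp add: s_def character_unimodular [OF \<psi>])
    have "(cmod (s - c))\<^sup>2 = 2 * (1 - Re (cnj c * s))"
    proof -
      have "(Re s)\<^sup>2 + (Im s)\<^sup>2 = 1" "(Re c)\<^sup>2 + (Im c)\<^sup>2 = 1"
        using s c cmod_power2 [of s] cmod_power2 [of c] by simp_all
      then show ?thesis unfolding cmod_power2 by (simp add: power2_eq_square algebra_simps)
    qed
    moreover have "r \<le> e + r\<^sup>2 / e" if "0 \<le> r" for r :: real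
    proof (cases "r \<le> e")
      case False
      then have "r * e \<le> r * r" using that by (intro mult_left_mono) auto
      then have "r \<le> r\<^sup>2 / e" using e by (simp add: field_simps power2_eq_square)
      then show ?thesis using e by simp
    qed (use e in \<open>auto intro: add_increasing2\<close>)
    ultimately have le: "cmod (s - c) \<le> e + (2 / e) * (1 - Re (cnj c * s))"
      by (metis norm_ge_zero times_divide_eq_left)
    have "\<psi> \<bar>w\<bar> = of_real (cmod (s - c))"
      using w z_in by (simp add: character_abs [OF \<psi>])
        (simp add: w_def s_def character_diff [OF \<psi>] character_scaleC [OF \<psi>] character_unit [OF \<psi>])
    moreover have "\<psi> (e *\<^sub>R \<bar>z\<bar> + (2 / e) *\<^sub>R ?v) = of_real (e + (2 / e) * (1 - Re (cnj c * s)))"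
      using z_in by (simp add: s_def character_add [OF \<psi>] character_diff [OF \<psi>] character_scaleR [OF \<psi>]
          character_scaleC [OF \<psi>] character_unit [OF \<psi>] character_real_part [OF \<psi>])
    ultimately show "\<psi> \<bar>w\<bar> \<le> \<psi> (e *\<^sub>R \<bar>z\<bar> + (2 / e) *\<^sub>R ?v)"
      using le by (simp only: less_eq_complex_def Re_complex_of_real Im_complex_of_real)
  qed (use w z_in in auto)
  have Re_mono: "Re (\<phi> x) \<le> Re (\<phi> y)" if "x \<in> E" "y \<in> E" "x \<le> y" for x y
    using character_mono [OF \<phi> that] by (simp add: less_eq_complex_def)
  have "Re (\<phi> (T \<bar>w\<bar>)) \<le> 0"
  proof (rule field_le_epsilon)
    fix e :: real assume e: "0 < e"
    have "Re (\<phi> (T \<bar>w\<bar>)) \<le> Re (\<phi> (T (e *\<^sub>R \<bar>z\<bar> + (2 / e) *\<^sub>R ?v)))"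
      using w z_in v by (intro Re_mono T_in mono w_le e) auto
    also have "T (e *\<^sub>R \<bar>z\<bar> + (2 / e) *\<^sub>R ?v) = e *\<^sub>R \<bar>z\<bar> + (2 / e) *\<^sub>R T ?v"
      using abs_eigenvector_fixed [OF eigen unimodular] by (simp only: add scaleR)
    also have "\<phi> \<dots> = of_real e"
      using T_in [OF v] \<open>\<phi> (T ?v) = 0\<close>
      by (simp add: character_add [OF \<phi>] character_scaleR [OF \<phi>] character_unit [OF \<phi>])
    finally show "Re (\<phi> (T \<bar>w\<bar>)) \<le> 0 + e" by simp
  qed
  obtain d where d: "\<bar>f\<bar> \<le> d *\<^sub>R \<bar>z\<bar>" "d > 0" using f by (auto simp: principal_ideal_def)
  have wf: "\<bar>mult z f - c *\<^sub>C f\<bar> \<le> d *\<^sub>R \<bar>w\<bar>"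
  proof (rule le_if_characters)
    fix \<psi> assume \<psi>: "\<psi> \<in> K"
    have "\<psi> \<bar>f\<bar> \<le> \<psi> (d *\<^sub>R \<bar>z\<bar>)" using f z_in d by (intro character_mono [OF \<psi>]) auto
    then have "cmod (\<psi> f) \<le> d"
      using f z_in by (simp add: character_abs [OF \<psi>] character_scaleR [OF \<psi>] character_unit [OF \<psi>] less_eq_complex_def)
    then have "cmod (\<psi> z - c) * cmod (\<psi> f) \<le> d * cmod (\<psi> z - c)"
      by (simp add: mult.commute [of "cmod (\<psi> z - c)"] mult_right_mono)
    moreover have "\<psi> (mult z f - c *\<^sub>C f) = (\<psi> z - c) * \<psi> f"
      using f z_in by (simp add: character_diff [OF \<psi>] character_scaleC [OF \<psi>] character_mult [OF _ _ \<psi>] algebra_simps)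
    moreover have "\<psi> w = \<psi> z - c"
      using z_in by (simp add: w_def character_diff [OF \<psi>] character_scaleC [OF \<psi>] character_unit [OF \<psi>])
    ultimately show "\<psi> \<bar>mult z f - c *\<^sub>C f\<bar> \<le> \<psi> (d *\<^sub>R \<bar>w\<bar>)"
      using f z_in w by (simp add: character_abs [OF \<psi>] character_scaleR [OF \<psi>] norm_mult less_eq_complex_def)
  qed (use f z_in w in auto)
  have g: "mult z f - c *\<^sub>C f \<in> E" using f z_in by auto
  have "cmod (\<phi> (T (mult z f - c *\<^sub>C f))) = Re (\<phi> \<bar>T (mult z f - c *\<^sub>C f)\<bar>)"
    using character_abs [OF \<phi> T_in [OF g]] by simp
  also have "\<dots> \<le> Re (\<phi> (T \<bar>mult z f - c *\<^sub>C f\<bar>))"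
    using g by (intro Re_mono abs_le T_in) (auto intro: T_in)
  also have "\<dots> \<le> Re (\<phi> (T (d *\<^sub>R \<bar>w\<bar>)))"
    using g w by (intro Re_mono mono wf T_in) auto
  also have "\<dots> = d * Re (\<phi> (T \<bar>w\<bar>))"
    using w T_in [of "\<bar>w\<bar>"] by (simp add: scaleR character_scaleR [OF \<phi>])
  also have "\<dots> \<le> 0" using \<open>Re (\<phi> (T \<bar>w\<bar>)) \<le> 0\<close> d by (simp add: mult_nonneg_nonpos)
  finally have "\<phi> (T (mult z f - c *\<^sub>C f)) = 0" by simp
  then have "\<phi> (T (mult z f)) = c * \<phi> (T f)"
    using f z_in T_in [of "mult z f"] T_in [OF f]
    by (simp add: diff scaleC character_diff [OF \<phi>] character_scaleC [OF \<phi>])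
  also have "\<dots> = \<phi> (l *\<^sub>C mult z (T f))"
    using z_in T_in [OF f] by (simp add: c_def character_scaleC [OF \<phi>] character_mult [OF _ _ \<phi>])
  finally show "\<phi> (T (mult z f)) = \<phi> (l *\<^sub>C mult z (T f))" .
qed (use f z_in T_in in auto)

lemma mult_isometry:
  assumes y: "y \<in> E" "\<bar>y\<bar> = \<bar>z\<bar>"
  obtains V where "bounded_clinear V" "\<And>x. x \<in> E \<Longrightarrow> V x = mult y x"
proof (rule extend_isometry [of E "mult y"])
  show "csubspace E" using ideal by (simp add: lattice_ideal_def)
  show "closure E = UNIV"
    using fixed_quasi_interior [of "\<bar>z\<bar>"] abs_eigenvector_fixed [OF eigen unimodular] z_nonzero
    by (simp add: abs_nonneg abs_zero_eq quasi_interior_def)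
  show "mult y (v + w) = mult y v + mult y w" if "v \<in> E" "w \<in> E" for v w
    using that y(1) by (intro eq_if_characters) (auto simp: character_add character_mult algebra_simps)
  show "mult y (c *\<^sub>C v) = c *\<^sub>C mult y v" if "v \<in> E" for c v
    using that y(1) by (intro eq_if_characters) (auto simp: character_scaleC character_mult)
  show "norm (mult y v) = norm v" if v: "v \<in> E" for v
  proof -
    have "\<bar>mult y v\<bar> = \<bar>v\<bar>"
    proof (rule eq_if_characters)
      fix \<phi> assume \<phi>: "\<phi> \<in> K"
      have "cmod (\<phi> y) = 1"
        using character_abs [OF \<phi> y(1)] character_unit [OF \<phi>] y(2) by (metis norm_one norm_of_real abs_norm_cancel)
      then show "\<phi> \<bar>mult y v\<bar> = \<phi> \<bar>v\<bar>"
        using v y(1) by (simp add: character_abs [OF \<phi>] character_mult [OF _ _ \<phi>] norm_mult)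
    qed (use v y in auto)
    then show ?thesis by (metis norm_abs)
  qed
qed (use that in blast)

text \<open>
  Multiplication by \<open>z\<close>, with inverse the multiplication by the conjugate of \<open>z\<close>, is an isometry of a
  dense ideal.
\<close>

theorem eigenvector_rotation: "\<exists>V W. rotation T V W l"
proof -
  obtain V where V: "bounded_clinear V" "\<And>x. x \<in> E \<Longrightarrow> V x = mult z x"
    using mult_isometry [OF z_in refl] by metis
  have z': "vconj z \<in> E" using z_in by auto
  obtain W where W: "bounded_clinear W" "\<And>x. x \<in> E \<Longrightarrow> W x = mult (vconj z) x"
    using mult_isometry [OF z' abs_vconj] by metis
  have dense: "closure E = UNIV"
    using fixed_quasi_interior [of "\<bar>z\<bar>"] abs_eigenvector_fixed [OF eigen unimodular] z_nonzero
    by (simp add: abs_nonneg abs_zero_eq quasi_interior_def)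
  have cancel: "\<phi> z * (cnj (\<phi> z) * c) = c" if "\<phi> \<in> K" for \<phi> c
  proof -
    have "\<phi> z * cnj (\<phi> z) = 1" using character_unimodular [OF that] by (metis complex_norm_square of_real_1 power_one)
    then show ?thesis by (simp flip: mult.assoc)
  qed
  have "rotation T V W l"
  proof
    fix x
    show "V (W x) = x"
    proof (rule eq_on_dense [where f = "\<lambda>x. V (W x)" and g = "\<lambda>x. x", OF dense])
      show "V (W x) = x" if "x \<in> E" for x
        using that z_in z' unfolding W(2) [OF that] V(2) [OF mult_in [OF z' that]]
        by (intro eq_if_characters) (auto simp: character_mult character_vconj cancel)
    qed (rule bounded_clinear_continuous [OF bounded_clinear_compose [OF V(1) W(1)]] continuous_on_id)+
    show "W (V x) = x"
    proof (rule eq_on_dense [where f = "\<lambda>x. W (V x)" and g = "\<lambda>x. x", OF dense])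
      show "W (V x) = x" if "x \<in> E" for x
        using that z_in z' unfolding V(2) [OF that] W(2) [OF mult_in [OF z_in that]]
        by (intro eq_if_characters) (auto simp: character_mult character_vconj cancel mult.left_commute [of "cnj _"])
    qed (rule bounded_clinear_continuous [OF bounded_clinear_compose [OF W(1) V(1)]] continuous_on_id)+
    show "T (V x) = l *\<^sub>C V (T x)"
    proof (rule eq_on_dense [where f = "\<lambda>x. T (V x)" and g = "\<lambda>x. l *\<^sub>C V (T x)", OF dense])
      show "T (V x) = l *\<^sub>C V (T x)" if "x \<in> E" for x
        using mult_intertwines [OF that] by (simp add: V T_in that)
    qed (rule bounded_clinear_continuous [OF bounded_clinear_compose [OF bounded_clinear V(1)]]
        bounded_clinear_continuous [OF bounded_clinear_scaled [OF bounded_clinear_compose [OF V(1) bounded_clinear]]])+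
  qed (use V W unimodular in auto)
  then show ?thesis by blast
qed

end

end

section \<open>The peripheral point spectrum\<close>

lemma group_unit_circle: "Group.group unit_circle_group"
proof (rule groupI)
  fix x assume "x \<in> carrier unit_circle_group"
  moreover from this have "x \<noteq> 0" by (auto simp: unit_circle_group_def)
  ultimately show "\<exists>y\<in>carrier unit_circle_group. y \<otimes>\<^bsub>unit_circle_group\<^esub> x = \<one>\<^bsub>unit_circle_group\<^esub>"
    by (intro bexI [of _ "inverse x"]) (auto simp: unit_circle_group_def norm_inverse)
qed (auto simp: unit_circle_group_def norm_mult)

lemma subgroup_unit_circleI:
  assumes "H \<subseteq> sphere 0 1" "1 \<in> H" "\<And>x y. x \<in> H \<Longrightarrow> y \<in> H \<Longrightarrow> x * y \<in> H" "\<And>x. x \<in> H \<Longrightarrow> inverse x \<in> H"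
  shows "subgroup H unit_circle_group"
proof
  fix x assume x: "x \<in> H"
  then have "cmod x = 1" using assms(1) by auto
  moreover from this have "x \<noteq> 0" by auto
  ultimately have "m_inv unit_circle_group x = inverse x"
    by (intro group.inv_equality [OF group_unit_circle]) (auto simp: unit_circle_group_def norm_inverse)
  then show "m_inv unit_circle_group x \<in> H" using assms x by simp
qed (use assms in \<open>auto simp: unit_circle_group_def\<close>)

theorem theorem5p6:
  fixes T :: "'a::complex_banach_lattice \<Rightarrow> 'a"
  assumes "bounded_clinear T"
    and "spectral_radius T = 1"
    and "positive_op T"
    and "irreducible_op T"
    and "peripheral_point_spectrum T \<noteq> {}"
    and "ws_bounded TYPE('j) T"
  shows
    "(\<forall>x>0. \<not> (\<lambda>k. (T ^^ k) x) \<longlonglongrightarrow> 0) \<and>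
     (\<forall>l\<in>peripheral_point_spectrum T. \<forall>z\<in>ker (shift l T). \<bar>z\<bar> \<in> ker (shift 1 T)) \<and>
     (1 \<in> point_spectrum T \<and>
      closed_sublattice (ker (shift 1 T)) \<and>
      cdim (ker (shift 1 T)) = 1 \<and>
      (\<exists>x. quasi_interior x \<and> ker (shift 1 T) = cspan {x})) \<and>
     (\<forall>l\<in>peripheral_point_spectrum T.
        similar_op T (\<lambda>x. l *\<^sub>C T x) \<and>
        (\<lambda>m. l * m) ` spectrum T = spectrum T \<and>
        (\<lambda>m. l * m) ` point_spectrum T = point_spectrum T) \<and>
     subgroup (peripheral_point_spectrum T) unit_circle_group \<and>
     (\<forall>l\<in>peripheral_point_spectrum T.
        cdim (\<Union>n\<in>{1..}. ker (shift l T ^^ n)) = 1 \<and> cdim (ker (shift l T)) = 1) \<and>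
     (\<forall>m. (\<exists>z. 0 \<le> z \<and> z \<noteq> 0 \<and> T z = m *\<^sub>C z) \<longleftrightarrow> m = 1)"
proof -
  interpret positive_operator T
    by unfold_locales fact+
  obtain a A M where averages: "\<And>n k. 0 \<le> a n k" "\<And>n. a n sums 1" "\<And>k. (\<lambda>n. a n k) \<longlonglongrightarrow> (0::real)"
    "\<And>n x. (\<lambda>k. a n k *\<^sub>R (T ^^ k) x) sums A n x" "\<And>n x. norm (A n x) \<le> M * norm x"
    using ws_bounded_averages [OF assms(2,6)] by blast
  interpret averaged_irreducible T a A M
    by unfold_locales (rule averages assms)+
  let ?P = "peripheral_point_spectrum T"
  have P: "l \<in> ?P \<longleftrightarrow> l \<in> point_spectrum T \<and> cmod l = 1" for l
    using point_spectrum_subset assms(2)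
    by (auto simp: peripheral_point_spectrum_def peripheral_spectrum_def)
  have ker_iff: "x \<in> ker (shift l T) \<longleftrightarrow> T x = l *\<^sub>C x" for l x
    by (auto simp: ker_def shift_def)
  obtain l\<^sub>0 z\<^sub>0 where z0: "cmod l\<^sub>0 = 1" "z\<^sub>0 \<noteq> 0" "T z\<^sub>0 = l\<^sub>0 *\<^sub>C z\<^sub>0"
    using assms(5) P by (auto simp: point_spectrum_def)
  define u where "u = \<bar>z\<^sub>0\<bar>"
  have u: "0 \<le> u" "u \<noteq> 0" "T u = u"
    using z0 abs_eigenvector_fixed by (auto simp: u_def abs_nonneg abs_zero_eq)
  note span = fixed_space [OF u]
  have a: "\<forall>x>0. \<not> (\<lambda>k. (T ^^ k) x) \<longlonglongrightarrow> 0"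
    using orbit_not_null [OF u(1,2)] u(3) by simp
  have b: "\<forall>l\<in>?P. \<forall>z\<in>ker (shift l T). \<bar>z\<bar> \<in> ker (shift 1 T)"
    using abs_eigenvector_fixed by (auto simp: P ker_iff)
  have one: "1 \<in> point_spectrum T"
    using u by (auto simp: point_spectrum_def)
  have sublattice: "closed_sublattice (ker (shift 1 T))"
    unfolding closed_sublattice_def
  proof (intro conjI ballI)
    show "csubspace (ker (shift 1 T))" unfolding span by (rule cvec.subspace_span)
    have "closed {x. x = T x}"
      by (intro closed_Collect_eq linear_continuous_on bounded_linear_axioms continuous_on_id)
    then show "closed (ker (shift 1 T))" by (simp add: ker_def shift_def)
    fix f assume f: "f \<in> ker (shift 1 T)"
    then obtain c where "f = c *\<^sub>C u" unfolding span by (auto simp: cvec.span_singleton)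
    then have "vconj f = cnj c *\<^sub>C u" using u by (simp add: vconj_scaleC nonneg_real)
    then show "vconj f \<in> ker (shift 1 T)" using u by (simp add: ker_iff scaleC)
    show "\<bar>f\<bar> \<in> ker (shift 1 T)" using f abs_eigenvector_fixed [of f 1] by (simp add: ker_iff)
  qed
  have rotation: "\<exists>V W. rotation T V W l" if "l \<in> ?P" for l
    using that eigenvector_rotation by (auto simp: P point_spectrum_def)
  have d: "similar_op T (\<lambda>x. l *\<^sub>C T x) \<and> (\<lambda>m. l * m) ` spectrum T = spectrum T \<and>
        (\<lambda>m. l * m) ` point_spectrum T = point_spectrum T" if "l \<in> ?P" for l
    using rotation [OF that] rotation.similar rotation.spectrum_rotated rotation.point_spectrum_rotated_eq
    by blast
  have e: "subgroup ?P unit_circle_group"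
  proof (rule subgroup_unit_circleI)
    show "?P \<subseteq> sphere 0 1" "1 \<in> ?P" using one by (auto simp: P)
    fix x assume x: "x \<in> ?P"
    show "x * y \<in> ?P" if "y \<in> ?P" for y
      using d [OF x] that x by (auto simp: P norm_mult)
    obtain m where "m \<in> point_spectrum T" "1 = x * m" using d [OF x] one by blast
    moreover from this have "inverse x = m" by (metis inverse_unique)
    ultimately show "inverse x \<in> ?P" using x by (auto simp: P norm_inverse)
  qed
  have f: "cdim (\<Union>n\<in>{1..}. ker (shift l T ^^ n)) = 1 \<and> cdim (ker (shift l T)) = 1" if l: "l \<in> ?P" for l
  proof -
    obtain V W where "rotation T V W l" using rotation [OF l] by blast
    then interpret rotation T V W l .
    have ker: "ker (shift l T ^^ n) = cspan {V u}" if "n \<ge> 1" for n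
    proof -
      have "ker (shift l T ^^ n) = V ` cspan {u}"
        by (simp only: kernel_rotated generalized_fixed_space [OF u that] span)
      also have "\<dots> = cspan {V u}" by (auto simp: cvec.span_singleton V_scaleC image_image)
      finally show ?thesis .
    qed
    have "V u \<noteq> 0" using u(2) WV [of u] W_scaleC [of 0 0] by auto
    moreover have "(\<Union>n\<in>{1..}. ker (shift l T ^^ n)) = cspan {V u}" using ker by auto
    moreover have "ker (shift l T) = cspan {V u}" using ker [of 1] by simp
    ultimately show ?thesis by (simp only: cdim_span_singleton simp_thms)
  qed
  have g: "(\<exists>z. 0 \<le> z \<and> z \<noteq> 0 \<and> T z = m *\<^sub>C z) \<longleftrightarrow> m = 1" for m
  proof
    assume "\<exists>z. 0 \<le> z \<and> z \<noteq> 0 \<and> T z = m *\<^sub>C z"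
    then obtain z where z: "0 \<le> z" "z \<noteq> 0" "T z = m *\<^sub>C z" by blast
    have Tz: "0 \<le> m *\<^sub>C z" using nonneg [OF z(1)] z(3) by simp
    then have "cnj m *\<^sub>C z = m *\<^sub>C z" using nonneg_real [of "m *\<^sub>C z"] z(1) by (simp add: vconj_scaleC nonneg_real)
    then have "(cnj m - m) *\<^sub>C z = 0" by (simp add: cvec.scale_left_diff_distrib)
    then have "cnj m = m" using z(2) by simp
    then have m: "m = of_real (Re m)" by (simp add: complex_eq_iff)
    have "0 \<le> Re m *\<^sub>R z" using Tz by (subst (asm) m) (simp add: scaleC_of_real)
    then have m0: "0 \<le> Re m" using z by (intro nonneg_scaleR_cancel)
    have "m \<in> spectrum T" using z point_spectrum_subset by (auto simp: point_spectrum_def)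
    then have "cmod m \<le> 1" using le_spectral_radius assms(2) by fastforce
    moreover have "\<not> cmod m < 1"
    proof
      assume "cmod m < 1"
      then have "(\<lambda>k. m ^ k *\<^sub>C z) \<longlonglongrightarrow> 0 *\<^sub>C z"
        by (intro tendsto_scaleC LIMSEQ_power_zero tendsto_const)
      moreover have "(T ^^ k) z = m ^ k *\<^sub>C z" for k
        by (induction k) (auto simp: scaleC z scaleC_scaleC mult.commute)
      ultimately have "(\<lambda>k. (T ^^ k) z) \<longlonglongrightarrow> 0" by simp
      moreover have "0 < z" using z by (simp add: less_le)
      ultimately show False using a by blast
    qed
    ultimately have "cmod m = 1" by simp
    moreover have "cmod m = \<bar>Re m\<bar>" by (subst m) (rule norm_of_real)
    ultimately have "Re m = 1" using m0 by simp
    then show "m = 1" by (subst m) simp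
  next
    assume "m = 1"
    then show "\<exists>z. 0 \<le> z \<and> z \<noteq> 0 \<and> T z = m *\<^sub>C z" using u by auto
  qed
  have "cdim (ker (shift 1 T)) = 1" "quasi_interior u"
    using fixed_space_dim [OF u] fixed_quasi_interior [OF u] by auto
  with a b one sublattice d e f g span show ?thesis by blast
qed

end
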